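(* Let $L=\partial_t+\sum_{l=1}^dA_l\partial_l$ with constant $N\times N$ matrices. Suppose that $\sigma_1(x_1)\in L^\infty(\mathbb R)$ is real valued with support in $[0,\rho]$ for some $\rho>0$, that $\sigma_j=0$ for $j\neq1$, and that the Bérenger split operator $\widetilde L$ with these absorptions is nondegenerate with respect to $x_1$ and defines a weakly well posed time evolution. Then the $\widetilde L$ evolution is perfectly matched in the sense that for $F\in C_0^\infty(\{t>0\}\cap\{x_1<0\};\mathbb C^{dN})$ the solutions $\widetilde U$ (without absorption) and $\widetilde U'$ (with absorption) of $$\widetilde L_1\widetilde U=F,\quad\widetilde U|_{t\le0}=0,\qquad\text{and}\qquad\widetilde L\widetilde U'=F,\quad\widetilde U'|_{t\le0}=0$$ satisfy $\widetilde U|_{x_1<0}=\widetilde U'|_{x_1<0}$.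
   Context: Split operator: for $\widetilde U=(U^1,\dots,U^d)$ with $U^l$ valued in $\mathbb C^N$, $(\widetilde L\widetilde U)_1=\partial_tU^1+A_1\partial_1(\sum_jU^j)+\sigma_1(x_1)U^1$ and $(\widetilde L\widetilde U)_l=\partial_tU^l+A_l\partial_l(\sum_jU^j)$ for $l\ge2$. $\widetilde L_1$ is the same operator with $\sigma_1=0$. Nondegenerate with respect to $x_1$ (for a constant coefficient operator $\mathcal L$): there is $\tau_1>0$ such that the degree in $\rho$ of $\det\mathcal L(\tau,\rho,i\eta)$ is independent of $(\tau,\eta)$ for $\mathrm{Re}\,\tau>\tau_1$, $\eta\in\mathbb R^{d-1}$; for the variable coefficient operator $\widetilde L$ this is required of $\widetilde L_1$, equivalently of $L$. Weakly well posed: there exist $q>0$, $K>0$, $\alpha\in\mathbb R$ such that for any initial value in $H^q(\mathbb R^d)$ there is a unique solution $\widetilde U\in C^0([0,\infty[;L^2(\mathbb R^d))$ of $\widetilde L\widetilde U=0$, and $\|\widetilde U(t)\|_{L^2}\le Ke^{\alpha t}\|\widetilde U(0)\|_{H^q}$ for $t\ge0$. This is assumed for $\widetilde L$; $L$ is assumed weakly hyperbolic ($\sum_l\xi_lA_l$ has only real eigenvalues for real $\xi$), so that it also holds for $\widetilde L_1$. *)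

theory Defs
  imports "HOL-Analysis.Analysis" "HOL-Computational_Algebra.Polynomial"
begin

section \<open>Square integrable functions and Sobolev spaces\<close>

text \<open>Elements of \<open>L\<^sup>2\<close> and \<open>L\<^sup>\<infinity>\<close> are represented by Borel functions; equality of classes is
  equality almost everywhere.\<close>

definition in_L2 :: "('a::euclidean_space \<Rightarrow> 'b::euclidean_space) \<Rightarrow> bool" where
  "in_L2 f \<longleftrightarrow> f \<in> borel_measurable borel \<and> integrable lborel (\<lambda>x. (norm (f x))\<^sup>2)"

definition L2_norm :: "('a::euclidean_space \<Rightarrow> 'b::euclidean_space) \<Rightarrow> real" where
  "L2_norm f = sqrt (LINT x|lborel. (norm (f x))\<^sup>2)"

definition L2_eq :: "('a::euclidean_space \<Rightarrow> 'b) \<Rightarrow> ('a \<Rightarrow> 'b) \<Rightarrow> bool" where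
  "L2_eq f g \<longleftrightarrow> (AE x in lborel. f x = g x)"

definition L2_continuous_on ::
    "real set \<Rightarrow> (real \<Rightarrow> 'a::euclidean_space \<Rightarrow> 'b::euclidean_space) \<Rightarrow> bool" where
  "L2_continuous_on T U \<longleftrightarrow>
     (\<forall>t\<in>T. in_L2 (U t) \<and> ((\<lambda>s. L2_norm (\<lambda>x. U s x - U t x)) \<longlongrightarrow> 0) (at t within T))"

text \<open>The Fourier transform on \<open>L\<^sup>2\<close>, in its unitary normalization and acting componentwise,
  is the \<open>L\<^sup>2\<close> limit of the transforms of the truncations to balls.\<close>

definition fourier_ball ::
    "(real^'d \<Rightarrow> complex^'m) \<Rightarrow> real \<Rightarrow> real^'d \<Rightarrow> complex^'m" where
  "fourier_ball f R \<xi> =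
     (2 * pi) powr (- real CARD('d) / 2) *\<^sub>R
       (LINT x|lborel. indicator (cball 0 R) x *\<^sub>R (cis (- (x \<bullet> \<xi>)) *s f x))"

definition has_fourier :: "(real^'d \<Rightarrow> complex^'m) \<Rightarrow> (real^'d \<Rightarrow> complex^'m) \<Rightarrow> bool" where
  "has_fourier f g \<longleftrightarrow> in_L2 f \<and> in_L2 g \<and>
     ((\<lambda>R. L2_norm (\<lambda>\<xi>. fourier_ball f R \<xi> - g \<xi>)) \<longlongrightarrow> 0) at_top"

definition in_sobolev :: "real \<Rightarrow> (real^'d \<Rightarrow> complex^'m) \<Rightarrow> bool" where
  "in_sobolev q f \<longleftrightarrow> (\<exists>g. has_fourier f g \<and>
     integrable lborel (\<lambda>\<xi>. (1 + (norm \<xi>)\<^sup>2) powr q * (norm (g \<xi>))\<^sup>2))"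

text \<open>The transform is unique up to null sets, so the choice below does not matter.\<close>

definition sobolev_norm :: "real \<Rightarrow> (real^'d \<Rightarrow> complex^'m) \<Rightarrow> real" where
  "sobolev_norm q f =
     sqrt (LINT \<xi>|lborel. (1 + (norm \<xi>)\<^sup>2) powr q * (norm ((SOME g. has_fourier f g) \<xi>))\<^sup>2)"


section \<open>Compactly supported smooth functions\<close>

primrec Ck :: "nat \<Rightarrow> ('a::euclidean_space \<Rightarrow> 'b::real_normed_vector) \<Rightarrow> bool" where
  "Ck 0 f \<longleftrightarrow> continuous_on UNIV f"
| "Ck (Suc k) f \<longleftrightarrow> (\<forall>x. f differentiable (at x)) \<and>
     (\<forall>b\<in>Basis. Ck k (\<lambda>x. frechet_derivative f (at x) b))"

definition test_functions :: "'a::euclidean_space set \<Rightarrow> ('a \<Rightarrow> 'b::real_normed_vector) set" where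
  "test_functions S = {f. (\<forall>k. Ck k f) \<and>
     compact (closure {x. f x \<noteq> 0}) \<and> closure {x. f x \<noteq> 0} \<subseteq> S}"


section \<open>The operators\<close>

text \<open>The variables are \<open>(t, x)\<close>, with \<open>x\<close> of type \<open>real^'d\<close>. The type \<open>'d\<close> has no preferred element,
  so the index of the coordinate \<open>x\<^sub>1\<close> is a parameter, called \<open>e\<close>.\<close>

abbreviation partial_t :: "(real \<times> (real^'d) \<Rightarrow> complex) \<Rightarrow> real \<times> (real^'d) \<Rightarrow> complex" where
  "partial_t \<phi> p \<equiv> frechet_derivative \<phi> (at p) (1, 0)"

abbreviation partial_x ::
    "'d \<Rightarrow> (real \<times> (real^'d) \<Rightarrow> complex) \<Rightarrow> real \<times> (real^'d) \<Rightarrow> complex" where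
  "partial_x l \<phi> p \<equiv> frechet_derivative \<phi> (at p) (0, axis l 1)"

definition weakly_hyperbolic :: "('d::finite \<Rightarrow> complex^'n^'n) \<Rightarrow> bool" where
  "weakly_hyperbolic A \<longleftrightarrow> (\<forall>\<xi>::real^'d. \<forall>\<mu>. \<forall>v::complex^'n.
     v \<noteq> 0 \<and> (\<Sum>l\<in>UNIV. (\<xi> $ l) *\<^sub>R A l) *v v = \<mu> *s v \<longrightarrow> \<mu> \<in> \<real>)"

text \<open>Vectors \<open>(U\<^sup>1, \<dots>, U\<^sup>d)\<close> of elements of \<open>complex^'n\<close> are indexed by pairs.\<close>

definition split_part :: "complex^('d::finite \<times> 'n::finite) \<Rightarrow> 'd \<Rightarrow> complex^'n" where
  "split_part u l = (\<chi> i. u $ (l, i))"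

text \<open>\<open>split_pairing e A \<sigma> U \<phi> l\<close> is the \<open>l\<close>-th block of the distribution
  \<open>\<partial>\<^sub>t U\<^sup>l + A\<^sub>l \<partial>\<^sub>l (\<Sum>\<^sub>j U\<^sup>j) + [l = e] \<sigma>(x\<^sub>1) U\<^sup>l\<close> evaluated at \<open>\<phi>\<close>. The iterated integral
  makes sense for every \<open>U\<close> continuous in time with values in \<open>L\<^sup>2\<close>: the inner integral is then
  a continuous function of \<open>t\<close>.\<close>

definition split_pairing ::
    "'d::finite \<Rightarrow> ('d \<Rightarrow> complex^'n^'n) \<Rightarrow> (real \<Rightarrow> real) \<Rightarrow>
     (real \<Rightarrow> real^'d \<Rightarrow> complex^('d \<times> 'n::finite)) \<Rightarrow>
     (real \<times> (real^'d) \<Rightarrow> complex) \<Rightarrow> 'd \<Rightarrow> complex^'n" where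
  "split_pairing e A \<sigma> U \<phi> l =
     (LINT t|lborel. LINT x|lborel.
        - (partial_t \<phi> (t, x) *s split_part (U t x) l)
        - partial_x l \<phi> (t, x) *s (A l *v (\<Sum>j\<in>UNIV. split_part (U t x) j))
        + (if l = e then (\<phi> (t, x) * complex_of_real (\<sigma> (x $ e))) *s split_part (U t x) l
           else 0))"

definition split_equation ::
    "real set \<Rightarrow> 'd::finite \<Rightarrow> ('d \<Rightarrow> complex^'n^'n) \<Rightarrow> (real \<Rightarrow> real) \<Rightarrow>
     (real \<Rightarrow> real^'d \<Rightarrow> complex^('d \<times> 'n::finite)) \<Rightarrow>
     (real \<times> (real^'d) \<Rightarrow> complex^('d \<times> 'n)) \<Rightarrow> bool" where
  "split_equation T e A \<sigma> U F \<longleftrightarrow> (\<forall>\<phi>\<in>test_functions (T \<times> UNIV). \<forall>l.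
     split_pairing e A \<sigma> U \<phi> l =
       (LINT t|lborel. LINT x|lborel. \<phi> (t, x) *s split_part (F (t, x)) l))"

definition solves_ivp ::
    "'d::finite \<Rightarrow> ('d \<Rightarrow> complex^'n^'n) \<Rightarrow> (real \<Rightarrow> real) \<Rightarrow>
     (real^'d \<Rightarrow> complex^('d \<times> 'n::finite)) \<Rightarrow>
     (real \<Rightarrow> real^'d \<Rightarrow> complex^('d \<times> 'n)) \<Rightarrow> bool" where
  "solves_ivp e A \<sigma> U0 U \<longleftrightarrow>
     L2_continuous_on {0..} U \<and> split_equation {0<..} e A \<sigma> U (\<lambda>_. 0) \<and> L2_eq (U 0) U0"

definition weakly_well_posed ::
    "'d::finite \<Rightarrow> ('d \<Rightarrow> complex^'n::finite^'n) \<Rightarrow> (real \<Rightarrow> real) \<Rightarrow> bool" where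
  "weakly_well_posed e A \<sigma> \<longleftrightarrow> (\<exists>q>0. \<exists>K>0. \<exists>\<alpha>::real.
     \<forall>U0 :: real^'d \<Rightarrow> complex^('d \<times> 'n). in_sobolev q U0 \<longrightarrow>
       (\<exists>U. solves_ivp e A \<sigma> U0 U \<and>
         (\<forall>V. solves_ivp e A \<sigma> U0 V \<longrightarrow> (\<forall>t\<ge>0. L2_eq (V t) (U t))) \<and>
         (\<forall>t\<ge>0. L2_norm (U t) \<le> K * exp (\<alpha> * t) * sobolev_norm q U0)))"

definition solves_forced ::
    "'d::finite \<Rightarrow> ('d \<Rightarrow> complex^'n^'n) \<Rightarrow> (real \<Rightarrow> real) \<Rightarrow>
     (real \<times> (real^'d) \<Rightarrow> complex^('d \<times> 'n::finite)) \<Rightarrow>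
     (real \<Rightarrow> real^'d \<Rightarrow> complex^('d \<times> 'n)) \<Rightarrow> bool" where
  "solves_forced e A \<sigma> F U \<longleftrightarrow>
     L2_continuous_on UNIV U \<and> split_equation UNIV e A \<sigma> U F \<and> (\<forall>t\<le>0. L2_eq (U t) (\<lambda>_. 0))"

definition perfectly_matched ::
    "'d::finite \<Rightarrow> ('d \<Rightarrow> complex^'n::finite^'n) \<Rightarrow> (real \<Rightarrow> real) \<Rightarrow> bool" where
  "perfectly_matched e A \<sigma> \<longleftrightarrow>
     (\<forall>F \<in> test_functions {(t, x). t > 0 \<and> x $ e < 0}. \<forall>U U'.
        solves_forced e A (\<lambda>_. 0) F U \<and> solves_forced e A \<sigma> F U' \<longrightarrow>
        (\<forall>t. AE x in lborel. x $ e < 0 \<longrightarrow> U t x = U' t x))"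


section \<open>Nondegeneracy with respect to one variable\<close>

text \<open>For the operator \<open>\<partial>\<^sub>t + \<Sum>\<^sub>l B\<^sub>l \<partial>\<^sub>l\<close>, the symbol at \<open>(\<tau>, \<rho>, \<i>\<eta>)\<close> as a matrix of polynomials
  in \<open>\<rho>\<close>. The component \<open>\<eta> $ e\<close> is not used, so \<open>\<eta>\<close> amounts to a point of \<open>\<real>\<^sup>d\<^sup>-\<^sup>1\<close>.\<close>

definition symbol_poly ::
    "'d::finite \<Rightarrow> ('d \<Rightarrow> complex^'m^'m) \<Rightarrow> complex \<Rightarrow> real^'d \<Rightarrow> complex poly^'m^'m" where
  "symbol_poly e B \<tau> \<eta> = (\<chi> p q.
     [: (if p = q then \<tau> else 0) + (\<Sum>l\<in>UNIV - {e}. \<i> * complex_of_real (\<eta> $ l) * B l $ p $ q),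
        B e $ p $ q :])"

definition nondegenerate :: "'d::finite \<Rightarrow> ('d \<Rightarrow> complex^'m^'m) \<Rightarrow> bool" where
  "nondegenerate e B \<longleftrightarrow> (\<exists>\<tau>1>0. \<exists>m. \<forall>\<tau> \<eta>. Re \<tau> > \<tau>1 \<longrightarrow>
     degree (det (symbol_poly e B \<tau> \<eta>)) = m)"

text \<open>The coefficients of the split operator without absorption: it is
  \<open>\<partial>\<^sub>t + \<Sum>\<^sub>l split_coeff A l \<partial>\<^sub>l\<close>.\<close>

definition split_coeff ::
    "('d::finite \<Rightarrow> complex^'n^'n) \<Rightarrow> 'd \<Rightarrow> complex^('d \<times> 'n::finite)^('d \<times> 'n)" where
  "split_coeff A l = (\<chi> p q. if fst p = l then A l $ snd p $ snd q else 0)"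

lemma split_part_split_coeff:
  "split_part (split_coeff A m *v u) l =
     (if l = m then A l *v (\<Sum>j\<in>UNIV. split_part u j) else 0)"
proof -
  have "(\<Sum>q\<in>UNIV. A l $ i $ snd q * u $ q) = (\<Sum>k\<in>UNIV. A l $ i $ k * (\<Sum>j\<in>UNIV. u $ (j, k)))"
    for i
  proof -
    have "(\<Sum>q\<in>UNIV. A l $ i $ snd q * u $ q) = (\<Sum>j\<in>UNIV. \<Sum>k\<in>UNIV. A l $ i $ k * u $ (j, k))"
      by (simp add: sum.cartesian_product split_def)
    also have "\<dots> = (\<Sum>k\<in>UNIV. \<Sum>j\<in>UNIV. A l $ i $ k * u $ (j, k))"
      by (rule sum.swap)
    finally show ?thesis by (simp add: sum_distrib_left)
  qed
  then show ?thesis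
    by (auto simp: vec_eq_iff split_part_def split_coeff_def matrix_vector_mult_def)
qed

end

theory Submission
  imports Defs "HOL-Computational_Algebra.Fundamental_Theorem_Algebra"
begin

text \<open>For real \<open>\<tau>\<close> larger than \<open>\<bar>\<sigma>\<bar>\<close> the complex stretching of the absorbing layer is the real change
  of variable \<open>\<Xi>\<close> that replaces \<open>x\<^sub>e\<close> by the primitive of \<open>1 + \<sigma>(x\<^sub>e) / \<tau>\<close>. It is the identity on
  \<open>x\<^sub>e < 0\<close>. Given \<open>\<gamma>\<close> supported in \<open>x\<^sub>e < 0\<close>, solve the stationary adjoint equation
  \<open>(\<tau> - \<Sum>\<^sub>l A\<^sub>l\<^sup>T \<partial>\<^sub>l) \<psi> = \<gamma>\<close> by Fourier transform; since \<open>\<Sum>\<^sub>l \<xi>\<^sub>l A\<^sub>l\<close> has real eigenvalues, the determinant of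
  the symbol is at least \<open>\<tau>\<^sup>N\<close> in modulus. Test the split equations on a finite time interval \<open>[0, T]\<close> with
  \<open>exp (- \<tau> t)\<close> times \<open>\<psi> \<circ> \<Xi>\<close> in the block \<open>e\<close> and \<open>(1 + \<sigma> / \<tau>) (\<psi> \<circ> \<Xi>)\<close> in the others. The time
  derivative and the absorption combine, so that the Laplace transform of the pairing of \<open>\<gamma>\<close> with
  \<open>\<Sum>\<^sub>j U\<^sup>j\<close> is expressed by \<open>F\<close> and \<open>\<psi>\<close>, independently of \<open>\<sigma>\<close>, up to an error of size \<open>exp (- \<tau> T)\<close>
  from the truncation at \<open>T\<close>. As \<open>\<tau> \<rightarrow> \<infinity>\<close> along the integers, such a bound makes the difference of the
  two pairings vanish for \<open>t < T\<close>. Each block then satisfies the same equation in \<open>x\<^sub>e < 0\<close> for both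
  solutions, hence the blocks agree.\<close>

section \<open>Functions of class C^k and smooth cut-offs\<close>

text \<open>The solutions are only continuous curves in \<open>L^2\<close> and \<sigma> is only
  bounded and measurable, so nothing can be differentiated or stretched on the side of
  \<open>U\<close>; everything is moved to test functions. Real \<tau> makes this possible: for
  complex \<tau> the composition with the stretching would ask for an analytic continuation of
  \<psi>.

  The factor \<open>1 + \<sigma> / \<tau>\<close> is never differentiated in its own variable. Block
  \<open>e\<close> differentiates along \<open>x_e\<close> and carries no factor, but the chain rule
  creates it; the other blocks carry it and differentiate along other variables. So every block
  yields the same factor times the composed derivative of \<psi>.

  The truncation at \<open>T\<close> keeps all time integrals finite. Its error is useful only if
  its constant does not depend on \<tau>, so the decay of \<psi> and of its derivatives has to be
  uniform in \<tau>: this is why families of Schwartz functions are carried along.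

  The weights are neither smooth nor compactly supported, so they are reached as dominated limits of
  test functions. The condition \<open>\<tau> \<ge> 2 * (C + 1)\<close>, with \<open>C\<close> a
  bound of \<sigma>, keeps the displacement of \<open>x_e\<close> below
  \<open>\<bar>x_e\<bar> / 2\<close> for the approximations too.\<close>

lemma Ck_SucI:
  assumes "\<And>x. (f has_derivative f' x) (at x)"
    and "\<And>b. b \<in> Basis \<Longrightarrow> Ck k (\<lambda>x. f' x b)"
  shows "Ck (Suc k) f"
proof -
  have "frechet_derivative f (at x) = f' x" for x
    using frechet_derivative_at[OF assms(1)] by simp
  with assms show ?thesis by (auto simp: differentiable_def)
qed

lemma Ck_Suc_has_derivative:
  "Ck (Suc k) f \<Longrightarrow> (f has_derivative frechet_derivative f (at x)) (at x)"
  by (simp add: frechet_derivative_works)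

lemma Ck_imp_continuous: "Ck k f \<Longrightarrow> continuous_on UNIV f"
  by (cases k) (auto intro!: differentiable_imp_continuous_on
      simp: differentiable_on_def differentiable_at_withinI)

lemma Ck_Suc_imp_Ck: "Ck (Suc k) f \<Longrightarrow> Ck k f"
proof (induction k arbitrary: f)
  case 0
  then show ?case using Ck_imp_continuous[of "Suc 0" f] by simp
next
  case (Suc k)
  then show ?case by (metis Ck.simps(2))
qed

lemma Ck_bounded_linear_compose:
  assumes h: "bounded_linear h" and "Ck k f"
  shows "Ck k (\<lambda>x. h (f x))"
  using assms(2)
proof (induction k arbitrary: f)
  case 0
  then show ?case by (auto intro!: bounded_linear.continuous_on[OF h])
next
  case (Suc k)
  show ?case
  proof (rule Ck_SucI)
    show "((\<lambda>x. h (f x)) has_derivative (\<lambda>v. h (frechet_derivative f (at x) v))) (at x)" for x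
      using bounded_linear.has_derivative[OF h Ck_Suc_has_derivative[OF Suc.prems]] .
  qed (use Suc in auto)
qed

lemma Ck_const [simp]: "Ck k (\<lambda>x. c)"
proof (induction k arbitrary: c)
  case (Suc k)
  show ?case by (rule Ck_SucI[where f' = "\<lambda>x v. 0"]) (use Suc in auto)
qed auto

lemma Ck_add: "Ck k f \<Longrightarrow> Ck k g \<Longrightarrow> Ck k (\<lambda>x. f x + g x)"
proof (induction k arbitrary: f g)
  case 0
  then show ?case by (auto intro!: continuous_intros)
next
  case (Suc k)
  show ?case
    by (rule Ck_SucI, rule has_derivative_add[OF Ck_Suc_has_derivative[OF Suc.prems(1)]
          Ck_Suc_has_derivative[OF Suc.prems(2)]])
      (use Suc in auto)
qed

lemma Ck_sum: "(\<And>i. i \<in> I \<Longrightarrow> Ck k (f i)) \<Longrightarrow> Ck k (\<lambda>x. \<Sum>i\<in>I. f i x)"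
  by (induction I rule: infinite_finite_induct) (auto intro: Ck_add)

lemma Ck_mult:
  fixes f g :: "'a::euclidean_space \<Rightarrow> 'b::real_normed_algebra"
  shows "Ck k f \<Longrightarrow> Ck k g \<Longrightarrow> Ck k (\<lambda>x. f x * g x)"
proof (induction k arbitrary: f g)
  case 0
  then show ?case by (auto intro!: continuous_intros)
next
  case (Suc k)
  show ?case
  proof (rule Ck_SucI)
    show "((\<lambda>x. f x * g x) has_derivative
        (\<lambda>v. f x * frechet_derivative g (at x) v + frechet_derivative f (at x) v * g x)) (at x)" for x
      by (rule has_derivative_mult[OF Ck_Suc_has_derivative[OF Suc.prems(1)]
            Ck_Suc_has_derivative[OF Suc.prems(2)]])
    show "Ck k (\<lambda>x. f x * frechet_derivative g (at x) b + frechet_derivative f (at x) b * g x)"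
      if "b \<in> Basis" for b
      using Suc that Ck_Suc_imp_Ck[OF Suc.prems(1)] Ck_Suc_imp_Ck[OF Suc.prems(2)]
      by (intro Ck_add Suc.IH) auto
  qed
qed

lemma Ck_prod:
  fixes f :: "'i \<Rightarrow> 'a::euclidean_space \<Rightarrow> 'b::{real_normed_algebra_1, comm_ring_1}"
  shows "(\<And>i. i \<in> I \<Longrightarrow> Ck k (f i)) \<Longrightarrow> Ck k (\<lambda>x. \<Prod>i\<in>I. f i x)"
  by (induction I rule: infinite_finite_induct) (auto intro: Ck_mult)

lemma Ck_compose_affine:
  fixes L :: "'a::euclidean_space \<Rightarrow> 'c::euclidean_space"
  assumes L: "bounded_linear L" and "Ck k f"
  shows "Ck k (\<lambda>x. f (L x + c))"
  using assms(2)
proof (induction k arbitrary: f)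
  case 0
  have "continuous_on UNIV (\<lambda>x. L x + c)"
    by (intro continuous_intros linear_continuous_on L)
  with 0 show ?case
    using continuous_on_compose2[of UNIV f UNIV "\<lambda>x. L x + c"] by auto
next
  case (Suc k)
  show ?case
  proof (rule Ck_SucI)
    show "((\<lambda>x. f (L x + c)) has_derivative (\<lambda>v. frechet_derivative f (at (L x + c)) (L v))) (at x)" for x
      by (rule has_derivative_compose[OF _ Ck_Suc_has_derivative[OF Suc.prems]])
        (use bounded_linear_imp_has_derivative[OF L] in \<open>auto intro!: derivative_eq_intros\<close>)
    fix b :: 'a
    assume "b \<in> Basis"
    have "frechet_derivative f (at y) (L b) =
        (\<Sum>u\<in>Basis. (L b \<bullet> u) *\<^sub>R frechet_derivative f (at y) u)" for y
    proof -
      have lin: "linear (frechet_derivative f (at y))"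
        using Suc.prems by (intro linear_frechet_derivative) simp
      have "frechet_derivative f (at y) (L b) =
          frechet_derivative f (at y) (\<Sum>u\<in>Basis. (L b \<bullet> u) *\<^sub>R u)"
        by (simp add: euclidean_representation)
      then show ?thesis by (simp add: linear_sum[OF lin] linear_scale[OF lin])
    qed
    then show "Ck k (\<lambda>x. frechet_derivative f (at (L x + c)) (L b))"
      by (simp, intro Ck_sum Ck_bounded_linear_compose[OF bounded_linear_scaleR_right] Suc.IH)
        (use Suc.prems in auto)
  qed
qed

lemma Ck_real_SucI:
  fixes f :: "real \<Rightarrow> 'b::real_normed_vector"
  assumes "\<And>s. (f has_vector_derivative f' s) (at s)" and "Ck k f'"
  shows "Ck (Suc k) f"
  by (rule Ck_SucI[where f' = "\<lambda>s h. h *\<^sub>R f' s"])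
    (use assms in \<open>auto simp: has_vector_derivative_def\<close>)

section \<open>A flat function and bumps on boxes\<close>

lemma poly_exp_minus_tendsto_0: "((\<lambda>t::real. poly p t * exp (- t)) \<longlongrightarrow> 0) at_top"
proof -
  have "((\<lambda>t. \<Sum>i\<le>degree p. coeff p i * (t ^ i / exp t)) \<longlongrightarrow> (\<Sum>i\<le>degree p. coeff p i * 0)) at_top"
    by (intro tendsto_intros tendsto_power_div_exp_0)
  then show ?thesis
    by (simp add: poly_altdef sum_distrib_right exp_minus divide_inverse mult.assoc)
qed

text \<open>The polynomial parameter makes this family closed under differentiation, so a single
  derivative formula gives smoothness of all orders by induction.\<close>

definition flat_exp :: "real poly \<Rightarrow> real \<Rightarrow> real" where
  "flat_exp p s = (if s > 0 then poly p (inverse s) * exp (- inverse s) else 0)"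

text \<open>The factor \<open>[:0, 0, 1:]\<close> is the square of \<open>inverse s\<close>, which
  comes from differentiating \<open>inverse s\<close>; the terms \<open>p\<close> and
  \<open>- pderiv p\<close> come from the exponential and from the polynomial.\<close>

lemma flat_exp_has_real_derivative:
  "(flat_exp p has_real_derivative flat_exp ((p - pderiv p) * [:0, 0, 1:]) s) (at s)"
proof (cases "s = 0")
  case s: True
  \<comment> \<open>The difference quotient at 0 has an additional factor \<open>1 / h\<close>;
    multiplying \<open>p\<close> by \<open>[:0, 1:]\<close> absorbs it into the polynomial.\<close>
  have "((\<lambda>h. poly ([:0, 1:] * p) (inverse h) * exp (- inverse h)) \<longlongrightarrow> 0) (at_right 0)"
    by (rule filterlim_compose[OF poly_exp_minus_tendsto_0 filterlim_inverse_at_top_right])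
  then have "((\<lambda>h. (flat_exp p (0 + h) - flat_exp p 0) / h) \<longlongrightarrow> 0) (at_right 0)"
  proof (rule Lim_transform_eventually)
    show "\<forall>\<^sub>F h in at_right 0. poly ([:0, 1:] * p) (inverse h) * exp (- inverse h) =
        (flat_exp p (0 + h) - flat_exp p 0) / h"
      by (intro eventually_at_rightI[of 0 1]) (auto simp: flat_exp_def field_simps)
  qed
  moreover have "((\<lambda>h. (flat_exp p (0 + h) - flat_exp p 0) / h) \<longlongrightarrow> 0) (at_left 0)"
    by (rule Lim_transform_eventually[OF tendsto_const])
      (auto simp: flat_exp_def intro!: eventually_at_leftI[of "-1::real"])
  ultimately have "((\<lambda>h. (flat_exp p (0 + h) - flat_exp p 0) / h) \<longlongrightarrow> 0) (at 0)"
    by (simp add: filterlim_split_at)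
  then show ?thesis using s by (simp add: DERIV_def flat_exp_def)
next
  case False
  then consider "s > 0" | "s < 0" by linarith
  then show ?thesis
  proof cases
    case 1
    have "((\<lambda>s. poly p (inverse s) * exp (- inverse s)) has_real_derivative
        flat_exp ((p - pderiv p) * [:0, 0, 1:]) s) (at s)"
      using 1 by (auto intro!: derivative_eq_intros DERIV_chain2[OF poly_DERIV] simp: flat_exp_def field_simps power2_eq_square)
    moreover have "\<forall>\<^sub>F x in nhds s. poly p (inverse x) * exp (- inverse x) = flat_exp p x"
      using 1 eventually_nhds_in_open[of "{0<..}" s] by (auto simp: flat_exp_def elim!: eventually_mono)
    ultimately show ?thesis by (subst (asm) DERIV_cong_ev[OF refl _ refl]) auto
  next
    case 2
    have "((\<lambda>s. 0) has_real_derivative flat_exp ((p - pderiv p) * [:0, 0, 1:]) s) (at s)"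
      using 2 by (auto simp: flat_exp_def)
    moreover have "\<forall>\<^sub>F x in nhds s. 0 = flat_exp p x"
      using 2 eventually_nhds_in_open[of "{..<0}" s] by (auto simp: flat_exp_def elim!: eventually_mono)
    ultimately show ?thesis by (subst (asm) DERIV_cong_ev[OF refl _ refl]) auto
  qed
qed

lemma Ck_flat_exp: "Ck k (flat_exp p)"
proof (induction k arbitrary: p)
  case 0
  show ?case
    using DERIV_isCont[OF flat_exp_has_real_derivative] by (auto intro!: continuous_at_imp_continuous_on)
next
  case (Suc k)
  then show ?case
    by (rule Ck_real_SucI[OF flat_exp_has_real_derivative[unfolded has_real_derivative_iff_has_vector_derivative]])
qed

definition kap :: "real \<Rightarrow> real" where "kap = flat_exp 1"

lemma kap_nonneg: "0 \<le> kap s" and kap_le_1: "kap s \<le> 1"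
  and kap_eq_0: "s \<le> 0 \<Longrightarrow> kap s = 0" and kap_pos: "s > 0 \<Longrightarrow> kap s > 0"
  by (auto simp: kap_def flat_exp_def)

lemma Ck_kap: "Ck k kap"
  unfolding kap_def by (rule Ck_flat_exp)

lemma kap_scaled_tendsto: "(\<lambda>n. kap (real n * s)) \<longlonglongrightarrow> (if s > 0 then 1 else 0)"
proof (cases "s > 0")
  case True
  have "(\<lambda>n. exp (- (inverse (real n) * inverse s))) \<longlonglongrightarrow> exp (- (0 * inverse s))"
    by (intro tendsto_intros lim_inverse_n)
  moreover have "\<forall>\<^sub>F n in sequentially. exp (- (inverse (real n) * inverse s)) = kap (real n * s)"
    using eventually_gt_at_top[of 0] by eventually_elim (use True in \<open>auto simp: kap_def flat_exp_def\<close>)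
  ultimately show ?thesis using True Lim_transform_eventually by fastforce
next
  case False
  then have "real n * s \<le> 0" for n by (simp add: mult_nonneg_nonpos)
  with False show ?thesis by (simp add: kap_eq_0)
qed

text \<open>The parameter \<open>r\<close> is a steepness. For every \<open>r > 0\<close> the bump
  is nonzero exactly on the open box, so the support does not grow while the bumps approach the
  indicator.\<close>

definition box_bump :: "real \<Rightarrow> real^'d \<Rightarrow> real^'d \<Rightarrow> real^'d \<Rightarrow> complex" where
  "box_bump r a b x =
     (\<Prod>l\<in>UNIV. complex_of_real (kap (r * (x $ l - a $ l)) * kap (r * (b $ l - x $ l))))"

lemma Ck_of_real_comp: "Ck k f \<Longrightarrow> Ck k (\<lambda>x. complex_of_real (f x))"
  by (rule Ck_bounded_linear_compose[OF bounded_linear_of_real])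

lemma Ck_box_bump: "Ck k (box_bump r a (b :: real^'d))"
proof -
  have *: "Ck k (\<lambda>x::real^'d. kap (c * x $ l + c'))" for c c' l
    by (intro Ck_compose_affine Ck_kap bounded_linear_const_mult bounded_linear_vec_nth)
  have 1: "Ck k (\<lambda>x::real^'d. kap (r * (x $ l - a $ l)))" for l
    using *[of r l "- r * a $ l"] by (simp add: algebra_simps)
  have 2: "Ck k (\<lambda>x::real^'d. kap (r * (b $ l - x $ l)))" for l
    using *[of "- r" l "r * b $ l"] by (simp add: algebra_simps)
  show ?thesis unfolding box_bump_def
    by (intro Ck_prod Ck_of_real_comp Ck_mult[where 'b = real] 1 2)
qed

lemma norm_box_bump_le_1: "cmod (box_bump r a b x) \<le> 1"
  unfolding box_bump_def prod_norm[symmetric]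
  by (intro prod_le_1) (auto simp: norm_mult kap_nonneg kap_le_1 mult_le_one)

lemma kap_mult_neq_0: "r > 0 \<Longrightarrow> kap (r * s) \<noteq> 0 \<longleftrightarrow> s > 0"
  using kap_pos[of "r * s"] kap_eq_0[of "r * s"]
  by (cases "s > 0") (auto simp: mult_le_0_iff)

lemma box_bump_neq_0: "r > 0 \<Longrightarrow> box_bump r a b x \<noteq> 0 \<longleftrightarrow> (\<forall>l. a $ l < x $ l \<and> x $ l < b $ l)"
  by (simp add: box_bump_def kap_mult_neq_0)

lemma box_bump_tendsto:
  "(\<lambda>n. box_bump (real n) a b x) \<longlonglongrightarrow> indicator (box a b) x"
proof -
  have "(\<lambda>n. box_bump (real n) a b x) \<longlonglongrightarrow>
     (\<Prod>l\<in>UNIV. complex_of_real ((if x $ l - a $ l > 0 then 1 else 0) * (if b $ l - x $ l > 0 then 1 else 0)))"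
    unfolding box_bump_def by (intro tendsto_intros kap_scaled_tendsto)
  moreover have "(\<Prod>l\<in>UNIV. complex_of_real ((if x $ l - a $ l > 0 then 1 else 0) * (if b $ l - x $ l > 0 then 1 else 0)))
      = indicator (box a b) x"
  proof (cases "x \<in> box a b")
    case True
    then show ?thesis by (auto simp: mem_box_cart)
  next
    case False
    then obtain l where "\<not> (a $ l < x $ l \<and> x $ l < b $ l)" by (auto simp: mem_box_cart)
    then show ?thesis using False by (auto intro!: exI[of _ l])
  qed
  ultimately show ?thesis by simp
qed

lemma box_bump_test_function:
  assumes "r > 0" "cbox a b \<subseteq> S"
  shows "box_bump r a b \<in> test_functions S"
proof -
  have "{x. box_bump r a b x \<noteq> 0} \<subseteq> cbox a b"
    using assms(1) by (auto simp: box_bump_neq_0 mem_box_cart less_imp_le)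
  then have *: "closure {x. box_bump r a b x \<noteq> 0} \<subseteq> cbox a b"
    by (rule closure_minimal) (rule closed_cbox)
  then have "compact (closure {x. box_bump r a b x \<noteq> 0})"
    by (meson bounded_cbox bounded_subset closed_closure compact_eq_bounded_closed)
  with * assms show ?thesis by (auto simp: test_functions_def Ck_box_bump)
qed

section \<open>Uniformly rapidly decreasing families\<close>

text \<open>The \<open>l^1\<close> form suits the Fourier transform: multiplication by the weight
  splits into multiplications by 1 and by the moduli of the coordinates, and a coordinate factor
  corresponds to a derivative. The weight is also submultiplicative under addition of
  arguments.\<close>

definition l1_weight :: "real^'d \<Rightarrow> real" where "l1_weight x = 1 + (\<Sum>l\<in>UNIV. \<bar>x $ l\<bar>)"

lemma l1_weight_ge_1: "1 \<le> l1_weight x"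
  by (simp add: l1_weight_def sum_nonneg)

lemma l1_weight_pos: "0 < l1_weight x" and l1_weight_nonneg: "0 \<le> l1_weight x"
  using l1_weight_ge_1[of x] by linarith+

lemma norm_le_l1_weight: "norm x \<le> l1_weight x"
  using norm_le_l1_cart[of x] by (simp add: l1_weight_def)

lemma nth_le_l1_weight: "\<bar>x $ l\<bar> \<le> l1_weight x"
  using component_le_norm_cart[of x l] norm_le_l1_weight[of x] by linarith

lemma l1_weight_le_norm: "l1_weight (x :: real^'d) \<le> 1 + real CARD('d) * norm x"
  unfolding l1_weight_def using sum_bounded_above[of UNIV "\<lambda>l. \<bar>x $ l\<bar>" "norm x"]
  by (auto simp: component_le_norm_cart)

lemma l1_weight_add_le: "l1_weight (x + y) \<le> l1_weight x * l1_weight y"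
proof -
  have "(\<Sum>l\<in>UNIV. \<bar>(x + y) $ l\<bar>) \<le> (\<Sum>l\<in>UNIV. \<bar>x $ l\<bar>) + (\<Sum>l\<in>UNIV. \<bar>y $ l\<bar>)"
    by (simp add: sum.distrib[symmetric] sum_mono abs_triangle_ineq)
  moreover have "0 \<le> (\<Sum>l\<in>UNIV. \<bar>x $ l\<bar>) * (\<Sum>l\<in>UNIV. \<bar>y $ l\<bar>)"
    by (simp add: sum_nonneg)
  ultimately show ?thesis
    unfolding l1_weight_def distrib_left distrib_right by linarith
qed

lemma continuous_l1_weight: "continuous_on UNIV l1_weight"
  unfolding l1_weight_def by (intro continuous_intros)

lemma l1_weight_measurable [measurable]: "l1_weight \<in> borel_measurable borel"
  by (rule borel_measurable_continuous_onI[OF continuous_l1_weight])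

lemma nn_integral_inverse_1_plus_square:
  "(\<integral>\<^sup>+x. ennreal (inverse (1 + x\<^sup>2)) \<partial>(lborel :: real measure)) < \<infinity>"
proof -
  have "(\<integral>\<^sup>+x. ennreal (inverse (1 + x\<^sup>2)) * indicator {0..} x \<partial>lborel) = ennreal (pi / 2 - arctan 0)"
    by (rule nn_integral_FTC_atLeast) (auto intro!: DERIV_arctan tendsto_arctan_at_top)
  then have "has_bochner_integral lborel (\<lambda>x::real. indicator {0..} x *\<^sub>R inverse (1 + x\<^sup>2)) (pi / 2)"
    by (intro has_bochner_integral_nn_integral)
      (auto simp: ennreal_mult[symmetric] ennreal_indicator[symmetric] mult.commute simp del: ennreal_indicator)
  then have "integrable lborel (\<lambda>x::real. inverse (1 + x\<^sup>2))"
    by (intro integrable.intros[OF has_bochner_integral_even_function]) auto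
  then show ?thesis by (simp add: integrable_iff_bounded)
qed

text \<open>Each factor \<open>1 + (x \<bullet> b)\<^sup>2\<close> is at most the square of the
  weight, so the product over the basis is at most its power \<open>2 * CARD('d)\<close>. The
  inverse of that product is integrable as a product of arctangent densities.\<close>

lemma integrable_inverse_l1_weight:
  assumes "2 * CARD('d) \<le> m"
  shows "integrable lborel (\<lambda>x::real^'d. inverse (l1_weight x ^ m))"
proof -
  have "(\<integral>\<^sup>+x. (\<Prod>b\<in>(Basis::(real^'d) set). inverse (1 + (x \<bullet> b)\<^sup>2)) \<partial>lborel)
      = (\<Prod>b\<in>(Basis::(real^'d) set). \<integral>\<^sup>+x. inverse (1 + x\<^sup>2) \<partial>(lborel :: real measure))"
    using nn_integral_lborel_prod[of "\<lambda>(b::real^'d) x. inverse (1 + x\<^sup>2)"] by (simp add: prod_ennreal)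
  also have "\<dots> < \<infinity>"
    using nn_integral_inverse_1_plus_square by (simp add: power_less_top_ennreal)
  finally have int: "integrable lborel (\<lambda>x::real^'d. \<Prod>b\<in>Basis. inverse (1 + (x \<bullet> b)\<^sup>2))"
    by (intro integrableI_nonneg) (auto intro!: prod_nonneg)
  show ?thesis
  proof (rule Bochner_Integration.integrable_bound[OF int])
    have le: "inverse (l1_weight x ^ m) \<le> (\<Prod>b\<in>Basis. inverse (1 + (x \<bullet> b)\<^sup>2))" for x :: "real^'d"
    proof -
      have "1 + (x \<bullet> b)\<^sup>2 \<le> (l1_weight x)\<^sup>2" if "b \<in> Basis" for b
      proof -
        have "1 + \<bar>x \<bullet> b\<bar> \<le> l1_weight x"
        proof -
          have "\<bar>x \<bullet> b\<bar> \<le> (\<Sum>l\<in>UNIV. \<bar>x $ l\<bar>)"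
            using norm_le_l1_cart[of x] Basis_le_norm[OF that, of x] by simp
          then show ?thesis by (simp add: l1_weight_def)
        qed
        then have "(1 + \<bar>x \<bullet> b\<bar>)\<^sup>2 \<le> (l1_weight x)\<^sup>2" by (intro power_mono) auto
        moreover have "(1 + \<bar>x \<bullet> b\<bar>)\<^sup>2 = 1 + 2 * \<bar>x \<bullet> b\<bar> + (x \<bullet> b)\<^sup>2"
          by (simp add: power2_eq_square algebra_simps)
        ultimately show ?thesis by linarith
      qed
      then have "(\<Prod>b\<in>Basis. 1 + (x \<bullet> b)\<^sup>2) \<le> (\<Prod>b\<in>(Basis::(real^'d) set). (l1_weight x)\<^sup>2)"
        by (intro prod_mono) auto
      also have "\<dots> = l1_weight x ^ (2 * CARD('d))" by (simp add: power_mult)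
      also have "\<dots> \<le> l1_weight x ^ m" using assms l1_weight_ge_1 by (intro power_increasing)
      finally have "inverse (l1_weight x ^ m) \<le> inverse (\<Prod>b\<in>Basis. 1 + (x \<bullet> b)\<^sup>2)"
        by (intro le_imp_inverse_le) (auto intro!: prod_pos add_pos_nonneg)
      then show ?thesis using prod_inversef[of "\<lambda>b. 1 + (x \<bullet> b)\<^sup>2" Basis] by (simp add: comp_def)
    qed
    show "AE x::real^'d in lborel. norm (inverse (l1_weight x ^ m)) \<le> norm (\<Prod>b\<in>Basis. inverse (1 + (x \<bullet> b)\<^sup>2))"
    proof (rule AE_I2)
      fix x :: "real^'d"
      have "norm (inverse (l1_weight x ^ m)) = inverse (l1_weight x ^ m)" by (simp add: l1_weight_nonneg)
      also have "\<dots> \<le> norm (\<Prod>b\<in>Basis. inverse (1 + (x \<bullet> b)\<^sup>2))"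
        unfolding real_norm_def by (rule order_trans[OF le abs_ge_self])
      finally show "norm (inverse (l1_weight x ^ m)) \<le> norm (\<Prod>b\<in>Basis. inverse (1 + (x \<bullet> b)\<^sup>2))" .
    qed
  qed measurable
qed

definition rapid :: "('i \<Rightarrow> real^'d \<Rightarrow> complex) \<Rightarrow> bool" where
  "rapid F \<longleftrightarrow> (\<forall>m. \<exists>C. \<forall>n x. cmod (F n x) * l1_weight x ^ m \<le> C)"

lemma rapid_bound:
  assumes "rapid F"
  obtains C where "C \<ge> 0" "\<And>n x. cmod (F n x) \<le> C * inverse (l1_weight x ^ m)"
proof -
  obtain C where C: "\<And>n x. cmod (F n x) * l1_weight x ^ m \<le> C"
    using assms unfolding rapid_def by blast
  have "cmod (F n x) \<le> C * inverse (l1_weight x ^ m)" for n x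
    using C[of n x] l1_weight_pos[of x] by (simp add: field_simps)
  moreover have "C \<ge> 0"
    using C[of undefined undefined] l1_weight_nonneg[of undefined] order_trans zero_le_mult_iff
    by (metis norm_ge_zero zero_le_power)
  ultimately show ?thesis using that by blast
qed

text \<open>Multipliers of polynomial growth, uniform in the index, preserve rapid decrease. This
  serves for coordinates, characters and resolvent entries alike.\<close>

lemma rapid_dominated:
  assumes "rapid F" and "\<And>n x. cmod (G n x) \<le> C * l1_weight x ^ k * cmod (F n x)" "C \<ge> 0"
  shows "rapid G"
  unfolding rapid_def
proof
  fix m
  obtain D where D: "\<And>n x. cmod (F n x) * l1_weight x ^ (k + m) \<le> D"
    using assms(1) unfolding rapid_def by blast
  have "cmod (G n x) * l1_weight x ^ m \<le> C * D" for n x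
  proof -
    have "cmod (G n x) * l1_weight x ^ m \<le> (C * l1_weight x ^ k * cmod (F n x)) * l1_weight x ^ m"
      using assms(2) by (intro mult_right_mono) (auto simp: l1_weight_nonneg)
    also have "\<dots> = C * (cmod (F n x) * l1_weight x ^ (k + m))" by (simp add: power_add)
    also have "\<dots> \<le> C * D" using D assms(3) by (intro mult_left_mono)
    finally show ?thesis .
  qed
  then show "\<exists>C. \<forall>n x. cmod (G n x) * l1_weight x ^ m \<le> C" by blast
qed

lemma rapid_add: "rapid F \<Longrightarrow> rapid G \<Longrightarrow> rapid (\<lambda>n x. F n x + G n x)"
  unfolding rapid_def
proof
  fix m
  assume "\<forall>m. \<exists>C. \<forall>n x. cmod (F n x) * l1_weight x ^ m \<le> C" "\<forall>m. \<exists>C. \<forall>n x. cmod (G n x) * l1_weight x ^ m \<le> C"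
  then obtain C D where *: "\<And>n x. cmod (F n x) * l1_weight x ^ m \<le> C" "\<And>n x. cmod (G n x) * l1_weight x ^ m \<le> D"
    by meson
  have "cmod (F n x + G n x) * l1_weight x ^ m \<le> C + D" for n x
  proof -
    have "cmod (F n x + G n x) * l1_weight x ^ m \<le> (cmod (F n x) + cmod (G n x)) * l1_weight x ^ m"
      by (intro mult_right_mono norm_triangle_ineq) (simp add: l1_weight_nonneg)
    then show ?thesis using *[of n x] by (simp add: algebra_simps)
  qed
  then show "\<exists>C. \<forall>n x. cmod (F n x + G n x) * l1_weight x ^ m \<le> C" by blast
qed

lemma rapid_integrable:
  fixes F :: "'i \<Rightarrow> real^'d \<Rightarrow> complex"
  assumes "rapid F" "F n \<in> borel_measurable borel"
  shows "integrable lborel (F n)"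
proof -
  obtain C where "C \<ge> 0" "\<And>n x. cmod (F n x) \<le> C * inverse (l1_weight x ^ (2 * CARD('d)))"
    using rapid_bound[OF assms(1)] by blast
  then show ?thesis
    by (intro Bochner_Integration.integrable_bound[OF
          integrable_mult_right[OF integrable_inverse_l1_weight[OF order_refl], of C]])
      (use assms(2) l1_weight_nonneg in \<open>auto simp: abs_mult\<close>)
qed

section \<open>Partial derivatives and families of Schwartz functions\<close>

definition pd :: "'d \<Rightarrow> (real^'d \<Rightarrow> 'b::real_normed_vector) \<Rightarrow> real^'d \<Rightarrow> 'b" where
  "pd l f x = frechet_derivative f (at x) (axis l 1)"

lemma has_derivative_pd:
  assumes "f differentiable (at x)"
  shows "(f has_derivative (\<lambda>v. \<Sum>l\<in>UNIV. v $ l *\<^sub>R pd l f x)) (at x)"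
proof -
  have lin: "linear (frechet_derivative f (at x))"
    by (rule linear_frechet_derivative[OF assms])
  have "frechet_derivative f (at x) v = (\<Sum>l\<in>UNIV. v $ l *\<^sub>R pd l f x)" for v
  proof -
    have "v = (\<Sum>l\<in>UNIV. v $ l *\<^sub>R axis l 1)"
      by (simp add: vec_eq_iff axis_def if_distrib sum.delta cong: if_cong)
    then have "frechet_derivative f (at x) v = frechet_derivative f (at x) (\<Sum>l\<in>UNIV. v $ l *\<^sub>R axis l 1)"
      by simp
    then show ?thesis by (simp add: linear_sum[OF lin] linear_scale[OF lin] pd_def)
  qed
  then show ?thesis
    using assms frechet_derivative_works[of f "at x"] by (metis (no_types, lifting) ext)
qed

lemma pd_eqI: "(f has_derivative f') (at x) \<Longrightarrow> pd l f x = f' (axis l 1)"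
  unfolding pd_def using frechet_derivative_at by metis

text \<open>The bounds are uniform in the index of the family, which will be \<open>\<tau> - 1\<close>.\<close>

primrec rapid_derivatives :: "nat \<Rightarrow> ('i \<Rightarrow> real^'d \<Rightarrow> complex) \<Rightarrow> bool" where
  "rapid_derivatives 0 F \<longleftrightarrow> rapid F \<and> (\<forall>n. continuous_on UNIV (F n))"
| "rapid_derivatives (Suc k) F \<longleftrightarrow> rapid F \<and> (\<forall>n x. F n differentiable (at x)) \<and> (\<forall>l. rapid_derivatives k (\<lambda>n. pd l (F n)))"

definition schwartz :: "('i \<Rightarrow> real^'d \<Rightarrow> complex) \<Rightarrow> bool" where
  "schwartz F \<longleftrightarrow> (\<forall>k. rapid_derivatives k F)"

lemma rapid_derivatives_SucI:
  assumes "rapid F" "\<And>n x. (F n has_derivative (\<lambda>v. \<Sum>l\<in>UNIV. v $ l *\<^sub>R G l n x)) (at x)"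
    "\<And>l. rapid_derivatives k (G l)"
  shows "rapid_derivatives (Suc k) F"
proof -
  have "pd l (F n) = G l n" for l n
    using pd_eqI[OF assms(2)] by (auto simp: axis_def if_distrib[of "\<lambda>c. c *\<^sub>R _"] cong: if_cong)
  with assms show ?thesis by (auto simp: differentiable_def)
qed

lemma rapid_derivatives_rapid: "rapid_derivatives k F \<Longrightarrow> rapid F"
  by (cases k) auto

lemma rapid_derivatives_Suc_continuous: "rapid_derivatives (Suc k) F \<Longrightarrow> continuous_on UNIV (F n)"
  by (auto intro!: differentiable_imp_continuous_on simp: differentiable_on_def differentiable_at_withinI)

lemma rapid_derivatives_continuous: "rapid_derivatives k F \<Longrightarrow> continuous_on UNIV (F n)"
  by (cases k) (simp, metis rapid_derivatives_Suc_continuous)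

lemma rapid_derivatives_Suc_imp_rapid_derivatives: "rapid_derivatives (Suc k) F \<Longrightarrow> rapid_derivatives k F"
proof (induction k arbitrary: F)
  case 0
  then show ?case using rapid_derivatives_Suc_continuous[OF 0] by auto
next
  case (Suc k)
  then show ?case by (metis rapid_derivatives.simps(2))
qed

lemma rapid_derivatives_has_derivative:
  "rapid_derivatives (Suc k) F \<Longrightarrow> (F n has_derivative (\<lambda>v. \<Sum>l\<in>UNIV. v $ l *\<^sub>R pd l (F n) x)) (at x)"
  by (intro has_derivative_pd) auto

lemma rapid_derivatives_add: "rapid_derivatives k F \<Longrightarrow> rapid_derivatives k G \<Longrightarrow> rapid_derivatives k (\<lambda>n x. F n x + G n x)"
proof (induction k arbitrary: F G)
  case 0
  then show ?case by (auto intro!: rapid_add continuous_intros)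
next
  case (Suc k)
  show ?case
  proof (rule rapid_derivatives_SucI)
    show "((\<lambda>x. F n x + G n x) has_derivative (\<lambda>v. \<Sum>l\<in>UNIV. v $ l *\<^sub>R (pd l (F n) x + pd l (G n) x))) (at x)" for n x
      using has_derivative_add[OF rapid_derivatives_has_derivative[OF Suc.prems(1)] rapid_derivatives_has_derivative[OF Suc.prems(2)]]
      by (simp add: scaleR_add_right sum.distrib)
  qed (use Suc in \<open>auto intro: rapid_add\<close>)
qed

lemma rapid_cmult: "rapid F \<Longrightarrow> rapid (\<lambda>n x. c * F n x)"
  by (rule rapid_dominated[of F _ "cmod c" 0]) (auto simp: norm_mult)

lemma rapid_derivatives_cmult: "rapid_derivatives k F \<Longrightarrow> rapid_derivatives k (\<lambda>n x. c * F n x)"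
proof (induction k arbitrary: F)
  case 0
  then show ?case by (auto intro!: rapid_cmult continuous_intros)
next
  case (Suc k)
  show ?case
  proof (rule rapid_derivatives_SucI)
    show "((\<lambda>x. c * F n x) has_derivative (\<lambda>v. \<Sum>l\<in>UNIV. v $ l *\<^sub>R (c * pd l (F n) x))) (at x)" for n x
      using has_derivative_mult_right[OF rapid_derivatives_has_derivative[OF Suc.prems], of c]
      by (simp add: sum_distrib_left mult.left_commute scaleR_conv_of_real)
  qed (use Suc in \<open>auto intro: rapid_cmult\<close>)
qed

lemma rapid_0: "rapid (\<lambda>n x. 0)"
  by (auto simp: rapid_def)

lemma pd_const: "pd l (\<lambda>x. c) = (\<lambda>x. 0)"
  by (rule ext, subst pd_eqI[OF has_derivative_const]) simp

lemma rapid_derivatives_0: "rapid_derivatives k (\<lambda>n x. 0)"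
  by (induction k) (auto simp: rapid_0 pd_const)

lemma rapid_derivatives_sum: "(\<And>i. i \<in> I \<Longrightarrow> rapid_derivatives k (F i)) \<Longrightarrow> rapid_derivatives k (\<lambda>n x. \<Sum>i\<in>I. F i n x)"
  by (induction I rule: infinite_finite_induct) (auto intro: rapid_derivatives_add simp: rapid_derivatives_0)

lemma rapid_derivatives_coord: "rapid_derivatives k F \<Longrightarrow> rapid_derivatives k (\<lambda>n x. complex_of_real (x $ j) * F n x)"
proof (induction k arbitrary: F)
  case (0 F)
  have "rapid (\<lambda>n x. complex_of_real (x $ j) * F n x)"
    by (rule rapid_dominated[of F _ 1 1]) (use 0 in \<open>simp_all add: norm_mult mult_right_mono nth_le_l1_weight\<close>)
  with 0 show ?case by (auto intro!: continuous_intros)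
next
  case (Suc k F)
  show ?case
  proof (rule rapid_derivatives_SucI)
    show "rapid (\<lambda>n x. complex_of_real (x $ j) * F n x)"
      by (rule rapid_dominated[of F _ 1 1])
        (use Suc.prems in \<open>simp_all add: norm_mult mult_right_mono nth_le_l1_weight\<close>)
    show "((\<lambda>x. complex_of_real (x $ j) * F n x) has_derivative
        (\<lambda>v. \<Sum>l\<in>UNIV. v $ l *\<^sub>R (complex_of_real (x $ j) * pd l (F n) x + (if l = j then 1 else 0) * F n x))) (at x)" for n x
    proof -
      have "((\<lambda>x. complex_of_real (x $ j)) has_derivative (\<lambda>v. complex_of_real (v $ j))) (at x)"
        by (intro bounded_linear_imp_has_derivative bounded_linear_compose[OF bounded_linear_of_real]
            bounded_linear_vec_nth)
      from has_derivative_mult[OF this rapid_derivatives_has_derivative[OF Suc.prems]]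
      show ?thesis
        by (rule has_derivative_eq_rhs)
          (simp add: fun_eq_iff scaleR_add_right sum.distrib sum_distrib_left scaleR_conv_of_real[symmetric]
            if_distrib[of "\<lambda>c. c * _"] if_distrib[of "scaleR _"] cong: if_cong)
    qed
    show "rapid_derivatives k (\<lambda>n x. complex_of_real (x $ j) * pd l (F n) x + (if l = j then 1 else 0) * F n x)" for l
      using Suc.prems rapid_derivatives_Suc_imp_rapid_derivatives[OF Suc.prems] by (intro rapid_derivatives_add Suc.IH rapid_derivatives_cmult) auto
  qed
qed

lemma schwartz_pd: "schwartz F \<Longrightarrow> schwartz (\<lambda>n. pd l (F n))"
  by (metis rapid_derivatives.simps(2) schwartz_def)

lemma schwartz_coord: "schwartz F \<Longrightarrow> schwartz (\<lambda>n x. complex_of_real (x $ j) * F n x)"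
  by (simp add: schwartz_def rapid_derivatives_coord)

lemma schwartz_cmult: "schwartz F \<Longrightarrow> schwartz (\<lambda>n x. c * F n x)"
  by (simp add: schwartz_def rapid_derivatives_cmult)

lemma schwartz_rapid: "schwartz F \<Longrightarrow> rapid F"
  using rapid_derivatives_rapid by (auto simp: schwartz_def)

lemma schwartz_continuous: "schwartz F \<Longrightarrow> continuous_on UNIV (F n)"
  unfolding schwartz_def by (metis rapid_derivatives_continuous)

lemma schwartz_differentiable: "schwartz F \<Longrightarrow> F n differentiable (at x)"
  by (metis rapid_derivatives.simps(2) schwartz_def)

lemma schwartz_measurable: "schwartz F \<Longrightarrow> F n \<in> borel_measurable borel"
  by (intro borel_measurable_continuous_onI schwartz_continuous)

lemma schwartz_integrable: "schwartz F \<Longrightarrow> integrable lborel (F n)"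
  by (intro rapid_integrable schwartz_rapid schwartz_measurable)

section \<open>Test functions as constant Schwartz families\<close>

lemma Basis_cart_cases:
  assumes "b \<in> (Basis :: (real^'d) set)"
  obtains l where "b = axis l 1"
  using assms by (auto simp: Basis_vec_def)

lemma compact_support_bounded:
  fixes f :: "'a::euclidean_space \<Rightarrow> 'b::real_normed_vector"
  assumes "continuous_on UNIV f" "compact (closure {x. f x \<noteq> 0})"
  shows "\<exists>B. \<forall>x. norm (f x) \<le> B"
proof -
  have "compact (f ` closure {x. f x \<noteq> 0})"
    using assms by (intro compact_continuous_image) (auto intro: continuous_on_subset)
  then have "bounded (f ` closure {x. f x \<noteq> 0})"
    by (rule compact_imp_bounded)
  then obtain B where "\<forall>y\<in>f ` closure {x. f x \<noteq> 0}. norm y \<le> B"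
    unfolding bounded_iff by auto
  then have B: "\<And>x. x \<in> closure {x. f x \<noteq> 0} \<Longrightarrow> norm (f x) \<le> B"
    by simp
  have "norm (f x) \<le> max B 0" for x
  proof (cases "f x = 0")
    case False
    then have "x \<in> closure {x. f x \<noteq> 0}" by (intro closure_subset[THEN subsetD]) simp
    then show ?thesis using B by (simp add: le_max_iff_disj)
  qed simp
  then show ?thesis by blast
qed

lemma pd_zero_outside_support:
  assumes "x \<notin> closure {x. f x \<noteq> 0}"
  shows "pd l f x = 0"
proof -
  have "\<forall>\<^sub>F y in nhds x. y \<in> - closure {x. f x \<noteq> 0}"
    using assms by (intro eventually_nhds_in_open) auto
  then have "\<forall>\<^sub>F y in nhds x. f y = 0"
    by eventually_elim (use closure_subset[of "{x. f x \<noteq> 0}"] in auto)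
  then have "(f has_derivative (\<lambda>v. 0)) (at x)"
    using has_derivative_transform_eventually[of "\<lambda>_. 0" "\<lambda>v. 0" x UNIV f]
    using eventually_nhds_x_imp_x[of "\<lambda>y. f y = 0" x]
    by (simp add: eventually_at_filter eventually_mono[of "\<lambda>y. f y = 0"])
  then show ?thesis by (simp add: pd_eqI)
qed

lemma pd_support: "closure {x. pd l f x \<noteq> 0} \<subseteq> closure {x. f x \<noteq> 0}"
  using pd_zero_outside_support by (intro closure_minimal) auto

lemma test_function_pd:
  assumes "f \<in> test_functions S"
  shows "pd l f \<in> test_functions S"
proof -
  have "Ck k (pd l f)" for k
  proof -
    have "Ck (Suc k) f" using assms by (auto simp: test_functions_def)
    then have "Ck k (\<lambda>x. frechet_derivative f (at x) (axis l 1))"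
      by (auto simp: Basis_vec_def)
    then show ?thesis unfolding pd_def .
  qed
  moreover have "compact (closure {x. pd l f x \<noteq> 0})"
    using assms pd_support[of l f] compact_Int_closed[of "closure {x. f x \<noteq> 0}" "closure {x. pd l f x \<noteq> 0}"]
    by (simp add: test_functions_def Int_absorb1)
  ultimately show ?thesis
    using assms pd_support[of l f] by (auto simp: test_functions_def)
qed

text \<open>The product with any power of the weight is continuous with the same compact support,
  hence bounded.\<close>

lemma test_function_rapid:
  fixes f :: "real^'d \<Rightarrow> complex"
  assumes "f \<in> test_functions S"
  shows "rapid (\<lambda>n::'i. f)"
  unfolding rapid_def
proof
  fix m
  have "continuous_on UNIV (\<lambda>x. f x * of_real (l1_weight x) ^ m)"
    using assms Ck_imp_continuous[of 0 f] by (intro continuous_intros continuous_l1_weight) (auto simp: test_functions_def)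
  moreover have "{x. f x * of_real (l1_weight x) ^ m \<noteq> 0} = {x. f x \<noteq> 0}"
    using l1_weight_pos[THEN less_imp_neq] by auto
  ultimately have "\<exists>B. \<forall>x. norm (f x * of_real (l1_weight x) ^ m) \<le> B"
    using assms by (intro compact_support_bounded) (auto simp: test_functions_def)
  then show "\<exists>C. \<forall>n x. cmod (f x) * l1_weight x ^ m \<le> C"
    by (auto simp: norm_mult norm_power l1_weight_nonneg)
qed

lemma test_function_schwartz:
  fixes f :: "real^'d \<Rightarrow> complex"
  assumes "f \<in> test_functions S"
  shows "schwartz (\<lambda>n::'i. f)"
proof -
  have "rapid_derivatives k (\<lambda>n::'i. f)" for k
    using assms
  proof (induction k arbitrary: f)
    case 0
    then show ?case by (auto simp: test_function_rapid test_functions_def Ck_imp_continuous)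
  next
    case (Suc k)
    have "f differentiable (at x)" for x
      using Suc.prems Ck.simps(2)[of 0 f] by (auto simp: test_functions_def)
    with Suc show ?case by (auto simp: test_function_rapid test_function_pd)
  qed
  then show ?thesis by (simp add: schwartz_def)
qed

section \<open>The Fourier transform\<close>

lemma lborel_integral_shift:
  fixes f :: "'a::euclidean_space \<Rightarrow> 'b::{banach, second_countable_topology}"
  assumes [measurable]: "f \<in> borel_measurable borel"
  shows "(LINT x|lborel. f (c + x)) = (LINT x|lborel. f x)"
    and "integrable lborel (\<lambda>x. f (c + x)) \<longleftrightarrow> integrable lborel f"
proof -
  have "(LINT x|lborel. f x) = (LINT x|distr lborel borel ((+) c). f x)"
    by (simp add: lborel_distr_plus)
  also have "\<dots> = (LINT x|lborel. f (c + x))"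
    by (subst integral_distr) simp_all
  finally show "(LINT x|lborel. f (c + x)) = (LINT x|lborel. f x)" ..
  have "integrable lborel f \<longleftrightarrow> integrable (distr lborel borel ((+) c)) f"
    by (simp add: lborel_distr_plus)
  also have "\<dots> \<longleftrightarrow> integrable lborel (\<lambda>x. f (c + x))"
    by (subst integrable_distr_eq) simp_all
  finally show "integrable lborel (\<lambda>x. f (c + x)) \<longleftrightarrow> integrable lborel f" ..
qed

lemma lborel_integral_scale:
  fixes f :: "'a::euclidean_space \<Rightarrow> 'b::{banach, second_countable_topology}"
  assumes [measurable]: "f \<in> borel_measurable borel" and c: "c > 0"
  shows "(LINT x|lborel. f x) = c ^ DIM('a) *\<^sub>R (LINT x|lborel. f (c *\<^sub>R x))"
proof -
  have "(LINT x|lborel. f x) = (LINT x|density (distr lborel borel (\<lambda>x. 0 + c *\<^sub>R x)) (\<lambda>_. \<bar>c\<bar> ^ DIM('a)). f x)"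
    using lborel_affine[of c "0::'a"] c by simp
  also have "\<dots> = c ^ DIM('a) *\<^sub>R (LINT x|lborel. f (c *\<^sub>R x))"
    using c by (subst integral_density) (simp_all add: integral_distr)
  finally show ?thesis .
qed

text \<open>Without normalization and with a real parameter in the phase: \<open>s = - 1\<close> is
  the transform and \<open>s = 1\<close> the inverse one, up to the constant
  \<open>(gauss_mass TYPE('d))\<^sup>2\<close>, which is (2 pi)^d.\<close>

definition FT :: "real \<Rightarrow> (real^'d \<Rightarrow> complex) \<Rightarrow> real^'d \<Rightarrow> complex" where
  "FT s f \<xi> = (LINT x|lborel. cis (s * (x \<bullet> \<xi>)) * f x)"

lemma cis_continuous: "continuous_on S g \<Longrightarrow> continuous_on S (\<lambda>x. cis (g x))"
  by (simp add: cis_conv_exp) (intro continuous_intros)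

lemma FT_integrand_measurable [measurable]:
  "f \<in> borel_measurable borel \<Longrightarrow> (\<lambda>x. cis (s * (x \<bullet> \<xi>)) * f x) \<in> borel_measurable borel"
proof -
  have "(\<lambda>x. cis (s * (x \<bullet> \<xi>))) \<in> borel_measurable borel"
    by (intro borel_measurable_continuous_onI cis_continuous continuous_intros)
  then show "f \<in> borel_measurable borel \<Longrightarrow> ?thesis" by measurable
qed

lemma FT_integrand_integrable:
  "integrable lborel f \<Longrightarrow> integrable lborel (\<lambda>x. cis (s * (x \<bullet> \<xi>)) * f x)"
  by (rule Bochner_Integration.integrable_bound[of lborel f])
    (auto simp: norm_mult intro: FT_integrand_measurable dest: borel_measurable_integrable)

lemma norm_FT_le: "integrable lborel f \<Longrightarrow> cmod (FT s f \<xi>) \<le> (LINT x|lborel. cmod (f x))"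
  unfolding FT_def by (rule order_trans[OF integral_norm_bound]) (simp add: norm_mult)

lemma FT_add:
  "integrable lborel f \<Longrightarrow> integrable lborel g \<Longrightarrow> FT s (\<lambda>x. f x + g x) \<xi> = FT s f \<xi> + FT s g \<xi>"
  unfolding FT_def by (simp add: distrib_left FT_integrand_integrable)

lemma FT_cmult: "FT s (\<lambda>x. c * f x) \<xi> = c * FT s f \<xi>"
  unfolding FT_def by (simp add: mult.left_commute[of _ c])

lemma FT_sum:
  "(\<And>i. i \<in> I \<Longrightarrow> integrable lborel (f i)) \<Longrightarrow> FT s (\<lambda>x. \<Sum>i\<in>I. f i x) \<xi> = (\<Sum>i\<in>I. FT s (f i) \<xi>)"
  unfolding FT_def by (simp add: sum_distrib_left FT_integrand_integrable)

text \<open>A quadratic remainder bound replaces differentiation under the integral; it serves for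
  the Fourier transform and for the resolvent.\<close>

lemma has_derivativeI_quadratic:
  fixes f :: "'a::real_normed_vector \<Rightarrow> 'b::real_normed_vector"
  assumes L: "bounded_linear L"
    and q: "\<And>h. norm h \<le> 1 \<Longrightarrow> norm (f (x + h) - f x - L h) \<le> C * (norm h)\<^sup>2"
  shows "(f has_derivative L) (at x)"
  unfolding has_derivative_at
proof (intro conjI L)
  have "((\<lambda>h::'a. C * norm h) \<longlongrightarrow> 0) (at 0)"
    by (rule tendsto_mult_right_zero[OF tendsto_norm_zero[OF tendsto_ident_at]])
  then show "((\<lambda>h. norm (f (x + h) - f x - L h) / norm h) \<longlongrightarrow> 0) (at 0)"
  proof (rule Lim_null_comparison[rotated])
    have "\<forall>\<^sub>F h in at (0::'a). norm h < 1"
      by (rule order_tendstoD(2)[OF tendsto_norm_zero[OF tendsto_ident_at]]) simp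
    then show "\<forall>\<^sub>F h in at 0. norm (norm (f (x + h) - f x - L h) / norm h) \<le> C * norm h"
    proof (rule eventually_mono)
      fix h :: 'a assume "norm h < 1"
      then show "norm (norm (f (x + h) - f x - L h) / norm h) \<le> C * norm h"
        using q[of h] by (cases "h = 0") (auto simp: divide_le_eq power2_eq_square mult.assoc)
    qed
  qed
qed

lemma norm_cis_remainder: "cmod (cis \<theta> - 1 - \<i> * complex_of_real \<theta>) \<le> \<theta>\<^sup>2"
proof -
  have "cmod (exp (\<i> * of_real \<theta>) - (\<Sum>k\<le>1. (\<i> * of_real \<theta>) ^ k / fact k))
      \<le> exp \<bar>Re (\<i> * of_real \<theta>)\<bar> * cmod (\<i> * of_real \<theta>) ^ Suc 1 / fact 1"
    by (rule Taylor_exp)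
  then show ?thesis by (simp add: cis_conv_exp norm_mult power2_eq_square diff_diff_add)
qed

text \<open>The remainder is a single integral with the factor
  \<open>cis \<theta> - 1 - \<i> * \<theta>\<close>, at most \<theta> squared in modulus; rapid
  decrease makes the second moment of \<open>f\<close> finite. A single function is written as a
  constant family.\<close>

lemma FT_has_derivative:
  fixes f :: "real^'d \<Rightarrow> complex"
  assumes f: "rapid (\<lambda>n::nat. f)" "f \<in> borel_measurable borel"
  shows "(FT s f has_derivative
    (\<lambda>h. \<Sum>l\<in>UNIV. h $ l *\<^sub>R (\<i> * of_real s * FT s (\<lambda>x. of_real (x $ l) * f x) \<xi>))) (at \<xi>)"
proof -
  note [measurable] = f(2)
  have int: "integrable lborel (\<lambda>x. of_real (x $ l) * f x)" for l
    by (rule rapid_integrable[of "\<lambda>n::nat. \<lambda>x. of_real (x $ l) * f x"])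
      (auto intro!: rapid_dominated[OF f(1), of _ 1 1] mult_right_mono simp: norm_mult nth_le_l1_weight)
  have int_f: "integrable lborel f"
    by (rule rapid_integrable[OF f])
  have int2: "integrable lborel (\<lambda>x. (norm x)\<^sup>2 * cmod (f x))"
  proof -
    have "integrable lborel (\<lambda>x. of_real ((norm x)\<^sup>2) * f x)"
      by (rule rapid_integrable[of "\<lambda>n::nat. \<lambda>x. of_real ((norm x)\<^sup>2) * f x"])
        (auto intro!: rapid_dominated[OF f(1), of _ 1 2] mult_right_mono power_mono simp: norm_mult norm_power norm_le_l1_weight)
    from integrable_norm[OF this] show ?thesis by (simp add: norm_mult norm_power)
  qed
  define L where "L h = (\<Sum>l\<in>UNIV. h $ l *\<^sub>R (\<i> * of_real s * FT s (\<lambda>x. of_real (x $ l) * f x) \<xi>))" for h :: "real^'d"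
  have L_eq: "L h = (LINT x|lborel. cis (s * (x \<bullet> \<xi>)) * (\<i> * of_real (s * (x \<bullet> h)) * f x))" for h
  proof -
    have "L h = FT s (\<lambda>x. \<Sum>l\<in>UNIV. (of_real (h $ l) * (\<i> * of_real s)) * (of_real (x $ l) * f x)) \<xi>"
      unfolding L_def by (subst FT_sum) (auto simp: FT_cmult int scaleR_conv_of_real mult.assoc)
    also have "(\<lambda>x. \<Sum>l\<in>UNIV. (of_real (h $ l) * (\<i> * of_real s)) * (of_real (x $ l) * f x))
       = (\<lambda>x. \<i> * of_real (s * (x \<bullet> h)) * f x)"
      by (simp add: inner_vec_def sum_distrib_left sum_distrib_right mult_ac fun_eq_iff)
    finally show ?thesis by (simp add: FT_def)
  qed
  have int3: "integrable lborel (\<lambda>x. cis (s * (x \<bullet> \<xi>)) * (\<i> * of_real (s * (x \<bullet> h)) * f x))" for h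
  proof (rule FT_integrand_integrable)
    have "integrable lborel (\<lambda>x. \<Sum>l\<in>UNIV. (of_real (h $ l) * (\<i> * of_real s)) * (of_real (x $ l) * f x))"
      by (intro Bochner_Integration.integrable_sum integrable_mult_right int)
    then show "integrable lborel (\<lambda>x. \<i> * of_real (s * (x \<bullet> h)) * f x)"
      by (simp add: inner_vec_def sum_distrib_left sum_distrib_right mult_ac)
  qed
  have "(FT s f has_derivative L) (at \<xi>)"
  proof (rule has_derivativeI_quadratic)
    show "bounded_linear L"
      unfolding L_def
      by (intro bounded_linear_sum bounded_linear_scaleR_const bounded_linear_vec_nth)
    fix h :: "real^'d"
    have "FT s f (\<xi> + h) - FT s f \<xi> - L h =
      (LINT x|lborel. cis (s * (x \<bullet> \<xi>)) * ((cis (s * (x \<bullet> h)) - 1 - \<i> * of_real (s * (x \<bullet> h))) * f x))"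
      (is "_ = (LINT x|lborel. ?r x)")
    proof -
      have "(LINT x|lborel. ?r x) = (LINT x|lborel. cis (s * (x \<bullet> (\<xi> + h))) * f x - cis (s * (x \<bullet> \<xi>)) * f x
          - cis (s * (x \<bullet> \<xi>)) * (\<i> * of_real (s * (x \<bullet> h)) * f x))"
        by (intro Bochner_Integration.integral_cong) (auto simp: inner_add_right distrib_left cis_mult[symmetric] algebra_simps)
      then show ?thesis
        unfolding L_eq FT_def
        by (simp only: Bochner_Integration.integral_diff Bochner_Integration.integrable_diff FT_integrand_integrable int_f int3)
    qed
    also have "cmod \<dots> \<le> (LINT x|lborel. (s\<^sup>2 * (norm h)\<^sup>2) * ((norm x)\<^sup>2 * cmod (f x)))"
    proof (rule Bochner_Integration.integral_norm_bound_integral)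
      fix x :: "real^'d"
      have "cmod (?r x) = cmod (cis (s * (x \<bullet> h)) - 1 - \<i> * of_real (s * (x \<bullet> h))) * cmod (f x)"
        by (simp add: norm_mult)
      also have "\<dots> \<le> (s * (x \<bullet> h))\<^sup>2 * cmod (f x)"
        by (intro mult_right_mono norm_cis_remainder) simp
      also have "\<dots> \<le> (s\<^sup>2 * ((norm x)\<^sup>2 * (norm h)\<^sup>2)) * cmod (f x)"
      proof -
        have "\<bar>x \<bullet> h\<bar>\<^sup>2 \<le> (norm x * norm h)\<^sup>2"
          by (intro power_mono Cauchy_Schwarz_ineq2) simp
        then show ?thesis by (auto simp: power_mult_distrib intro!: mult_right_mono mult_left_mono)
      qed
      finally show "cmod (?r x) \<le> (s\<^sup>2 * (norm h)\<^sup>2) * ((norm x)\<^sup>2 * cmod (f x))"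
        by (simp add: mult_ac)
    next
      have "integrable lborel (\<lambda>x. cis (s * (x \<bullet> (\<xi> + h))) * f x - cis (s * (x \<bullet> \<xi>)) * f x
          - cis (s * (x \<bullet> \<xi>)) * (\<i> * of_real (s * (x \<bullet> h)) * f x))"
        by (intro Bochner_Integration.integrable_diff FT_integrand_integrable int_f int3)
      then show "integrable lborel ?r"
        by (rule Bochner_Integration.integrable_cong[THEN iffD1, rotated 2])
          (auto simp: inner_add_right distrib_left cis_mult[symmetric] algebra_simps)
    qed (intro integrable_mult_right int2)
    also have "\<dots> = (s\<^sup>2 * (LINT x|lborel. (norm x)\<^sup>2 * cmod (f x))) * (norm h)\<^sup>2"
      by simp
    finally show "norm (FT s f (\<xi> + h) - FT s f \<xi> - L h) \<le>
      (s\<^sup>2 * (LINT x|lborel. (norm x)\<^sup>2 * cmod (f x))) * (norm h)\<^sup>2" .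
  qed
  then show ?thesis unfolding L_def .
qed

text \<open>Translation invariance gives each difference quotient along the axis the integral 0.
  Decay of the derivative provides a dominating function, and the quotients converge to the
  derivative.\<close>

lemma integral_pd_eq_0:
  fixes f :: "real^'d \<Rightarrow> complex"
  assumes f: "schwartz (\<lambda>n::nat. f)"
  shows "(LINT x|lborel. pd l f x) = 0"
proof -
  define u :: "real^'d" where "u = axis l 1"
  define q :: "nat \<Rightarrow> real^'d \<Rightarrow> complex" where
    "q n x = (f ((1 / real (Suc n)) *\<^sub>R u + x) - f x) * of_nat (Suc n)" for n x
  note [measurable] = schwartz_measurable[OF f] schwartz_measurable[OF schwartz_pd[OF f]]
  have int_f: "integrable lborel f"
    by (rule schwartz_integrable[OF f])
  have q0: "(LINT x|lborel. q n x) = 0" for n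
    unfolding q_def using lborel_integral_shift[of f] int_f by simp
  obtain C where C: "C \<ge> 0" "\<And>x. cmod (pd l f x) \<le> C * inverse (l1_weight x ^ (2 * CARD('d)))"
    using rapid_bound[OF schwartz_rapid[OF schwartz_pd[OF f]]] by metis
  have der: "((\<lambda>s. f (s *\<^sub>R u + x)) has_vector_derivative pd l f (s *\<^sub>R u + x)) (at s within S)" for s x S
  proof -
    have "((\<lambda>s. f (s *\<^sub>R u + x)) has_derivative (\<lambda>r. \<Sum>j\<in>UNIV. (r *\<^sub>R u) $ j *\<^sub>R pd j f (s *\<^sub>R u + x))) (at s within S)"
      by (rule has_derivative_compose[OF _ has_derivative_pd[OF schwartz_differentiable[OF f]]])
        (auto intro!: derivative_eq_intros)
    then show ?thesis
      by (simp add: has_vector_derivative_def u_def axis_def if_distrib[of "\<lambda>c. c *\<^sub>R _"] if_distrib[of "\<lambda>c. _ * c"] cong: if_cong)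
  qed
  have "(\<lambda>n. LINT x|lborel. q n x) \<longlonglongrightarrow> (LINT x|lborel. pd l f x)"
  proof (rule integral_dominated_convergence)
    \<comment> \<open>The power of 2 pays for evaluating the derivative at points translated by at
      most 1: such a translation changes the weight by at most the factor 2.\<close>
    show "integrable lborel (\<lambda>x::real^'d. C * 2 ^ (2 * CARD('d)) * inverse (l1_weight x ^ (2 * CARD('d))))"
      by (intro integrable_mult_right integrable_inverse_l1_weight) simp
    show "AE x in lborel. (\<lambda>n. q n x) \<longlonglongrightarrow> pd l f x"
    proof (rule AE_I2)
      fix x
      have "((\<lambda>s. (f (s *\<^sub>R u + x) - f x) /\<^sub>R s) \<longlongrightarrow> pd l f x) (at 0)"
      proof (rule LIM_zero_cancel, rule tendsto_norm_zero_cancel, rule Lim_transform_eventually)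
        show "((\<lambda>s. cmod (f ((0 + s) *\<^sub>R u + x) - f (0 *\<^sub>R u + x) - s *\<^sub>R pd l f (0 *\<^sub>R u + x)) / norm s) \<longlongrightarrow> 0) (at 0)"
          using der[of x 0 UNIV] unfolding has_vector_derivative_def has_derivative_at by blast
        have "cmod (f (s *\<^sub>R u + x) - f x - s *\<^sub>R pd l f x) / \<bar>s\<bar> = cmod ((f (s *\<^sub>R u + x) - f x) /\<^sub>R s - pd l f x)"
          if "s \<noteq> 0" for s
        proof -
          have "(f (s *\<^sub>R u + x) - f x) /\<^sub>R s - pd l f x = (f (s *\<^sub>R u + x) - f x - s *\<^sub>R pd l f x) /\<^sub>R s"
            using that by (simp add: scaleR_diff_right)
          then show ?thesis by (simp add: divide_inverse mult.commute)
        qed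
        then show "\<forall>\<^sub>F s in at 0. cmod (f ((0 + s) *\<^sub>R u + x) - f (0 *\<^sub>R u + x) - s *\<^sub>R pd l f (0 *\<^sub>R u + x)) / norm s
            = norm ((f (s *\<^sub>R u + x) - f x) /\<^sub>R s - pd l f x)"
          by (auto simp: eventually_at_filter)
      qed
      then have "(\<lambda>n. (f (inverse (real (Suc n)) *\<^sub>R u + x) - f x) /\<^sub>R inverse (real (Suc n))) \<longlonglongrightarrow> pd l f x"
        by (rule filterlim_compose)
          (use LIMSEQ_inverse_real_of_nat in \<open>simp add: filterlim_at\<close>)
      then show "(\<lambda>n. q n x) \<longlonglongrightarrow> pd l f x"
        by (simp add: q_def inverse_eq_divide scaleR_conv_of_real mult.commute)
    qed
    fix n
    show "AE x in lborel. norm (q n x) \<le> C * 2 ^ (2 * CARD('d)) * inverse (l1_weight x ^ (2 * CARD('d)))"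
    proof (rule AE_I2)
      fix x
      define \<delta> where "\<delta> = 1 / real (Suc n)"
      have \<delta>: "0 < \<delta>" "\<delta> \<le> 1" by (auto simp: \<delta>_def)
      have B: "cmod (pd l f (s *\<^sub>R u + x)) \<le> C * 2 ^ (2 * CARD('d)) * inverse (l1_weight x ^ (2 * CARD('d)))"
        if "s \<in> {0..\<delta>}" for s
      proof -
        have "l1_weight (- (s *\<^sub>R u)) \<le> 2"
          using that \<delta> by (simp add: l1_weight_def u_def axis_def if_distrib[of abs] if_distrib[of "\<lambda>c. _ * c"] abs_mult sum.delta cong: if_cong)
        then have "l1_weight (s *\<^sub>R u + x) * l1_weight (- (s *\<^sub>R u)) \<le> l1_weight (s *\<^sub>R u + x) * 2"
          by (intro mult_left_mono) (auto simp: l1_weight_nonneg)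
        then have "l1_weight x \<le> l1_weight (s *\<^sub>R u + x) * 2"
          using l1_weight_add_le[of "s *\<^sub>R u + x" "- (s *\<^sub>R u)"] by simp
        then have "l1_weight x ^ (2 * CARD('d)) \<le> (l1_weight (s *\<^sub>R u + x) * 2) ^ (2 * CARD('d))"
          by (intro power_mono) (auto simp: l1_weight_nonneg)
        then have "inverse (l1_weight (s *\<^sub>R u + x) ^ (2 * CARD('d))) \<le> 2 ^ (2 * CARD('d)) * inverse (l1_weight x ^ (2 * CARD('d)))"
          using l1_weight_pos[of x] l1_weight_pos[of "s *\<^sub>R u + x"] by (simp add: power_mult_distrib field_simps)
        then have "C * inverse (l1_weight (s *\<^sub>R u + x) ^ (2 * CARD('d))) \<le> C * (2 ^ (2 * CARD('d)) * inverse (l1_weight x ^ (2 * CARD('d))))"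
          using C(1) by (rule mult_left_mono)
        then show ?thesis using C(2)[of "s *\<^sub>R u + x"] by (simp add: mult.assoc)
      qed
      have "norm (f (\<delta> *\<^sub>R u + x) - f (0 *\<^sub>R u + x)) \<le>
          (C * 2 ^ (2 * CARD('d)) * inverse (l1_weight x ^ (2 * CARD('d)))) * norm (\<delta> - 0)"
      proof (rule differentiable_bound)
        show "convex {0..\<delta>}" by simp
        show "((\<lambda>s. f (s *\<^sub>R u + x)) has_derivative (\<lambda>h. h *\<^sub>R pd l f (s *\<^sub>R u + x))) (at s within {0..\<delta>})" for s
          using der[of x s "{0..\<delta>}"] by (simp add: has_vector_derivative_def)
        show "onorm (\<lambda>h. h *\<^sub>R pd l f (s *\<^sub>R u + x)) \<le> C * 2 ^ (2 * CARD('d)) * inverse (l1_weight x ^ (2 * CARD('d)))"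
          if "s \<in> {0..\<delta>}" for s
          using mult_right_mono[OF B[OF that] abs_ge_zero] by (intro onorm_le) (simp add: mult.commute)
      qed (use \<delta> in auto)
      moreover have "norm (q n x) = norm (f (\<delta> *\<^sub>R u + x) - f x) / \<delta>"
        by (simp add: q_def \<delta>_def norm_mult del: of_nat_Suc)
      ultimately show "norm (q n x) \<le> C * 2 ^ (2 * CARD('d)) * inverse (l1_weight x ^ (2 * CARD('d)))"
        using \<delta> by (simp add: divide_le_eq)
    qed
  qed (auto simp: q_def)
  then have "(\<lambda>n. 0) \<longlonglongrightarrow> (LINT x|lborel. pd l f x)" by (simp add: q0)
  then show ?thesis using LIMSEQ_unique[OF tendsto_const] by metis
qed

lemma rapid_single: "rapid F \<Longrightarrow> rapid (\<lambda>m. F n)"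
  unfolding rapid_def by meson

text \<open>Freezes one member of a family as a constant family, so that statements on single
  functions apply to it.\<close>

lemma schwartz_single: "schwartz F \<Longrightarrow> schwartz (\<lambda>m::'j. F n)"
proof -
  have "rapid_derivatives k F \<Longrightarrow> rapid_derivatives k (\<lambda>m::'j. F n)" for k
  proof (induction k arbitrary: F)
    case 0
    then show ?case by (auto intro: rapid_single)
  next
    case (Suc k)
    have "rapid_derivatives k (\<lambda>m::'j. pd l (F n))" for l
      using Suc.IH[of "\<lambda>n. pd l (F n)"] Suc.prems by simp
    moreover have "rapid (\<lambda>m::'j. F n)"
      using Suc.prems by (auto intro: rapid_single)
    ultimately show ?case using Suc.prems by simp
  qed
  then show "schwartz F \<Longrightarrow> ?thesis" by (simp add: schwartz_def)
qed

text \<open>Integration by parts: the integral of the derivative of the character times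
  \<open>f\<close> vanishes, and the product rule splits it into the two terms of the
  formula.\<close>

lemma FT_pd:
  fixes f :: "real^'d \<Rightarrow> complex"
  assumes f: "schwartz (\<lambda>n::nat. f)"
  shows "FT s (pd l f) \<xi> = - \<i> * of_real (s * \<xi> $ l) * FT s f \<xi>"
proof -
  define c :: "real^'d \<Rightarrow> complex" where "c x = cis (s * (x \<bullet> \<xi>))" for x
  have c': "(c has_derivative (\<lambda>v. \<Sum>j\<in>UNIV. v $ j *\<^sub>R (\<i> * of_real (s * \<xi> $ j) * c x))) (at x)" for x
  proof -
    have "((\<lambda>x. s * (x \<bullet> \<xi>)) has_derivative (\<lambda>v. s * (v \<bullet> \<xi>))) (at x)"
      by (intro derivative_intros)
    then have "((\<lambda>x. \<i> * complex_of_real (s * (x \<bullet> \<xi>))) has_derivative (\<lambda>v. \<i> * complex_of_real (s * (v \<bullet> \<xi>)))) (at x)"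
      by (intro derivative_intros)
    then have "((\<lambda>x. exp (\<i> * complex_of_real (s * (x \<bullet> \<xi>)))) has_derivative
        (\<lambda>v. exp (\<i> * complex_of_real (s * (x \<bullet> \<xi>))) * (\<i> * complex_of_real (s * (v \<bullet> \<xi>))))) (at x)"
      by (rule has_derivative_compose[OF _ DERIV_exp[unfolded has_field_derivative_def]])
    moreover have "c = (\<lambda>x. exp (\<i> * complex_of_real (s * (x \<bullet> \<xi>))))"
      by (simp add: c_def cis_conv_exp fun_eq_iff)
    ultimately show ?thesis
      by (simp add: inner_vec_def sum_distrib_left sum_distrib_right scaleR_conv_of_real mult_ac)
  qed
  \<comment> \<open>Differentiating the character reproduces it up to a constant, so the induction
    closes; \<open>g\<close> stays general because it is replaced by its derivatives.\<close>
  have prod: "rapid_derivatives k (\<lambda>n::nat. \<lambda>x. c x * g x)" if "schwartz (\<lambda>n::nat. g)" for g k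
    using that
  proof (induction k arbitrary: g)
    case 0
    have "rapid (\<lambda>n::nat. \<lambda>x. c x * g x)"
      by (rule rapid_dominated[OF schwartz_rapid[OF 0], of _ 1 0]) (auto simp: norm_mult c_def)
    moreover have "continuous_on UNIV c"
      unfolding c_def by (intro cis_continuous continuous_intros)
    ultimately show ?case using schwartz_continuous[OF 0] by (auto intro: continuous_intros)
  next
    case (Suc k)
    show ?case
    proof (rule rapid_derivatives_SucI)
      show "rapid (\<lambda>n::nat. \<lambda>x. c x * g x)"
        by (rule rapid_dominated[OF schwartz_rapid[OF Suc.prems], of _ 1 0]) (auto simp: norm_mult c_def)
      show "((\<lambda>x. c x * g x) has_derivative
        (\<lambda>v. \<Sum>l\<in>UNIV. v $ l *\<^sub>R (c x * pd l g x + (\<i> * of_real (s * \<xi> $ l)) * (c x * g x)))) (at x)" for x and n :: nat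
        using has_derivative_mult[OF c' has_derivative_pd[OF schwartz_differentiable[OF Suc.prems]]]
        by (rule has_derivative_eq_rhs)
          (simp add: fun_eq_iff scaleR_add_right sum.distrib sum_distrib_left sum_distrib_right mult.assoc)
      show "rapid_derivatives k (\<lambda>n::nat. \<lambda>x. c x * pd l g x + (\<i> * of_real (s * \<xi> $ l)) * (c x * g x))" for l
        by (intro rapid_derivatives_add rapid_derivatives_cmult Suc.IH schwartz_pd[OF Suc.prems] Suc.prems)
    qed
  qed
  have cf: "schwartz (\<lambda>n::nat. \<lambda>x. c x * f x)"
    using prod[OF f] by (simp add: schwartz_def)
  have "pd l (\<lambda>x. c x * f x) x = c x * pd l f x + (\<i> * of_real (s * \<xi> $ l)) * (c x * f x)" for x
  proof -
    have "pd l (\<lambda>x. c x * f x) x =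
      c x * (\<Sum>j\<in>UNIV. axis l 1 $ j *\<^sub>R pd j f x) + (\<Sum>j\<in>UNIV. axis l 1 $ j *\<^sub>R (\<i> * of_real (s * \<xi> $ j) * c x)) * f x"
      by (rule pd_eqI[OF has_derivative_mult[OF c' has_derivative_pd[OF schwartz_differentiable[OF f]]]])
    then show ?thesis
      by (simp add: axis_def if_distrib[of "\<lambda>c. c *\<^sub>R _"] mult.assoc cong: if_cong)
  qed
  then have "0 = (LINT x|lborel. c x * pd l f x + (\<i> * of_real (s * \<xi> $ l)) * (c x * f x))"
    using integral_pd_eq_0[OF cf, of l] by simp
  also have "\<dots> = FT s (pd l f) \<xi> + (\<i> * of_real (s * \<xi> $ l)) * FT s f \<xi>"
    unfolding FT_def c_def
    by (subst Bochner_Integration.integral_add)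
      (auto intro!: FT_integrand_integrable integrable_mult_right schwartz_integrable[OF schwartz_pd[OF f]] schwartz_integrable[OF f])
  finally show ?thesis
    using eq_neg_iff_add_eq_0[of "FT s (pd l f) \<xi>" "(\<i> * of_real (s * \<xi> $ l)) * FT s f \<xi>"] by simp
qed

text \<open>Induction on the power of the weight. One more power costs the sum of the moduli of the
  coordinates, and each of these is exchanged for a derivative of \<open>F\<close> by
  \<open>FT_pd\<close>. The constants come from bounds uniform in the index and stay so.\<close>

lemma rapid_FT:
  fixes F :: "'i \<Rightarrow> real^'d \<Rightarrow> complex"
  assumes F: "schwartz F" and s: "s \<noteq> 0"
  shows "rapid (\<lambda>n. FT s (F n))"
proof -
  have "\<exists>C. \<forall>n \<xi>. cmod (FT s (F n) \<xi>) * l1_weight \<xi> ^ m \<le> C" for m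
    using F
  proof (induction m arbitrary: F)
    case 0
    obtain C where C: "\<And>n x. cmod (F n x) \<le> C * inverse (l1_weight x ^ (2 * CARD('d)))"
      using rapid_bound[OF schwartz_rapid[OF 0]] by metis
    have "cmod (FT s (F n) \<xi>) \<le> (LINT x|lborel. C * inverse (l1_weight (x::real^'d) ^ (2 * CARD('d))))" for n \<xi>
    proof -
      have "cmod (FT s (F n) \<xi>) \<le> (LINT x|lborel. cmod (F n x))"
        by (rule norm_FT_le[OF schwartz_integrable[OF 0]])
      also have "\<dots> \<le> (LINT x|lborel. C * inverse (l1_weight (x::real^'d) ^ (2 * CARD('d))))"
        using C by (intro integral_mono integrable_norm schwartz_integrable[OF 0] integrable_mult_right integrable_inverse_l1_weight) auto
      finally show ?thesis .
    qed
    then show ?case by auto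
  next
    case (Suc m)
    obtain C where C: "\<And>n \<xi>. cmod (FT s (F n) \<xi>) * l1_weight \<xi> ^ m \<le> C"
      using Suc.IH[OF Suc.prems] by blast
    have "\<forall>l. \<exists>D. \<forall>n \<xi>. cmod (FT s (pd l (F n)) \<xi>) * l1_weight \<xi> ^ m \<le> D"
      using Suc.IH[OF schwartz_pd[OF Suc.prems]] by blast
    then obtain D where D: "\<And>l n \<xi>. cmod (FT s (pd l (F n)) \<xi>) * l1_weight \<xi> ^ m \<le> D l"
      by metis
    have "cmod (FT s (F n) \<xi>) * l1_weight \<xi> ^ Suc m \<le> C + inverse \<bar>s\<bar> * (\<Sum>l\<in>UNIV. D l)" for n \<xi>
    proof -
      have *: "cmod (FT s (F n) \<xi>) * \<bar>\<xi> $ l\<bar> = inverse \<bar>s\<bar> * cmod (FT s (pd l (F n)) \<xi>)" for l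
        using FT_pd[OF schwartz_single[OF Suc.prems], of s l n \<xi>] s by (simp add: norm_mult abs_mult)
      have "cmod (FT s (F n) \<xi>) * l1_weight \<xi> ^ Suc m = cmod (FT s (F n) \<xi>) * l1_weight \<xi> ^ m
          + (\<Sum>l\<in>UNIV. cmod (FT s (F n) \<xi>) * \<bar>\<xi> $ l\<bar>) * l1_weight \<xi> ^ m"
      proof -
        have "(\<Sum>l\<in>UNIV. cmod (FT s (F n) \<xi>) * \<bar>\<xi> $ l\<bar>) = cmod (FT s (F n) \<xi>) * (l1_weight \<xi> - 1)"
          by (simp add: l1_weight_def sum_distrib_left)
        then show ?thesis unfolding power_Suc by (simp only:) (simp add: algebra_simps)
      qed
      also have "(\<Sum>l\<in>UNIV. cmod (FT s (F n) \<xi>) * \<bar>\<xi> $ l\<bar>) * l1_weight \<xi> ^ m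
          = inverse \<bar>s\<bar> * (\<Sum>l\<in>UNIV. cmod (FT s (pd l (F n)) \<xi>) * l1_weight \<xi> ^ m)"
        unfolding * by (simp add: sum_distrib_left sum_distrib_right mult.assoc)
      also have "\<dots> \<le> inverse \<bar>s\<bar> * (\<Sum>l\<in>UNIV. D l)"
        by (intro mult_left_mono sum_mono D) simp
      finally show ?thesis using C[of n \<xi>] by linarith
    qed
    then show ?case by blast
  qed
  then show ?thesis by (simp add: rapid_def)
qed

text \<open>A derivative of the transform is the transform of a coordinate multiple, which is again
  a Schwartz family; so \<open>rapid_FT\<close> applies at every order.\<close>

lemma schwartz_FT:
  fixes F :: "'i \<Rightarrow> real^'d \<Rightarrow> complex"
  assumes F: "schwartz F" and s: "s \<noteq> 0"
  shows "schwartz (\<lambda>n. FT s (F n))"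
proof -
  have der: "(FT s (F n) has_derivative
    (\<lambda>h. \<Sum>l\<in>UNIV. h $ l *\<^sub>R (\<i> * of_real s * FT s (\<lambda>x. of_real (x $ l) * F n x) \<xi>))) (at \<xi>)"
    if "schwartz F" for F :: "'i \<Rightarrow> real^'d \<Rightarrow> complex" and n \<xi>
    using FT_has_derivative[OF rapid_single[OF schwartz_rapid[OF that]] schwartz_measurable[OF that]] .
  have "rapid_derivatives k (\<lambda>n. FT s (F n))" for k
    using F
  proof (induction k arbitrary: F)
    case 0
    then show ?case
      using rapid_FT[OF 0 s] has_derivative_continuous[OF der[OF 0]]
      by (auto intro: continuous_at_imp_continuous_on)
  next
    case (Suc k)
    show ?case
      by (rule rapid_derivatives_SucI[OF rapid_FT[OF Suc.prems s] der[OF Suc.prems]])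
        (intro rapid_derivatives_cmult Suc.IH schwartz_coord Suc.prems)
  qed
  then show ?thesis by (simp add: schwartz_def)
qed

section \<open>The Gaussian and Fourier inversion\<close>

definition gauss :: "real^'d \<Rightarrow> complex" where "gauss x = of_real (exp (- (x \<bullet> x) / 2))"

lemma gauss_has_derivative:
  "(gauss has_derivative (\<lambda>v. \<Sum>l\<in>UNIV. v $ l *\<^sub>R (- 1 * (of_real (x $ l) * gauss x)))) (at x)"
proof -
  have "((\<lambda>x. exp (- (x \<bullet> x) / 2)) has_derivative (\<lambda>v. - (x \<bullet> v) * exp (- (x \<bullet> x) / 2))) (at x)"
    by (auto intro!: derivative_eq_intros simp: inner_commute)
  from bounded_linear.has_derivative[OF bounded_linear_of_real this]
  show ?thesis
    unfolding gauss_def[abs_def]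
    by (rule has_derivative_eq_rhs)
      (simp add: fun_eq_iff inner_vec_def sum_distrib_right scaleR_conv_of_real sum_negf mult_ac)
qed

text \<open>The \<open>m\<close>-th power of \<open>y / m \<le> exp (y / m)\<close>.\<close>

lemma power_le_exp: "y \<ge> 0 \<Longrightarrow> y ^ m \<le> real m ^ m * exp y"
proof (cases "m = 0")
  case False
  assume y: "y \<ge> 0"
  have "(y / m) ^ m \<le> exp (y / m) ^ m"
    using y by (intro power_mono order_trans[OF _ exp_ge_add_one_self[of "y / m"]]) auto
  also have "\<dots> = exp y" using False by (simp add: exp_of_nat_mult[symmetric])
  finally show ?thesis using False by (simp add: power_divide field_simps)
qed simp

lemma schwartz_gauss: "schwartz (\<lambda>n::'i. gauss :: real^'d \<Rightarrow> complex)"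
proof -
  have rapid: "rapid (\<lambda>n::'i. gauss :: real^'d \<Rightarrow> complex)"
    unfolding rapid_def
  proof
    fix m
    define D where "D = real CARD('d)"
    have "cmod (gauss x) * l1_weight x ^ m \<le> real m ^ m * exp (1 + D\<^sup>2 / 2)" for x :: "real^'d"
    proof -
      have "cmod (gauss x) * l1_weight x ^ m \<le> exp (- (norm x)\<^sup>2 / 2) * (real m ^ m * exp (1 + D * norm x))"
        using l1_weight_le_norm[of x] power_le_exp[of "1 + D * norm x" m]
        by (auto simp: gauss_def D_def power2_norm_eq_inner l1_weight_nonneg intro!: mult_left_mono intro: order_trans[OF power_mono])
      also have "\<dots> = real m ^ m * exp (1 + D * norm x - (norm x)\<^sup>2 / 2)"
        by (simp add: mult.left_commute[of _ "real m ^ m"] mult_exp_exp)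
      also have "\<dots> \<le> real m ^ m * exp (1 + D\<^sup>2 / 2)"
      proof -
        \<comment> \<open>Completing the square: the Gaussian beats the exponential of
          \<open>D * norm x\<close>, which comes from bounding the power of the weight by an
          exponential.\<close>
        have "0 \<le> (D - norm x)\<^sup>2" by simp
        then have "D * norm x - (norm x)\<^sup>2 / 2 \<le> D\<^sup>2 / 2"
          by (simp add: power2_diff)
        then show ?thesis by (intro mult_left_mono) auto
      qed
      finally show ?thesis .
    qed
    then show "\<exists>C. \<forall>(n::'i) x. cmod (gauss (x::real^'d)) * l1_weight x ^ m \<le> C" by blast
  qed
  have "rapid_derivatives k (\<lambda>n::'i. gauss :: real^'d \<Rightarrow> complex)" for k
  proof (induction k)
    case 0
    then show ?case
      using rapid has_derivative_continuous[OF gauss_has_derivative]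
      by (auto intro: continuous_at_imp_continuous_on)
  next
    case (Suc k)
    show ?case
      by (rule rapid_derivatives_SucI[OF rapid gauss_has_derivative]) (intro rapid_derivatives_cmult rapid_derivatives_coord Suc)
  qed
  then show ?thesis by (simp add: schwartz_def)
qed

text \<open>The Gaussian solves the first order system saying that its derivative along each axis is
  minus the coordinate times itself. The transform turns this system into itself, so the quotient of
  the transform by the Gaussian has derivative 0; its value at 0 is the mass.\<close>

lemma FT_gauss:
  assumes s: "s\<^sup>2 = 1"
  shows "FT s gauss (\<xi> :: real^'d) = (LINT x|lborel. gauss (x :: real^'d)) * gauss \<xi>"
proof -
  define E :: "real^'d \<Rightarrow> complex" where "E \<xi> = of_real (exp ((\<xi> \<bullet> \<xi>) / 2))" for \<xi>
  have E': "(E has_derivative (\<lambda>v. of_real (\<xi> \<bullet> v) * E \<xi>)) (at \<xi>)" for \<xi>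
  proof -
    have "((\<lambda>x. exp ((x \<bullet> x) / 2)) has_derivative (\<lambda>v. (\<xi> \<bullet> v) * exp ((\<xi> \<bullet> \<xi>) / 2))) (at \<xi>)"
      by (auto intro!: derivative_eq_intros simp: inner_commute)
    from bounded_linear.has_derivative[OF bounded_linear_of_real this]
    show ?thesis unfolding E_def[abs_def] by simp
  qed
  have F': "(FT s gauss has_derivative (\<lambda>v. - of_real (\<xi> \<bullet> v) * FT s gauss \<xi>)) (at \<xi>)" for \<xi> :: "real^'d"
  proof -
    have 1: "FT s (\<lambda>x. of_real (x $ l) * gauss x) \<xi> = \<i> * of_real (s * \<xi> $ l) * FT s gauss \<xi>" for l
    proof -
      have "pd l gauss x = - 1 * (of_real (x $ l) * gauss x)" for x :: "real^'d"
        using pd_eqI[OF gauss_has_derivative, of l x]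
        by (simp add: sum_negf axis_def if_distrib[of "\<lambda>c. c *\<^sub>R _"] cong: if_cong)
      then have "FT s (pd l gauss) \<xi> = - 1 * FT s (\<lambda>x. of_real (x $ l) * gauss x) \<xi>"
        by (simp only: FT_cmult[symmetric] ext[of "pd l gauss" "\<lambda>x. - 1 * (complex_of_real (x $ l) * gauss x)"])
      with FT_pd[OF schwartz_gauss, of s l \<xi>] show ?thesis by simp
    qed
    have 2: "(FT s gauss has_derivative
      (\<lambda>h. \<Sum>l\<in>UNIV. h $ l *\<^sub>R (\<i> * of_real s * FT s (\<lambda>x. of_real (x $ l) * gauss x) \<xi>))) (at \<xi>)"
      by (rule FT_has_derivative[OF schwartz_rapid[OF schwartz_gauss] schwartz_measurable[OF schwartz_gauss]])
    \<comment> \<open>Here the condition on \<open>s\<close> enters: the two factors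
      \<open>s\<close>, one from the derivative of the transform and one from \<open>FT_pd\<close>,
      cancel.\<close>
    have 3: "\<i> * of_real s * (\<i> * of_real (s * \<xi> $ l) * c) = - (of_real (\<xi> $ l) * c)" for l :: 'd and c
    proof -
      have "complex_of_real s * complex_of_real s = 1"
        using s by (metis of_real_1 of_real_mult power2_eq_square)
      then show ?thesis by (simp add: algebra_simps)
    qed
    show ?thesis
      using 2 unfolding 1 3
      by (rule has_derivative_eq_rhs) (simp add: fun_eq_iff inner_vec_def sum_distrib_left sum_distrib_right scaleR_conv_of_real sum_negf mult_ac)
  qed
  have "((\<lambda>\<xi>. FT s gauss \<xi> * E \<xi>) has_derivative (\<lambda>v. 0)) (at \<xi>)" for \<xi> :: "real^'d"
    using has_derivative_mult[OF F' E'] by (rule has_derivative_eq_rhs) (simp add: fun_eq_iff)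
  then obtain c where c: "\<And>\<xi>::real^'d. FT s gauss \<xi> * E \<xi> = c"
    using has_derivative_zero_constant[of UNIV "\<lambda>\<xi>. FT s gauss \<xi> * E \<xi>"]
    by (metis UNIV_I convex_UNIV has_derivative_at_withinI)
  have E_g: "E \<xi> * gauss \<xi> = 1" for \<xi>
    by (simp add: E_def gauss_def of_real_mult[symmetric] exp_add[symmetric] del: of_real_mult)
  have "c = (LINT x|lborel. gauss (x :: real^'d))"
    using c[of 0] by (simp add: E_def FT_def)
  moreover have "FT s gauss \<xi> = c * gauss \<xi>"
    using E_g[of \<xi>] unfolding c[of \<xi>, symmetric] by (simp add: mult.assoc)
  ultimately show ?thesis by simp
qed

definition gauss_mass :: "'d::finite itself \<Rightarrow> complex" where
  "gauss_mass _ = (LINT x|lborel. gauss (x :: real^'d))"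

lemma gauss_mass_neq_0: "gauss_mass TYPE('d::finite) \<noteq> 0"
proof
  assume 0: "gauss_mass TYPE('d) = 0"
  have int: "integrable lborel (\<lambda>x::real^'d. exp (- (x \<bullet> x) / 2))"
    using integrable_norm[OF schwartz_integrable[OF schwartz_gauss[where 'i = nat and 'd = 'd]]]
    by (simp add: gauss_def)
  have "complex_of_real (LINT x|lborel. exp (- ((x::real^'d) \<bullet> x) / 2)) = 0"
    using 0 by (simp add: gauss_mass_def gauss_def[abs_def])
  then have "(LINT x|lborel. exp (- ((x::real^'d) \<bullet> x) / 2)) = 0"
    by (simp only: of_real_eq_0_iff)
  then have "AE x::real^'d in lborel. exp (- (x \<bullet> x) / 2) = 0"
    using integral_nonneg_eq_0_iff_AE[OF int] by simp
  then have "AE x::real^'d in lborel. False" by simp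
  then have "emeasure lborel (UNIV :: (real^'d) set) = 0"
    using AE_iff_measurable[of UNIV "lborel :: (real^'d) measure" "\<lambda>x. False"] by simp
  then show False by simp
qed

text \<open>The integral \<open>J n\<close> is evaluated in two ways as the dilation \<epsilon>
  tends to 0. Directly, \<open>f\<close> concentrates at \<open>x\<close> and leaves the integral of
  the transformed Gaussian, the square of the mass. After Fubini and a dilation, the Gaussian
  becomes a regularizing factor of the inversion integral and tends to 1.\<close>

theorem Fourier_inversion:
  fixes f :: "real^'d \<Rightarrow> complex"
  assumes f: "schwartz (\<lambda>n::nat. f)"
  shows "FT 1 (FT (-1) f) x = (gauss_mass TYPE('d))\<^sup>2 * f x"
proof -
  note g = schwartz_gauss[where 'i = nat and 'd = 'd]
  have Ff: "schwartz (\<lambda>n::nat. FT (-1) f)"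
    by (rule schwartz_FT[OF f]) simp
  have Fg: "schwartz (\<lambda>n::nat. FT (-1) (gauss :: real^'d \<Rightarrow> complex))"
    by (rule schwartz_FT[OF g]) simp
  define \<epsilon> where "\<epsilon> n = inverse (real (Suc n))" for n
  have \<epsilon>_pos: "\<epsilon> n > 0" for n by (simp add: \<epsilon>_def)
  have \<epsilon>_lim: "\<epsilon> \<longlonglongrightarrow> 0" unfolding \<epsilon>_def by (rule LIMSEQ_inverse_real_of_nat)
  note [measurable] = schwartz_measurable[OF f] schwartz_measurable[OF g] schwartz_measurable[OF Ff]
  obtain B where B: "\<And>x. cmod (f x) \<le> B"
    using rapid_bound[OF schwartz_rapid[OF f], of 0] by auto
  obtain B' where B': "\<And>x::real^'d. cmod (gauss x) \<le> B'"
    using rapid_bound[OF schwartz_rapid[OF g], of 0] by auto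
  define J where "J n = (LINT z|lborel. f (x + \<epsilon> n *\<^sub>R z) * FT (-1) gauss z)" for n
  have "J \<longlonglongrightarrow> (LINT z|lborel. f x * FT (-1) gauss (z::real^'d))"
    unfolding J_def
  proof (rule integral_dominated_convergence[where s = "\<lambda>n z. f (x + \<epsilon> n *\<^sub>R z) * FT (-1) gauss z"
        and w = "\<lambda>z. B * cmod (FT (-1) gauss z)"])
    show "integrable lborel (\<lambda>z::real^'d. B * cmod (FT (-1) gauss z))"
      by (intro integrable_mult_right integrable_norm schwartz_integrable[OF Fg])
    have [measurable]: "FT (-1) gauss \<in> borel_measurable (borel :: (real^'d) measure)"
      by (rule schwartz_measurable[OF Fg])
    show "(\<lambda>z::real^'d. f x * FT (- 1) gauss z) \<in> borel_measurable lborel" by measurable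
    show "(\<lambda>z. f (x + \<epsilon> n *\<^sub>R z) * FT (- 1) gauss z) \<in> borel_measurable lborel" for n by measurable
    show "AE z in lborel. (\<lambda>n. f (x + \<epsilon> n *\<^sub>R z) * FT (- 1) gauss z) \<longlonglongrightarrow> f x * FT (- 1) gauss z"
    proof (intro AE_I2 tendsto_intros)
      fix z
      have "(\<lambda>n. x + \<epsilon> n *\<^sub>R z) \<longlonglongrightarrow> x + 0 *\<^sub>R z"
        by (intro tendsto_intros \<epsilon>_lim)
      moreover have "isCont f x"
        using schwartz_continuous[OF f] by (simp add: continuous_on_eq_continuous_at)
      ultimately show "(\<lambda>n. f (x + \<epsilon> n *\<^sub>R z)) \<longlonglongrightarrow> f x"
        using isCont_tendsto_compose[of x f "\<lambda>n. x + \<epsilon> n *\<^sub>R z"] by simp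
    qed
    show "AE z in lborel. norm (f (x + \<epsilon> n *\<^sub>R z) * FT (- 1) gauss z) \<le> B * cmod (FT (-1) gauss z)" for n
      using B by (intro AE_I2) (simp add: norm_mult mult_right_mono)
  qed
  also have "(LINT z|lborel. f x * FT (-1) gauss (z::real^'d)) = (gauss_mass TYPE('d))\<^sup>2 * f x"
    by (simp add: FT_gauss gauss_mass_def power2_eq_square)
  finally have lim1: "J \<longlonglongrightarrow> (gauss_mass TYPE('d))\<^sup>2 * f x" .
  have J_eq: "J n = (LINT \<eta>|lborel. gauss (\<epsilon> n *\<^sub>R \<eta>) * (cis (1 * (\<eta> \<bullet> x)) * FT (-1) f \<eta>))" for n
  proof -
    define Q where "Q z \<xi> = f (x + \<epsilon> n *\<^sub>R z) * (cis (- 1 * (\<xi> \<bullet> z)) * gauss \<xi>)" for z \<xi>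
    have Q_meas: "(\<lambda>(z, \<xi>). Q z \<xi>) \<in> borel_measurable (lborel \<Otimes>\<^sub>M lborel)"
    proof -
      have "continuous_on UNIV (\<lambda>p. f (x + \<epsilon> n *\<^sub>R fst p) * (cis (- 1 * (snd p \<bullet> fst p)) * gauss (snd p)))"
        by (intro continuous_intros cis_continuous continuous_on_compose2[OF schwartz_continuous[OF f]]
            continuous_on_compose2[OF schwartz_continuous[OF g]]) auto
      then have "(\<lambda>(z, \<xi>). Q z \<xi>) \<in> borel_measurable borel"
        unfolding Q_def split_def by (rule borel_measurable_continuous_onI)
      then show ?thesis by (simp add: lborel_prod)
    qed
    have f_shift: "integrable lborel (\<lambda>z. f (x + \<epsilon> n *\<^sub>R z))"
    proof -
      have "integrable lborel (\<lambda>y. f (x + y))"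
        using lborel_integral_shift(2)[of f x] schwartz_integrable[OF f] by simp
      then have "integrable (density (distr lborel borel (\<lambda>z. 0 + \<epsilon> n *\<^sub>R z)) (\<lambda>_. ennreal (\<bar>\<epsilon> n\<bar> ^ DIM(real^'d)))) (\<lambda>y. f (x + y))"
        using lborel_affine[of "\<epsilon> n" "0::real^'d"] \<epsilon>_pos[of n] by (simp add: ennreal_power)
      then have "integrable lborel (\<lambda>z. \<epsilon> n ^ CARD('d) *\<^sub>R f (x + \<epsilon> n *\<^sub>R z))"
        using \<epsilon>_pos[of n] by (subst (asm) integrable_density) (auto simp: integrable_distr_eq)
      then have "integrable lborel (\<lambda>z. inverse (\<epsilon> n ^ CARD('d)) *\<^sub>R (\<epsilon> n ^ CARD('d) *\<^sub>R f (x + \<epsilon> n *\<^sub>R z)))"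
        by (rule integrable_scaleR_right)
      moreover have nz: "\<epsilon> n ^ CARD('d) \<noteq> 0" using \<epsilon>_pos[of n] by simp
      ultimately show ?thesis by (simp only: scaleR_scaleR left_inverse[OF nz] scaleR_one)
    qed
    have Q_int: "integrable (lborel \<Otimes>\<^sub>M lborel) (\<lambda>(z, \<xi>). Q z \<xi>)"
    proof (rule lborel_pair.Fubini_integrable[OF Q_meas])
      show "integrable lborel (\<lambda>z. LINT \<xi>|lborel. norm (case (z, \<xi>) of (z, \<xi>) \<Rightarrow> Q z \<xi>))"
        by (auto simp: Q_def norm_mult intro: integrable_norm f_shift)
      show "AE z in lborel. integrable lborel (\<lambda>\<xi>. case (z, \<xi>) of (z, \<xi>) \<Rightarrow> Q z \<xi>)"
        unfolding Q_def
        by (auto intro!: AE_I2 integrable_mult_right FT_integrand_integrable[where s = "- 1", simplified] schwartz_integrable[OF g])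
    qed
    have "J n = (LINT z|lborel. LINT \<xi>|lborel. Q z \<xi>)"
      unfolding J_def Q_def FT_def by simp
    also have "\<dots> = (LINT \<xi>|lborel. LINT z|lborel. Q z \<xi>)"
      using lborel_pair.Fubini_integral[OF Q_int] by simp
    also have "\<dots> = (LINT \<xi>|lborel. gauss \<xi> * (inverse (\<epsilon> n) ^ CARD('d) *\<^sub>R
        (cis (1 * ((inverse (\<epsilon> n) *\<^sub>R \<xi>) \<bullet> x)) * FT (-1) f (inverse (\<epsilon> n) *\<^sub>R \<xi>))))"
    proof (intro Bochner_Integration.integral_cong refl)
      fix \<xi>
      \<comment> \<open>Centring the phase at \<open>x\<close> makes the inner integrand a dilation
        of a translate of one function, so that the inner integral is the transform of
        \<open>f\<close> at the rescaled frequency.\<close>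
      define k where "k w = f w * cis (- ((w - x) \<bullet> (inverse (\<epsilon> n) *\<^sub>R \<xi>)))" for w
      have [measurable]: "k \<in> borel_measurable borel"
        unfolding k_def by (intro borel_measurable_continuous_onI continuous_intros cis_continuous schwartz_continuous[OF f])
      have "(LINT z|lborel. Q z \<xi>) = gauss \<xi> * (LINT z|lborel. k (x + \<epsilon> n *\<^sub>R z))"
      proof -
        have "Q z \<xi> = gauss \<xi> * k (x + \<epsilon> n *\<^sub>R z)" for z
          using \<epsilon>_pos[of n] by (simp add: Q_def k_def inner_commute mult.assoc[symmetric])
        then show ?thesis by simp
      qed
      also have "(LINT z|lborel. k (x + \<epsilon> n *\<^sub>R z)) = inverse (\<epsilon> n) ^ CARD('d) *\<^sub>R (LINT y|lborel. k (x + y))"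
        using lborel_integral_scale[of "\<lambda>y. k (x + y)" "\<epsilon> n"] \<epsilon>_pos[of n]
        by (simp add: power_inverse)
      also have "(LINT y|lborel. k (x + y)) = (LINT y|lborel. k y)"
        by (rule lborel_integral_shift) simp
      also have "\<dots> = (LINT y|lborel. cis (1 * ((inverse (\<epsilon> n) *\<^sub>R \<xi>) \<bullet> x)) * (cis (- 1 * (y \<bullet> (inverse (\<epsilon> n) *\<^sub>R \<xi>))) * f y))"
      proof (intro Bochner_Integration.integral_cong refl)
        fix y
        define \<eta> where "\<eta> = inverse (\<epsilon> n) *\<^sub>R \<xi>"
        have arg: "- ((y - x) \<bullet> \<eta>) = 1 * (\<eta> \<bullet> x) + - 1 * (y \<bullet> \<eta>)"
          by (simp add: inner_diff_left inner_commute[of \<eta> x])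
        show "k y = cis (1 * ((inverse (\<epsilon> n) *\<^sub>R \<xi>) \<bullet> x)) * (cis (- 1 * (y \<bullet> (inverse (\<epsilon> n) *\<^sub>R \<xi>))) * f y)"
          unfolding k_def \<eta>_def[symmetric] arg cis_mult[symmetric] by (simp only: mult_ac)
      qed
      finally show "(LINT z|lborel. Q z \<xi>) = gauss \<xi> * (inverse (\<epsilon> n) ^ CARD('d) *\<^sub>R
        (cis (1 * ((inverse (\<epsilon> n) *\<^sub>R \<xi>) \<bullet> x)) * FT (-1) f (inverse (\<epsilon> n) *\<^sub>R \<xi>)))"
        by (simp add: FT_def)
    qed
    \<comment> \<open>The Jacobian of this dilation in the frequency cancels the one already
      produced in the space variable.\<close>
    also have "\<dots> = \<epsilon> n ^ CARD('d) *\<^sub>R (LINT \<eta>|lborel. gauss (\<epsilon> n *\<^sub>R \<eta>) * (inverse (\<epsilon> n) ^ CARD('d) *\<^sub>R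
        (cis (1 * (\<eta> \<bullet> x)) * FT (-1) f \<eta>)))"
    proof -
      have "continuous_on UNIV (\<lambda>\<xi>. gauss \<xi> * (inverse (\<epsilon> n) ^ CARD('d) *\<^sub>R
        (cis (1 * ((inverse (\<epsilon> n) *\<^sub>R \<xi>) \<bullet> x)) * FT (-1) f (inverse (\<epsilon> n) *\<^sub>R \<xi>))))"
        by (intro continuous_intros cis_continuous schwartz_continuous[OF g]
            continuous_on_compose2[OF schwartz_continuous[OF Ff]]) auto
      from borel_measurable_continuous_onI[OF this]
      show ?thesis using \<epsilon>_pos[of n] by (subst lborel_integral_scale[of _ "\<epsilon> n"]) auto
    qed
    also have "\<dots> = (LINT \<eta>|lborel. gauss (\<epsilon> n *\<^sub>R \<eta>) * (cis (1 * (\<eta> \<bullet> x)) * FT (-1) f \<eta>))"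
      using \<epsilon>_pos[of n] by (simp add: power_inverse[symmetric] power_mult_distrib[symmetric])
    finally show ?thesis .
  qed
  have "J \<longlonglongrightarrow> (LINT \<eta>|lborel. gauss (0 :: real^'d) * (cis (1 * (\<eta> \<bullet> x)) * FT (-1) f \<eta>))"
    unfolding J_eq
  proof (rule integral_dominated_convergence)
    show "integrable lborel (\<lambda>\<eta>. B' * cmod (FT (-1) f \<eta>))"
      by (intro integrable_mult_right integrable_norm schwartz_integrable[OF Ff])
    show "AE \<eta> in lborel. (\<lambda>n. gauss (\<epsilon> n *\<^sub>R \<eta>) * (cis (1 * (\<eta> \<bullet> x)) * FT (-1) f \<eta>))
        \<longlonglongrightarrow> gauss (0 :: real^'d) * (cis (1 * (\<eta> \<bullet> x)) * FT (-1) f \<eta>)"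
    proof (intro AE_I2 tendsto_intros)
      fix \<eta> :: "real^'d"
      have "(\<lambda>n. \<epsilon> n *\<^sub>R \<eta>) \<longlonglongrightarrow> 0 *\<^sub>R \<eta>"
        by (intro tendsto_intros \<epsilon>_lim)
      moreover have "isCont gauss (0::real^'d)"
        using schwartz_continuous[OF g] by (simp add: continuous_on_eq_continuous_at)
      ultimately show "(\<lambda>n. gauss (\<epsilon> n *\<^sub>R \<eta>)) \<longlonglongrightarrow> gauss (0 :: real^'d)"
        using isCont_tendsto_compose[of 0 gauss "\<lambda>n. \<epsilon> n *\<^sub>R \<eta>"] by simp
    qed
    show "AE \<eta> in lborel. norm (gauss (\<epsilon> n *\<^sub>R \<eta>) * (cis (1 * (\<eta> \<bullet> x)) * FT (-1) f \<eta>)) \<le> B' * cmod (FT (-1) f \<eta>)" for n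
      using B' by (intro AE_I2) (simp add: norm_mult mult_right_mono)
    show "(\<lambda>\<eta>. gauss (\<epsilon> n *\<^sub>R \<eta>) * (cis (1 * (\<eta> \<bullet> x)) * FT (- 1) f \<eta>)) \<in> borel_measurable lborel" for n
    proof -
      have "continuous_on UNIV (\<lambda>\<eta>. gauss (\<epsilon> n *\<^sub>R \<eta>) * (cis (1 * (\<eta> \<bullet> x)) * FT (- 1) f \<eta>))"
        by (intro continuous_intros cis_continuous schwartz_continuous[OF Ff]
            continuous_on_compose2[OF schwartz_continuous[OF g]]) auto
      from borel_measurable_continuous_onI[OF this] show ?thesis by simp
    qed
    show "(\<lambda>\<eta>. gauss (0 :: real^'d) * (cis (1 * (\<eta> \<bullet> x)) * FT (- 1) f \<eta>)) \<in> borel_measurable lborel"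
    proof -
      have "continuous_on UNIV (\<lambda>\<eta>. gauss (0 :: real^'d) * (cis (1 * (\<eta> \<bullet> x)) * FT (- 1) f \<eta>))"
        by (intro continuous_intros cis_continuous schwartz_continuous[OF Ff])
      from borel_measurable_continuous_onI[OF this] show ?thesis by simp
    qed
  qed
  also have "(LINT \<eta>|lborel. gauss (0 :: real^'d) * (cis (1 * (\<eta> \<bullet> x)) * FT (-1) f \<eta>)) = FT 1 (FT (-1) f) x"
    by (simp add: FT_def gauss_def)
  finally show ?thesis using lim1 LIMSEQ_unique by blast
qed

section \<open>The stationary adjoint equation\<close>

text \<open>A real \<tau> has distance at least \<tau> from each root on the imaginary axis; the
  induction splits off one linear factor at a time.\<close>

lemma monic_poly_lower_bound:
  assumes "lead_coeff p = (1::complex)" "\<And>z. poly p z = 0 \<Longrightarrow> Re z = 0" "\<tau> \<ge> 0"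
  shows "\<tau> ^ degree p \<le> cmod (poly p (of_real \<tau>))"
  using assms
proof (induction "degree p" arbitrary: p)
  case 0
  then obtain c where "p = [:c:]" by (metis degree_eq_zeroE)
  with 0 show ?case by simp
next
  case (Suc n)
  have "\<not> constant (poly p)"
    using Suc.hyps(2) constant_degree[of p] by simp
  then obtain z where z: "poly p z = 0"
    using fundamental_theorem_of_algebra by blast
  then obtain q where q: "p = [:- z, 1:] * q"
    by (metis dvd_def poly_eq_0_iff_dvd)
  have q0: "q \<noteq> 0" using q Suc.hyps(2) by auto
  have deg: "degree p = Suc (degree q)"
    unfolding q using q0 by (subst degree_mult_eq) auto
  have lc: "lead_coeff q = 1"
    using Suc.prems(1) unfolding q by (simp add: lead_coeff_mult del: mult_pCons_left)
  have IH: "\<tau> ^ degree q \<le> cmod (poly q (of_real \<tau>))"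
    using Suc.hyps deg lc Suc.prems(2,3) by (intro Suc.hyps(1)) (auto simp: q)
  have "\<tau> \<le> cmod (of_real \<tau> - z)"
    using Suc.prems(2)[OF z] abs_Re_le_cmod[of "of_real \<tau> - z"] Suc.prems(3) by simp
  with IH have "\<tau> * \<tau> ^ degree q \<le> cmod (of_real \<tau> - z) * cmod (poly q (of_real \<tau>))"
    using Suc.prems(3) by (intro mult_mono) auto
  then show ?case unfolding deg by (simp add: q norm_mult[symmetric] algebra_simps)
qed

definition char_poly_shift :: "complex^'n^'n \<Rightarrow> complex poly" where
  "char_poly_shift B = det (\<chi> i j. [: B $ i $ j, if i = j then 1 else 0 :])"

lemma poly_char_poly_shift: "poly (char_poly_shift B) z = det (\<chi> i j. (if i = j then z else 0) + B $ i $ j)"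
proof -
  have "poly [: B $ i $ j, if i = j then 1 else 0 :] z = (if i = j then z else 0) + B $ i $ j" for i j
    by simp
  then show ?thesis
    by (simp add: char_poly_shift_def det_def poly_sum poly_prod add.commute)
qed

text \<open>In the Leibniz expansion the degree of a term is at most the number of fixed points of
  its permutation; only the identity reaches \<open>CARD('n)\<close>, and its term is monic.\<close>

lemma char_poly_shift_monic:
  fixes B :: "complex^'n^'n"
  shows "degree (char_poly_shift B) = CARD('n)" "lead_coeff (char_poly_shift B) = 1"
proof -
  define e where "e i j = [: B $ i $ j, if i = j then 1 else 0 :]" for i j
  have e_deg: "degree (e i j) \<le> (if i = j then 1 else 0)" for i j
    by (simp add: e_def)
  have prod_deg: "degree (\<Prod>i\<in>UNIV. e i (p i)) \<le> card {i. p i = i}" for p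
  proof -
    have "degree (\<Prod>i\<in>UNIV. e i (p i)) \<le> (\<Sum>i\<in>UNIV. degree (e i (p i)))"
      using degree_prod_sum_le[of UNIV "\<lambda>i. e i (p i)"] by (simp add: comp_def)
    also have "\<dots> \<le> (\<Sum>i\<in>UNIV. if p i = i then 1 else 0)"
    proof (rule sum_mono)
      show "degree (e i (p i)) \<le> (if p i = i then 1 else 0)" for i
        using e_deg[of i "p i"] by (cases "p i = i") auto
    qed
    also have "\<dots> = card {i. p i = i}" by (simp add: sum.If_cases)
    finally show ?thesis .
  qed
  have small: "card {i. p i = i} < CARD('n)" if "p \<noteq> id" for p :: "'n \<Rightarrow> 'n"
  proof -
    have "{i. p i = i} \<noteq> UNIV" using that by (auto simp: fun_eq_iff)
    then show ?thesis by (intro psubset_card_mono) auto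
  qed
  have c: "coeff (of_int (sign p) * (\<Prod>i\<in>UNIV. e i (p i))) k = 0" if "k > card {i. p i = i}" for p k
  proof -
    have "degree (of_int (sign p) * (\<Prod>i\<in>UNIV. e i (p i))) \<le> degree (\<Prod>i\<in>UNIV. e i (p i))"
      by (rule order_trans[OF degree_mult_le]) simp
    with prod_deg[of p] that show ?thesis by (intro coeff_eq_0) linarith
  qed
  have id1: "coeff (\<Prod>i\<in>UNIV. e i (id i)) CARD('n) = 1"
  proof -
    have d: "degree (\<Prod>i\<in>UNIV. e i (id i)) = CARD('n)"
      by (subst degree_prod_eq_sum_degree) (auto simp: e_def)
    have "lead_coeff (\<Prod>i\<in>UNIV. e i (id i)) = 1"
      by (simp add: lead_coeff_prod e_def)
    with d show ?thesis by simp
  qed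
  have cp: "char_poly_shift B = (\<Sum>p | p permutes UNIV. of_int (sign p) * (\<Prod>i\<in>UNIV. e i (p i)))"
    by (simp add: char_poly_shift_def det_def e_def)
  have fin: "finite {p::'n\<Rightarrow>'n. p permutes UNIV}" by (rule finite_permutations) simp
  have co: "coeff (char_poly_shift B) CARD('n) = 1"
  proof -
    have "coeff (char_poly_shift B) CARD('n) =
      (\<Sum>p | p permutes (UNIV::'n set). if p = id then 1 else 0)"
      unfolding cp coeff_sum
      by (intro sum.cong refl) (use c small id1 in \<open>auto simp: sign_id\<close>)
    also have "\<dots> = 1" using fin by (simp add: permutes_id)
    finally show ?thesis .
  qed
  have "degree (char_poly_shift B) \<le> CARD('n)"
  proof (rule degree_le, intro allI impI)
    fix k assume k: "CARD('n) < k"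
    have "card {i. p i = i} \<le> CARD('n)" for p :: "'n \<Rightarrow> 'n" by (intro card_mono) auto
    then show "coeff (char_poly_shift B) k = 0"
      unfolding cp coeff_sum using k by (intro sum.neutral ballI c) (meson le_less_trans)
  qed
  moreover have "CARD('n) \<le> degree (char_poly_shift B)"
    using co by (intro le_degree) simp
  ultimately show "degree (char_poly_shift B) = CARD('n)" by simp
  with co show "lead_coeff (char_poly_shift B) = 1" by simp
qed

lemma norm_det_le:
  fixes M :: "complex^'n^'n"
  assumes "\<And>i j. cmod (M $ i $ j) \<le> b"
  shows "cmod (det M) \<le> fact CARD('n) * b ^ CARD('n)"
proof -
  have "cmod (det M) \<le> (\<Sum>p | p permutes (UNIV::'n set). b ^ CARD('n))"
    unfolding det_def
  proof (rule sum_norm_le)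
    fix p :: "'n \<Rightarrow> 'n"
    have "cmod (of_int (sign p)) = 1" by (simp add: sign_def)
    moreover have "(\<Prod>i\<in>UNIV. cmod (M $ i $ p i)) \<le> (\<Prod>i\<in>(UNIV::'n set). b)"
      by (intro prod_mono) (simp add: assms)
    ultimately show "cmod (of_int (sign p) * (\<Prod>i\<in>UNIV. M $ i $ p i)) \<le> b ^ CARD('n)"
      by (simp add: norm_mult prod_norm)
  qed
  also have "\<dots> = fact CARD('n) * b ^ CARD('n)"
    by (simp add: card_permutations)
  finally show ?thesis .
qed

text \<open>The transpose of the symbol of \<open>\<tau> - \<Sum>\<^sub>l A\<^sub>l\<^sup>T \<partial>\<^sub>l\<close>.\<close>

definition symb :: "('d::finite \<Rightarrow> complex^'n^'n) \<Rightarrow> real \<Rightarrow> real^'d \<Rightarrow> complex^'n^'n" where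
  "symb A \<tau> \<xi> = (\<chi> i j. (if i = j then of_real \<tau> else 0) - \<i> * (\<Sum>l\<in>UNIV. of_real (\<xi> $ l) * A l $ i $ j))"

lemma det_symb_ge:
  fixes A :: "'d::finite \<Rightarrow> complex^'n::finite^'n"
  assumes hyp: "weakly_hyperbolic A" and "\<tau> \<ge> 0"
  shows "\<tau> ^ CARD('n) \<le> cmod (det (symb A \<tau> \<xi>))"
proof -
  define A\<xi> where "A\<xi> = (\<Sum>l\<in>UNIV. (\<xi> $ l) *\<^sub>R A l)"
  define B :: "complex^'n^'n" where "B = (\<chi> i j. - \<i> * (\<Sum>l\<in>UNIV. of_real (\<xi> $ l) * A l $ i $ j))"
  have A\<xi>_nth: "A\<xi> $ i $ j = (\<Sum>l\<in>UNIV. of_real (\<xi> $ l) * A l $ i $ j)" for i j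
    by (simp add: A\<xi>_def) (simp add: scaleR_conv_of_real)
  have symb: "symb A \<tau> \<xi> = (\<chi> i j. (if i = j then of_real \<tau> else 0) + B $ i $ j)"
    by (simp add: symb_def B_def vec_eq_iff)
  have "Re z = 0" if "poly (char_poly_shift B) z = 0" for z
  proof -
    have "det (\<chi> i j. (if i = j then z else 0) + B $ i $ j) = 0"
      using that by (simp add: poly_char_poly_shift)
    then have "\<not> invertible (\<chi> i j. (if i = j then z else 0) + B $ i $ j)"
      by (simp add: invertible_det_nz)
    then obtain v where v: "v \<noteq> 0" "(\<chi> i j. (if i = j then z else 0) + B $ i $ j) *v v = 0"
      unfolding invertible_left_inverse matrix_left_invertible_ker by blast
    \<comment> \<open>A root \<open>z\<close> makes \<open>- \<i> * z\<close> an eigenvalue of the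
      real combination of the matrices. This eigenvalue is real, hence \<open>z\<close> is purely
      imaginary.\<close>
    have "A\<xi> *v v = (- \<i> * z) *s v"
    proof -
      have "\<i> * (A\<xi> *v v) $ i = z * v $ i" for i
      proof -
        have "(\<Sum>j\<in>UNIV. ((if i = j then z else 0) + B $ i $ j) * v $ j) = 0"
          using v(2) by (simp add: vec_eq_iff matrix_vector_mult_def)
        then have "z * v $ i + (\<Sum>j\<in>UNIV. B $ i $ j * v $ j) = 0"
          by (simp add: distrib_right sum.distrib if_distrib[of "\<lambda>c. c * _"] cong: if_cong)
        moreover have "(\<Sum>j\<in>UNIV. B $ i $ j * v $ j) = - (\<i> * (A\<xi> *v v) $ i)"
          by (simp add: B_def A\<xi>_nth[symmetric] matrix_vector_mult_def sum_distrib_left sum_negf mult.assoc)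
        ultimately show ?thesis by simp
      qed
      then have "(A\<xi> *v v) $ i = - \<i> * (z * v $ i)" for i
        by (metis mult.assoc mult_minus_left i_squared minus_minus mult_1_left)
      then show ?thesis by (simp add: vec_eq_iff mult.assoc)
    qed
    then have "- \<i> * z \<in> \<real>"
      using hyp v(1) unfolding weakly_hyperbolic_def A\<xi>_def by blast
    then show ?thesis by (simp add: complex_is_Real_iff)
  qed
  from monic_poly_lower_bound[OF char_poly_shift_monic(2) this assms(2), of B]
  show ?thesis by (simp add: char_poly_shift_monic(1) poly_char_poly_shift symb)
qed

section \<open>The resolvent: growth in the frequency, uniformly in \<tau>, and derivatives\<close>

definition resolv :: "('d::finite \<Rightarrow> complex^'n^'n) \<Rightarrow> real \<Rightarrow> real^'d \<Rightarrow> complex^'n^'n" where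
  "resolv A \<tau> \<xi> = matrix_inv (symb A \<tau> \<xi>)"

lemma resolv_inverse:
  assumes "weakly_hyperbolic A" "\<tau> > 0"
  shows "resolv A \<tau> \<xi> ** symb A \<tau> \<xi> = mat 1" "symb A \<tau> \<xi> ** resolv A \<tau> \<xi> = mat 1"
proof -
  have "det (symb A \<tau> \<xi>) \<noteq> 0"
    using det_symb_ge[OF assms(1), of \<tau> \<xi>] assms(2) by (metis norm_zero less_imp_le not_less zero_less_power)
  then have "invertible (symb A \<tau> \<xi>)" by (simp add: invertible_det_nz)
  then show "resolv A \<tau> \<xi> ** symb A \<tau> \<xi> = mat 1" "symb A \<tau> \<xi> ** resolv A \<tau> \<xi> = mat 1"
    unfolding resolv_def matrix_inv_def invertible_def by (metis (mono_tags, lifting) someI_ex)+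
qed

text \<open>By Cramer's rule an entry is a quotient of determinants. The numerator is at most a
  constant times the \<open>CARD('n)\<close>-th power of \<tau> times the weight, the denominator at
  least that power of \<tau>, so \<tau> cancels. The eigenvalues may be defective, which is why
  powers of the weight are lost; the decay of the data compensates for them.\<close>

lemma resolv_bound:
  fixes A :: "'d::finite \<Rightarrow> complex^'n::finite^'n"
  assumes hyp: "weakly_hyperbolic A"
  obtains C where "C \<ge> 0" "\<And>\<tau> \<xi> i j. \<tau> \<ge> 1 \<Longrightarrow> cmod (resolv A \<tau> \<xi> $ i $ j) \<le> C * l1_weight \<xi> ^ CARD('n)"
proof -
  define a where "a = (\<Sum>l\<in>UNIV. \<Sum>i\<in>UNIV. \<Sum>j\<in>UNIV. cmod (A l $ i $ j))"
  have a: "cmod (A l $ i $ j) \<le> a" for l i j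
  proof -
    have "cmod (A l $ i $ j) \<le> (\<Sum>j\<in>UNIV. cmod (A l $ i $ j))"
      by (intro member_le_sum) auto
    also have "\<dots> \<le> (\<Sum>i\<in>UNIV. \<Sum>j\<in>UNIV. cmod (A l $ i $ j))"
      by (intro member_le_sum[of i UNIV "\<lambda>i. \<Sum>j\<in>UNIV. cmod (A l $ i $ j)"]) (auto intro!: sum_nonneg)
    also have "\<dots> \<le> a"
      unfolding a_def by (intro member_le_sum[of l UNIV "\<lambda>l. \<Sum>i\<in>UNIV. \<Sum>j\<in>UNIV. cmod (A l $ i $ j)"]) (auto intro!: sum_nonneg)
    finally show ?thesis .
  qed
  have a0: "a \<ge> 0" unfolding a_def by (intro sum_nonneg) auto
  show ?thesis
  proof (rule that[of "fact CARD('n) * (1 + a) ^ CARD('n)"])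
    fix \<tau> :: real and \<xi> :: "real^'d" and k j :: 'n
    assume \<tau>: "\<tau> \<ge> 1"
    let ?M = "symb A \<tau> \<xi>"
    have entry: "cmod (?M $ i $ j) \<le> (1 + a) * \<tau> * l1_weight \<xi>" for i j
    proof -
      have "cmod (?M $ i $ j) \<le> \<tau> + (\<Sum>l\<in>UNIV. \<bar>\<xi> $ l\<bar> * a)"
      proof -
        have "cmod (\<Sum>l\<in>UNIV. of_real (\<xi> $ l) * A l $ i $ j) \<le> (\<Sum>l\<in>UNIV. \<bar>\<xi> $ l\<bar> * a)"
          by (intro sum_norm_le) (auto simp: norm_mult intro!: mult_left_mono a)
        moreover have "cmod (?M $ i $ j) \<le> cmod (if i = j then of_real \<tau> else 0) + cmod (\<i> * (\<Sum>l\<in>UNIV. of_real (\<xi> $ l) * A l $ i $ j))"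
          by (simp only: symb_def vec_lambda_beta norm_triangle_ineq4)
        moreover have "cmod (if i = j then of_real \<tau> else 0) \<le> \<tau>" using \<tau> by auto
        ultimately show ?thesis by (simp add: norm_mult)
      qed
      also have "\<dots> \<le> \<tau> * l1_weight \<xi> + a * (\<tau> * l1_weight \<xi>)"
      proof (rule add_mono)
        show "\<tau> \<le> \<tau> * l1_weight \<xi>" using \<tau> l1_weight_ge_1[of \<xi>] by simp
        have "(\<Sum>l\<in>UNIV. \<bar>\<xi> $ l\<bar> * a) = a * (\<Sum>l\<in>UNIV. \<bar>\<xi> $ l\<bar>)"
          by (simp add: sum_distrib_left mult.commute)
        also have "\<dots> \<le> a * (\<tau> * l1_weight \<xi>)"
        proof (rule mult_left_mono[OF _ a0])
          have "1 * l1_weight \<xi> \<le> \<tau> * l1_weight \<xi>" using \<tau> l1_weight_nonneg by (intro mult_right_mono)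
          then show "(\<Sum>l\<in>UNIV. \<bar>\<xi> $ l\<bar>) \<le> \<tau> * l1_weight \<xi>" by (simp add: l1_weight_def)
        qed
        finally show "(\<Sum>l\<in>UNIV. \<bar>\<xi> $ l\<bar> * a) \<le> a * (\<tau> * l1_weight \<xi>)" .
      qed
      finally show ?thesis by (simp add: algebra_simps)
    qed
    have det_ge: "\<tau> ^ CARD('n) \<le> cmod (det ?M)"
      using det_symb_ge[OF hyp] \<tau> by simp
    then have det0: "det ?M \<noteq> 0" using \<tau> by (metis norm_zero not_less zero_less_power less_le_trans zero_less_one)
    have "?M *v (column j (resolv A \<tau> \<xi>)) = axis j 1"
    proof -
      have "?M *v column j (resolv A \<tau> \<xi>) = column j (?M ** resolv A \<tau> \<xi>)"
        by (simp add: vec_eq_iff column_def matrix_vector_mult_def matrix_matrix_mult_def)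
      also have "\<dots> = axis j 1"
        using resolv_inverse(2)[OF hyp, of \<tau> \<xi>] \<tau> by (simp add: vec_eq_iff column_def mat_def axis_def)
      finally show ?thesis .
    qed
    then have "column j (resolv A \<tau> \<xi>) = (\<chi> k. det (\<chi> p q. if q = k then axis j 1 $ p else ?M $ p $ q) / det ?M)"
      using cramer[OF det0] by blast
    then have "resolv A \<tau> \<xi> $ k $ j = det (\<chi> p q. if q = k then axis j 1 $ p else ?M $ p $ q) / det ?M"
      by (simp add: vec_eq_iff column_def)
    also have "cmod \<dots> \<le> fact CARD('n) * ((1 + a) * \<tau> * l1_weight \<xi>) ^ CARD('n) / \<tau> ^ CARD('n)"
    proof -
      \<comment> \<open>The replaced column has entries 0 and 1, which must obey the same bound as
        the entries of the symbol.\<close>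
      have "1 \<le> (1 + a) * \<tau> * l1_weight \<xi>"
        using a0 \<tau> l1_weight_ge_1[of \<xi>] by (metis (no_types) mult_mono' mult_1 le_add_same_cancel1 zero_le_one)
      then have "cmod (det (\<chi> p q. if q = k then axis j 1 $ p else ?M $ p $ q)) \<le> fact CARD('n) * ((1 + a) * \<tau> * l1_weight \<xi>) ^ CARD('n)"
        using entry by (intro norm_det_le) (auto simp: axis_def)
      with det_ge \<tau> show ?thesis
        unfolding norm_divide
        by (intro frac_le) (auto intro: order_trans[OF norm_ge_zero])
    qed
    also have "\<dots> = fact CARD('n) * (1 + a) ^ CARD('n) * l1_weight \<xi> ^ CARD('n)"
      using \<tau> by (simp add: power_mult_distrib)
    finally show "cmod (resolv A \<tau> \<xi> $ k $ j) \<le> fact CARD('n) * (1 + a) ^ CARD('n) * l1_weight \<xi> ^ CARD('n)" .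
  qed (use a0 in simp)
qed

lemma matrix_sub_rdistrib': "(A - B) ** C = A ** C - B ** (C :: complex^'n^'n)"
  by (simp add: matrix_matrix_mult_def vec_eq_iff sum_subtractf left_diff_distrib)

lemma matrix_sub_ldistrib': "C ** (A - B) = C ** A - C ** (B :: complex^'n^'n)"
  by (simp add: matrix_matrix_mult_def vec_eq_iff sum_subtractf right_diff_distrib)

lemma norm_matrix_mult_nth_le:
  fixes X Y :: "complex^'n^'n" and b c :: real
  assumes "\<And>i j. cmod (X $ i $ j) \<le> b" "\<And>i j. cmod (Y $ i $ j) \<le> c"
  shows "cmod ((X ** Y) $ i $ j) \<le> CARD('n) * b * c"
proof -
  have "0 \<le> b" using assms(1) norm_ge_zero order_trans by blast
  then have "cmod (\<Sum>k\<in>UNIV. X $ i $ k * Y $ k $ j) \<le> (\<Sum>k\<in>(UNIV::'n set). b * c)"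
    unfolding norm_mult using assms by (intro sum_norm_le) (simp add: norm_mult mult_mono)
  then show ?thesis by (simp add: matrix_matrix_mult_def)
qed

text \<open>The resolvent identity \<open>R(\<xi> + h) - R(\<xi>) = R(\<xi> + h) D R(\<xi>)\<close>, used twice, gives the remainder
  \<open>R(\<xi> + h) D R(\<xi>) D R(\<xi>)\<close> after the linear term, which is quadratic in \<open>h\<close>.\<close>

lemma resolv_has_derivative:
  fixes A :: "'d::finite \<Rightarrow> complex^'n::finite^'n"
  assumes hyp: "weakly_hyperbolic A" and \<tau>: "\<tau> \<ge> 1"
  shows "((\<lambda>\<xi>. resolv A \<tau> \<xi> $ i $ j) has_derivative
    (\<lambda>v. \<Sum>l\<in>UNIV. v $ l *\<^sub>R (\<Sum>p\<in>UNIV. \<Sum>q\<in>UNIV.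
       resolv A \<tau> \<xi> $ i $ p * (\<i> * A l $ p $ q) * resolv A \<tau> \<xi> $ q $ j))) (at \<xi>)"
    (is "(_ has_derivative ?L) _")
proof -
  define D where "D h = (\<chi> i j. \<i> * (\<Sum>l\<in>UNIV. of_real (h $ l) * A l $ i $ j))" for h :: "real^'d"
  define R where "R = resolv A \<tau>"
  obtain C where C: "C \<ge> 0" "\<And>\<xi> i j. cmod (R \<xi> $ i $ j) \<le> C * l1_weight \<xi> ^ CARD('n)"
    using resolv_bound[OF hyp] \<tau> unfolding R_def by metis
  define a where "a = (\<Sum>l\<in>UNIV. \<Sum>i\<in>UNIV. \<Sum>j\<in>UNIV. cmod (A l $ i $ j))"
  have D_bound: "cmod (D h $ i $ j) \<le> norm h * a" for h i j
  proof -
    have "cmod (D h $ i $ j) \<le> (\<Sum>l\<in>UNIV. norm h * cmod (A l $ i $ j))"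
      by (auto simp: D_def norm_mult component_le_norm_cart intro!: sum_norm_le mult_right_mono)
    also have "\<dots> \<le> norm h * (\<Sum>l\<in>UNIV. \<Sum>i\<in>UNIV. \<Sum>j\<in>UNIV. cmod (A l $ i $ j))"
      unfolding sum_distrib_left[symmetric]
    proof (intro mult_left_mono sum_mono)
      fix l
      have "cmod (A l $ i $ j) \<le> (\<Sum>j\<in>UNIV. cmod (A l $ i $ j))"
        by (intro member_le_sum) auto
      also have "\<dots> \<le> (\<Sum>i\<in>UNIV. \<Sum>j\<in>UNIV. cmod (A l $ i $ j))"
        by (intro member_le_sum[of i UNIV "\<lambda>i. \<Sum>j\<in>UNIV. cmod (A l $ i $ j)"]) (auto intro!: sum_nonneg)
      finally show "cmod (A l $ i $ j) \<le> (\<Sum>i\<in>UNIV. \<Sum>j\<in>UNIV. cmod (A l $ i $ j))" .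
    qed auto
    finally show ?thesis by (simp add: a_def)
  qed
  \<comment> \<open>The symbol is affine in the frequency, so its increment is exactly linear and
    the remainder comes from inverting only.\<close>
  have symb_diff: "symb A \<tau> \<xi> - symb A \<tau> (\<xi> + h) = D h" for \<xi> h
    by (simp add: symb_def D_def vec_eq_iff distrib_right sum.distrib distrib_left)
  have R_diff: "R (\<xi> + h) - R \<xi> = R (\<xi> + h) ** D h ** R \<xi>" for \<xi> h
  proof -
    have "R (\<xi> + h) ** symb A \<tau> (\<xi> + h) = mat 1" "symb A \<tau> \<xi> ** R \<xi> = mat 1"
      using resolv_inverse[OF hyp, of \<tau>] \<tau> by (auto simp: R_def)
    moreover have "R (\<xi> + h) ** D h ** R \<xi> =
        R (\<xi> + h) ** (symb A \<tau> \<xi> ** R \<xi>) - R (\<xi> + h) ** symb A \<tau> (\<xi> + h) ** R \<xi>"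
      unfolding symb_diff[of \<xi> h, symmetric] by (simp add: matrix_sub_ldistrib' matrix_sub_rdistrib' matrix_mul_assoc)
    ultimately show ?thesis by simp
  qed
  have L_eq: "?L v = (R \<xi> ** D v ** R \<xi>) $ i $ j" for v
  proof -
    have "(R \<xi> ** D v ** R \<xi>) $ i $ j = (\<Sum>q\<in>UNIV. \<Sum>p\<in>UNIV. \<Sum>l\<in>UNIV.
        of_real (v $ l) * (R \<xi> $ i $ p * (\<i> * A l $ p $ q) * R \<xi> $ q $ j))"
      by (simp add: matrix_matrix_mult_def D_def sum_distrib_left sum_distrib_right mult_ac)
    also have "\<dots> = (\<Sum>p\<in>UNIV. \<Sum>q\<in>UNIV. \<Sum>l\<in>UNIV.
        of_real (v $ l) * (R \<xi> $ i $ p * (\<i> * A l $ p $ q) * R \<xi> $ q $ j))"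
      by (rule sum.swap)
    also have "\<dots> = (\<Sum>p\<in>UNIV. \<Sum>l\<in>UNIV. \<Sum>q\<in>UNIV.
        of_real (v $ l) * (R \<xi> $ i $ p * (\<i> * A l $ p $ q) * R \<xi> $ q $ j))"
      by (intro sum.cong refl sum.swap)
    also have "\<dots> = (\<Sum>l\<in>UNIV. \<Sum>p\<in>UNIV. \<Sum>q\<in>UNIV.
        of_real (v $ l) * (R \<xi> $ i $ p * (\<i> * A l $ p $ q) * R \<xi> $ q $ j))"
      by (rule sum.swap)
    finally show ?thesis by (simp add: R_def scaleR_conv_of_real sum_distrib_left)
  qed
  define N where "N = real CARD('n)"
  \<comment> \<open>Bounds the entries of the resolvent on the whole unit ball around \<xi>, so that
    the constant of the quadratic remainder does not depend on \<open>h\<close>.\<close>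
  define r where "r = C * (l1_weight \<xi> * (1 + real CARD('d))) ^ CARD('n)"
  have wt_h: "l1_weight (\<xi> + h) \<le> l1_weight \<xi> * (1 + real CARD('d))" if "norm h \<le> 1" for h
  proof -
    have "l1_weight h \<le> 1 + real CARD('d)"
      using l1_weight_le_norm[of h] that mult_left_mono[of "norm h" 1 "real CARD('d)"] by linarith
    then show ?thesis
      using l1_weight_add_le[of \<xi> h] mult_left_mono[of "l1_weight h" _ "l1_weight \<xi>"] l1_weight_nonneg[of \<xi>] by (meson order_trans)
  qed
  have R_r: "cmod (R (\<xi> + h) $ i $ j) \<le> r" if "norm h \<le> 1" for h i j
    unfolding r_def using C(1) wt_h[OF that] l1_weight_nonneg[of "\<xi> + h"]
    by (intro order_trans[OF C(2)] mult_left_mono power_mono) auto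
  show ?thesis
    unfolding R_def[symmetric]
  proof (rule has_derivativeI_quadratic)
    show "bounded_linear (\<lambda>v. \<Sum>l\<in>UNIV. v $ l *\<^sub>R (\<Sum>p\<in>UNIV. \<Sum>q\<in>UNIV. R \<xi> $ i $ p * (\<i> * A l $ p $ q) * R \<xi> $ q $ j))"
      by (intro bounded_linear_sum bounded_linear_scaleR_const bounded_linear_vec_nth)
    fix h :: "real^'d" assume h: "norm h \<le> 1"
    have "R (\<xi> + h) $ i $ j - R \<xi> $ i $ j - ?L h = (R (\<xi> + h) - R \<xi> - R \<xi> ** D h ** R \<xi>) $ i $ j"
      unfolding L_eq by simp
    also have "R (\<xi> + h) - R \<xi> - R \<xi> ** D h ** R \<xi> = R (\<xi> + h) ** D h ** R \<xi> ** D h ** R \<xi>"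
      unfolding R_diff by (simp add: matrix_sub_rdistrib'[symmetric] R_diff)
    also have "cmod (\<dots> $ i $ j) \<le> N * (N * (N * (N * r * (norm h * a)) * r) * (norm h * a)) * r"
      unfolding N_def using R_r[OF h] R_r[of 0] D_bound
      by (intro norm_matrix_mult_nth_le) auto
    finally show "norm (R (\<xi> + h) $ i $ j - R \<xi> $ i $ j - (\<Sum>l\<in>UNIV. h $ l *\<^sub>R (\<Sum>p\<in>UNIV. \<Sum>q\<in>UNIV. R \<xi> $ i $ p * (\<i> * A l $ p $ q) * R \<xi> $ q $ j)))
        \<le> (N ^ 4 * r ^ 3 * a\<^sup>2) * (norm h)\<^sup>2"
      unfolding R_def by (simp add: power_def numeral_eq_Suc mult_ac)
  qed
qed

text \<open>A derivative of a resolvent entry is a combination of products of two entries. The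
  induction therefore runs over all entries and all families at once, and its hypothesis is applied
  twice to such a product. The index \<open>n\<close> stands for \<open>\<tau> = Suc n\<close>, so
  the bounds are uniform in \<tau>.\<close>

lemma rapid_derivatives_resolv:
  fixes A :: "'d::finite \<Rightarrow> complex^'n::finite^'n" and F :: "nat \<Rightarrow> real^'d \<Rightarrow> complex"
  assumes hyp: "weakly_hyperbolic A" and "rapid_derivatives k F"
  shows "rapid_derivatives k (\<lambda>n \<xi>. resolv A (real (Suc n)) \<xi> $ i $ j * F n \<xi>)"
  using assms(2)
proof (induction k arbitrary: F i j)
  obtain C where C: "C \<ge> 0" "\<And>\<tau> \<xi> i j. \<tau> \<ge> 1 \<Longrightarrow> cmod (resolv A \<tau> \<xi> $ i $ j) \<le> C * l1_weight \<xi> ^ CARD('n)"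
    using resolv_bound[OF hyp] by metis
  have rapid: "rapid (\<lambda>n \<xi>. resolv A (real (Suc n)) \<xi> $ i $ j * F n \<xi>)" if "rapid F"
    for F :: "nat \<Rightarrow> real^'d \<Rightarrow> complex" and i j
    using C by (intro rapid_dominated[OF that, of _ C "CARD('n)"]) (auto simp: norm_mult intro!: mult_right_mono)
  {
    case (0 F i j)
    have "continuous_on UNIV (\<lambda>\<xi>. resolv A (real (Suc n)) \<xi> $ i $ j)" for n
      using has_derivative_continuous[OF resolv_has_derivative[OF hyp, of "real (Suc n)"]]
      by (auto intro!: continuous_at_imp_continuous_on)
    with 0 rapid[of F] show ?case by (auto intro!: continuous_on_mult simp del: of_nat_Suc)
  next
    case (Suc k F i j)
    show ?case
    proof (rule rapid_derivatives_SucI)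
      show "rapid (\<lambda>n \<xi>. resolv A (real (Suc n)) \<xi> $ i $ j * F n \<xi>)"
        using rapid Suc.prems by simp
      show "((\<lambda>\<xi>. resolv A (real (Suc n)) \<xi> $ i $ j * F n \<xi>) has_derivative
        (\<lambda>v. \<Sum>l\<in>UNIV. v $ l *\<^sub>R (resolv A (real (Suc n)) \<xi> $ i $ j * pd l (F n) \<xi> +
          (\<Sum>p\<in>UNIV. \<Sum>q\<in>UNIV. (\<i> * A l $ p $ q) *
            (resolv A (real (Suc n)) \<xi> $ i $ p * (resolv A (real (Suc n)) \<xi> $ q $ j * F n \<xi>)))))) (at \<xi>)" for n \<xi>
        using has_derivative_mult[OF resolv_has_derivative[OF hyp, of "real (Suc n)"] rapid_derivatives_has_derivative[OF Suc.prems]]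
        by (rule has_derivative_eq_rhs)
          (simp_all add: fun_eq_iff distrib_left sum.distrib sum_distrib_left sum_distrib_right
            scaleR_conv_of_real mult_ac del: of_nat_Suc)
      show "rapid_derivatives k (\<lambda>n \<xi>. resolv A (real (Suc n)) \<xi> $ i $ j * pd l (F n) \<xi> +
          (\<Sum>p\<in>UNIV. \<Sum>q\<in>UNIV. (\<i> * A l $ p $ q) *
            (resolv A (real (Suc n)) \<xi> $ i $ p * (resolv A (real (Suc n)) \<xi> $ q $ j * F n \<xi>))))" for l
        using Suc.prems rapid_derivatives_Suc_imp_rapid_derivatives[OF Suc.prems]
        by (intro rapid_derivatives_add rapid_derivatives_sum rapid_derivatives_cmult Suc.IH) auto
    qed
  }
qed

lemma stationary_adjoint_solution:
  fixes A :: "'d::finite \<Rightarrow> complex^'n::finite^'n" and \<gamma> :: "real^'d \<Rightarrow> complex"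
  assumes hyp: "weakly_hyperbolic A" and \<gamma>: "schwartz (\<lambda>n::nat. \<gamma>)"
  obtains \<psi> :: "nat \<Rightarrow> 'n \<Rightarrow> real^'d \<Rightarrow> complex" where
    "\<And>i. schwartz (\<lambda>n. \<psi> n i)"
    "\<And>n j x. of_real (real (Suc n)) * \<psi> n j x - (\<Sum>l\<in>UNIV. \<Sum>i\<in>UNIV. A l $ i $ j * pd l (\<psi> n i) x) = (if j = k then \<gamma> x else 0)"
proof -
  \<comment> \<open>Compensates for the constant in \<open>Fourier_inversion\<close>.\<close>
  define c where "c = inverse ((gauss_mass TYPE('d))\<^sup>2)"
  \<comment> \<open>The adjoint system multiplies the symbol by a row vector from the left; with
    datum \<gamma> in component \<open>k\<close> its solution is row \<open>k\<close> of the
    resolvent.\<close>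
  define h where "h n i \<xi> = resolv A (real (Suc n)) \<xi> $ k $ i * (c * FT (-1) \<gamma> \<xi>)" for n i \<xi>
  define \<psi> where "\<psi> n i = FT 1 (h n i)" for n i
  have F\<gamma>: "schwartz (\<lambda>n::nat. FT (-1) \<gamma>)"
    by (rule schwartz_FT[OF \<gamma>]) simp
  have h: "schwartz (\<lambda>n. h n i)" for i
    unfolding schwartz_def h_def
    using schwartz_cmult[OF F\<gamma>, of c] by (intro allI rapid_derivatives_resolv[OF hyp]) (simp add: schwartz_def)
  show ?thesis
  proof (rule that)
    show "schwartz (\<lambda>n. \<psi> n i)" for i
      unfolding \<psi>_def by (rule schwartz_FT[OF h]) simp
    fix n j x
    let ?\<tau> = "real (Suc n)"
    have int: "integrable lborel (h n i)" for i by (rule schwartz_integrable[OF h])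
    have int': "integrable lborel (\<lambda>\<xi>. of_real (\<xi> $ l) * h n i \<xi>)" for i l
      by (rule schwartz_integrable[OF schwartz_coord[OF h]])
    have pd: "pd l (\<psi> n i) x = \<i> * FT 1 (\<lambda>\<xi>. of_real (\<xi> $ l) * h n i \<xi>) x" for l i
    proof -
      have "(FT 1 (h n i) has_derivative
        (\<lambda>v. \<Sum>l\<in>UNIV. v $ l *\<^sub>R (\<i> * of_real 1 * FT 1 (\<lambda>\<xi>. of_real (\<xi> $ l) * h n i \<xi>) x))) (at x)"
        by (rule FT_has_derivative[OF rapid_single[OF schwartz_rapid[OF h]] schwartz_measurable[OF h]])
      from pd_eqI[OF this] show ?thesis
        by (simp add: \<psi>_def axis_def if_distrib[of "\<lambda>c. c *\<^sub>R _"] cong: if_cong)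
    qed
    have "of_real ?\<tau> * \<psi> n j x - (\<Sum>l\<in>UNIV. \<Sum>i\<in>UNIV. A l $ i $ j * pd l (\<psi> n i) x)
      = FT 1 (\<lambda>\<xi>. of_real ?\<tau> * h n j \<xi> + (\<Sum>l\<in>UNIV. \<Sum>i\<in>UNIV. (- \<i> * A l $ i $ j) * (of_real (\<xi> $ l) * h n i \<xi>))) x"
    proof -
      have int2: "integrable lborel (\<lambda>\<xi>. (- \<i> * A l $ i $ j) * (of_real (\<xi> $ l) * h n i \<xi>))" for l i
        by (rule integrable_mult_right[OF int'])
      have "FT 1 (\<lambda>\<xi>. of_real ?\<tau> * h n j \<xi> + (\<Sum>l\<in>UNIV. \<Sum>i\<in>UNIV. (- \<i> * A l $ i $ j) * (of_real (\<xi> $ l) * h n i \<xi>))) x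
        = FT 1 (\<lambda>\<xi>. of_real ?\<tau> * h n j \<xi>) x
          + (\<Sum>l\<in>UNIV. \<Sum>i\<in>UNIV. FT 1 (\<lambda>\<xi>. (- \<i> * A l $ i $ j) * (of_real (\<xi> $ l) * h n i \<xi>)) x)"
        by (simp only: FT_add FT_sum integrable_mult_right[OF int] Bochner_Integration.integrable_sum int2)
      then show ?thesis
        unfolding pd FT_cmult by (simp add: \<psi>_def sum_negf mult_ac)
    qed
    also have "(\<lambda>\<xi>. of_real ?\<tau> * h n j \<xi> + (\<Sum>l\<in>UNIV. \<Sum>i\<in>UNIV. (- \<i> * A l $ i $ j) * (of_real (\<xi> $ l) * h n i \<xi>)))
      = (\<lambda>\<xi>. (if j = k then c else 0) * FT (-1) \<gamma> \<xi>)"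
    proof
      fix \<xi> :: "real^'d"
      have "(\<Sum>l\<in>UNIV. \<Sum>i\<in>UNIV. (- \<i> * A l $ i $ j) * (of_real (\<xi> $ l) * h n i \<xi>)) =
        (\<Sum>i\<in>UNIV. \<Sum>l\<in>UNIV. (- \<i> * A l $ i $ j) * (of_real (\<xi> $ l) * h n i \<xi>))"
        by (rule sum.swap)
      then have "of_real ?\<tau> * h n j \<xi> + (\<Sum>l\<in>UNIV. \<Sum>i\<in>UNIV. (- \<i> * A l $ i $ j) * (of_real (\<xi> $ l) * h n i \<xi>))
        = (\<Sum>i\<in>UNIV. h n i \<xi> * symb A ?\<tau> \<xi> $ i $ j)"
        by (simp add: symb_def right_diff_distrib sum_subtractf if_distrib[of "\<lambda>c. _ * c"] sum_distrib_left
            sum_negf mult_ac del: of_nat_Suc cong: if_cong)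
      also have "\<dots> = (resolv A ?\<tau> \<xi> ** symb A ?\<tau> \<xi>) $ k $ j * (c * FT (-1) \<gamma> \<xi>)"
        by (simp add: h_def matrix_matrix_mult_def sum_distrib_left sum_distrib_right mult_ac del: of_nat_Suc)
      also have "\<dots> = (if j = k then c else 0) * FT (-1) \<gamma> \<xi>"
        using resolv_inverse(1)[OF hyp, of ?\<tau> \<xi>] by (simp add: mat_def del: of_nat_Suc)
      finally show "of_real ?\<tau> * h n j \<xi> + (\<Sum>l\<in>UNIV. \<Sum>i\<in>UNIV. (- \<i> * A l $ i $ j) * (of_real (\<xi> $ l) * h n i \<xi>))
        = (if j = k then c else 0) * FT (-1) \<gamma> \<xi>" .
    qed
    also have "FT 1 (\<lambda>\<xi>. (if j = k then c else 0) * FT (-1) \<gamma> \<xi>) x = (if j = k then \<gamma> x else 0)"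
      unfolding FT_cmult Fourier_inversion[OF \<gamma>] c_def using gauss_mass_neq_0[where 'd = 'd] by simp
    finally show "of_real ?\<tau> * \<psi> n j x - (\<Sum>l\<in>UNIV. \<Sum>i\<in>UNIV. A l $ i $ j * pd l (\<psi> n i) x) = (if j = k then \<gamma> x else 0)" .
  qed
qed

section \<open>Vanishing from Laplace transforms, and approximations\<close>

lemma integrable_compact_support:
  fixes f :: "'a::euclidean_space \<Rightarrow> 'b::{banach, second_countable_topology}"
  assumes "continuous_on UNIV f" "compact S" "\<And>x. x \<notin> S \<Longrightarrow> f x = 0"
  shows "integrable lborel f"
proof -
  have "integrable lborel (\<lambda>x. indicator S x *\<^sub>R f x)"
    using assms by (intro borel_integrable_compact) (auto intro: continuous_on_subset)
  moreover have "(\<lambda>x. indicator S x *\<^sub>R f x) = f"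
    using assms(3) by (auto simp: indicator_def)
  ultimately show ?thesis by simp
qed

text \<open>The series \<open>1 - exp (- y) = \<Sum>k\<ge>1. (- 1) ^ (k - 1) * y ^ k / k!\<close> at
  \<open>y = exp (n (c - t))\<close> turns the Laplace transform at the multiples of \<open>n\<close> into an integral that
  converges to the integral of \<open>f\<close> over \<open>t < c\<close>.\<close>

lemma laplace_vanishing:
  fixes f :: "real \<Rightarrow> complex"
  assumes cont: "continuous_on UNIV f" and supp: "\<And>t. t \<notin> {0..S} \<Longrightarrow> f t = 0"
    and bound: "\<And>n. n \<ge> m \<Longrightarrow> cmod (LINT t|lborel. of_real (exp (- real n * t)) * f t) \<le> C * exp (- real n * T)"
    and "t < T"
  shows "f t = 0"
proof -
  have int: "integrable lborel f"
    by (rule integrable_compact_support[OF cont, of "{0..S}"]) (auto simp: supp)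
  note [measurable] = borel_measurable_continuous_onI[OF cont]
  have C0: "C \<ge> 0"
    using order_trans[OF norm_ge_zero bound[OF order_refl]] by (simp add: zero_le_mult_iff)
  define G where "G n c = (LINT t|lborel. of_real (1 - exp (- exp (real n * (c - t)))) * f t)" for n c
  have G_lim: "(\<lambda>n. G n c) \<longlonglongrightarrow> (LINT t|lborel. indicator {..<c} t *\<^sub>R f t)" for c
    unfolding G_def
  proof (rule integral_dominated_convergence[where w = "\<lambda>t. cmod (f t)"])
    show "integrable lborel (\<lambda>t. cmod (f t))" using int by simp
    show "AE t in lborel. norm (of_real (1 - exp (- exp (real n * (c - t)))) * f t) \<le> cmod (f t)" for n
    proof (rule AE_I2)
      fix t
      have "\<bar>1 - exp (- exp (real n * (c - t)))\<bar> \<le> 1" by simp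
      from mult_right_mono[OF this norm_ge_zero[of "f t"]]
      show "norm (of_real (1 - exp (- exp (real n * (c - t)))) * f t) \<le> cmod (f t)"
        by (simp only: norm_mult norm_of_real mult_1)
    qed
    show "AE t in lborel. (\<lambda>n. of_real (1 - exp (- exp (real n * (c - t)))) * f t)
        \<longlonglongrightarrow> indicator {..<c} t *\<^sub>R f t"
      using AE_lborel_singleton[of c]
    proof eventually_elim
      fix t assume "t \<noteq> c"
      have "(\<lambda>n. 1 - exp (- exp (real n * (c - t)))) \<longlonglongrightarrow> indicator {..<c} t"
      proof (cases "t < c")
        case True
        have "filterlim (\<lambda>n. real n * (c - t)) at_top sequentially"
          using True by (intro filterlim_at_top_mult_tendsto_pos[OF tendsto_const] filterlim_real_sequentially) auto
        then have "filterlim (\<lambda>n. - exp (real n * (c - t))) at_bot sequentially"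
          unfolding filterlim_uminus_at_top[symmetric] by (rule filterlim_compose[OF exp_at_top])
        then have "(\<lambda>n. exp (- exp (real n * (c - t)))) \<longlonglongrightarrow> 0"
          by (rule filterlim_compose[OF exp_at_bot])
        from tendsto_diff[OF tendsto_const this, of 1] show ?thesis using True by simp
      next
        case False
        then have "t > c" using \<open>t \<noteq> c\<close> by simp
        then have "filterlim (\<lambda>n. real n * (t - c)) at_top sequentially"
          by (intro filterlim_at_top_mult_tendsto_pos[OF tendsto_const] filterlim_real_sequentially) auto
        then have "filterlim (\<lambda>n. - (real n * (t - c))) at_bot sequentially"
          unfolding filterlim_uminus_at_top[symmetric] .
        from filterlim_compose[OF exp_at_bot this]
        have "(\<lambda>n. exp (real n * (c - t))) \<longlonglongrightarrow> 0" by (simp add: algebra_simps)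
        then have "(\<lambda>n. 1 - exp (- exp (real n * (c - t)))) \<longlonglongrightarrow> 1 - exp (- 0)"
          by (intro tendsto_intros)
        with False show ?thesis by simp
      qed
      then have "(\<lambda>n. of_real (1 - exp (- exp (real n * (c - t)))) * f t) \<longlonglongrightarrow> of_real (indicator {..<c} t) * f t"
        by (intro tendsto_intros)
      then show "(\<lambda>n. of_real (1 - exp (- exp (real n * (c - t)))) * f t) \<longlonglongrightarrow> indicator {..<c} t *\<^sub>R f t"
        by (simp add: scaleR_conv_of_real)
    qed
  qed measurable
  \<comment> \<open>Only the exponents \<open>Suc k * n\<close> occur, all at least
    \<open>m\<close>, so the hypothesis applies to each term. Its factor
    \<open>exp (- real n * T)\<close> to the power \<open>Suc k\<close> combines with the
    coefficient, and the bounds sum to an exponential series without its term of order 0.\<close>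
  have G_bound: "cmod (G n c) \<le> C * (exp (exp (real n * (c - T))) - 1)" if n: "n \<ge> m" "n \<ge> 1" for n c
  proof -
    define g where "g k t = of_real (- ((- exp (real n * (c - t))) ^ Suc k / fact (Suc k))) * f t" for k t
    have sm: "(\<lambda>k. y ^ Suc k / fact (Suc k)) sums (exp y - 1)" for y :: real
      using sums_Suc_iff[of "\<lambda>k. y ^ k / fact k" "exp y - 1"] exp_converges[of y]
      by (simp add: divide_inverse mult.commute)
    have g_sums: "(\<lambda>k. g k t) sums (of_real (1 - exp (- exp (real n * (c - t)))) * f t)" for t
      unfolding g_def using sums_minus[OF sm[of "- exp (real n * (c - t))"]]
      by (intro sums_mult2 sums_of_real) simp
    have pow: "exp (real n * (c - t)) ^ Suc k = exp (real (Suc k * n) * c) * exp (- real (Suc k * n) * t)" for t k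
      by (simp add: exp_of_nat_mult[symmetric] exp_add[symmetric] algebra_simps)
    have g_eq: "g k t = of_real (- ((-1) ^ Suc k) * exp (real (Suc k * n) * c) / fact (Suc k)) * (of_real (exp (- real (Suc k * n) * t)) * f t)" for k t
    proof -
      have "- ((- exp (real n * (c - t))) ^ Suc k / fact (Suc k)) =
        (- ((-1) ^ Suc k) * exp (real (Suc k * n) * c) / fact (Suc k)) * exp (- real (Suc k * n) * t)"
        unfolding power_minus[of "exp _"] pow by simp
      then show ?thesis unfolding g_def by (simp only: of_real_mult mult.assoc)
    qed
    define Y where "Y = exp (real n * c)"
    \<comment> \<open>For negative \<open>t\<close> the exponential would exceed \<open>Y\<close>,
      but \<open>f\<close> vanishes there.\<close>
    have g_norm: "cmod (g k t) \<le> (Y ^ Suc k / fact (Suc k)) * cmod (f t)" for k t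
    proof (cases "t \<in> {0..S}")
      case True
      have "exp (real n * (c - t)) \<le> Y"
        unfolding Y_def using True by (simp add: mult_left_mono)
      then have "exp (real n * (c - t)) ^ Suc k \<le> Y ^ Suc k" by (intro power_mono) auto
      then have "exp (real n * (c - t)) ^ Suc k / fact (Suc k) * cmod (f t) \<le> Y ^ Suc k / fact (Suc k) * cmod (f t)"
        by (intro mult_right_mono divide_right_mono) auto
      moreover have "cmod (g k t) = exp (real n * (c - t)) ^ Suc k / fact (Suc k) * cmod (f t)"
        unfolding g_def norm_mult norm_of_real abs_minus_cancel abs_divide power_abs by simp
      ultimately show ?thesis by simp
    qed (simp add: g_def supp)
    have g_int: "integrable lborel (g k)" for k
    proof (rule Bochner_Integration.integrable_bound)
      show "integrable lborel (\<lambda>t. (Y ^ Suc k / fact (Suc k)) * cmod (f t))"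
        by (intro integrable_mult_right integrable_norm int)
      show "g k \<in> borel_measurable lborel" unfolding g_def by measurable
      show "AE t in lborel. norm (g k t) \<le> norm ((Y ^ Suc k / fact (Suc k)) * cmod (f t))"
        unfolding real_norm_def by (intro AE_I2 order_trans[OF g_norm abs_ge_self])
    qed
    have int_g: "cmod (LINT t|lborel. g k t) \<le> C * (exp (real n * (c - T)) ^ Suc k / fact (Suc k))" for k
    proof -
      have "m \<le> Suc k * n" using n by (metis le_trans mult_le_mono1 mult_1 Suc_le_eq zero_less_Suc One_nat_def)
      from bound[OF this]
      have "exp (real (Suc k * n) * c) / fact (Suc k) * cmod (LINT t|lborel. of_real (exp (- real (Suc k * n) * t)) * f t)
          \<le> exp (real (Suc k * n) * c) / fact (Suc k) * (C * exp (- real (Suc k * n) * T))"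
        by (intro mult_left_mono) auto
      moreover have "cmod (LINT t|lborel. g k t) =
        exp (real (Suc k * n) * c) / fact (Suc k) * cmod (LINT t|lborel. of_real (exp (- real (Suc k * n) * t)) * f t)"
        unfolding g_eq integral_mult_right_zero norm_mult norm_of_real abs_divide abs_mult abs_minus_cancel power_abs
        by simp
      moreover have "exp (real (Suc k * n) * c) / fact (Suc k) * (C * exp (- real (Suc k * n) * T))
          = C * (exp (real n * (c - T)) ^ Suc k / fact (Suc k))"
        unfolding pow by simp
      ultimately show ?thesis by linarith
    qed
    have summ: "summable (\<lambda>k. y ^ Suc k / fact (Suc k))" for y :: real
      using sm sums_summable by blast
    have "G n c = (LINT t|lborel. (\<Sum>k. g k t))"
      unfolding G_def using sums_unique[OF g_sums] by simp
    also have "\<dots> = (\<Sum>k. LINT t|lborel. g k t)"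
    proof (rule integral_suminf[OF g_int])
      show "AE t in lborel. summable (\<lambda>k. norm (g k t))"
      proof (rule AE_I2)
        fix t
        show "summable (\<lambda>k. norm (g k t))"
        proof (rule summable_comparison_test'[where N = 0])
          show "summable (\<lambda>k. (Y ^ Suc k / fact (Suc k)) * cmod (f t))"
            by (rule summable_mult2[OF summ])
          show "norm (norm (g k t)) \<le> (Y ^ Suc k / fact (Suc k)) * cmod (f t)" for k
            by (simp only: real_norm_def abs_norm_cancel g_norm)
        qed
      qed
      show "summable (\<lambda>k. LINT t|lborel. norm (g k t))"
      proof (rule summable_comparison_test'[where N = 0 and g = "\<lambda>k. (Y ^ Suc k / fact (Suc k)) * (LINT t|lborel. cmod (f t))"])
        show "summable (\<lambda>k. (Y ^ Suc k / fact (Suc k)) * (LINT t|lborel. cmod (f t)))"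
          by (rule summable_mult2[OF summ])
        fix k :: nat
        have "(LINT t|lborel. norm (g k t)) \<le> (LINT t|lborel. (Y ^ Suc k / fact (Suc k)) * cmod (f t))"
          by (intro integral_mono integrable_norm g_int integrable_mult_right int g_norm)
        then show "norm (LINT t|lborel. norm (g k t)) \<le> (Y ^ Suc k / fact (Suc k)) * (LINT t|lborel. cmod (f t))"
          by simp
      qed
    qed
    also have "cmod \<dots> \<le> (\<Sum>k. C * (exp (real n * (c - T)) ^ Suc k / fact (Suc k)))"
      by (rule norm_suminf_le[OF int_g summable_mult[OF summ]])
    also have "\<dots> = C * (exp (exp (real n * (c - T))) - 1)"
      using sums_unique[OF sums_mult[OF sm]] by simp
    finally show ?thesis .
  qed
  have zero: "(LINT t|lborel. indicator {..<c} t *\<^sub>R f t) = 0" if "c < T" for c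
  proof -
    have "filterlim (\<lambda>n. real n * (T - c)) at_top sequentially"
      using that by (intro filterlim_at_top_mult_tendsto_pos[OF tendsto_const] filterlim_real_sequentially) auto
    then have "filterlim (\<lambda>n. - (real n * (T - c))) at_bot sequentially"
      unfolding filterlim_uminus_at_top[symmetric] .
    from filterlim_compose[OF exp_at_bot this]
    have "(\<lambda>n. exp (real n * (c - T))) \<longlonglongrightarrow> 0" by (simp add: algebra_simps)
    then have "(\<lambda>n. C * (exp (exp (real n * (c - T))) - 1)) \<longlonglongrightarrow> C * (exp 0 - 1)"
      by (intro tendsto_intros)
    then have "(\<lambda>n. C * (exp (exp (real n * (c - T))) - 1)) \<longlonglongrightarrow> 0" by simp
    then have "(\<lambda>n. G n c) \<longlonglongrightarrow> 0"
      by (rule Lim_null_comparison[rotated])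
        (use G_bound in \<open>auto intro!: eventually_sequentiallyI[of "max m 1"]\<close>)
    with G_lim[of c] show ?thesis using LIMSEQ_unique by blast
  qed
  \<comment> \<open>Any base point to the left of \<open>t\<close> serves. Up to
    \<open>(t + T) / 2\<close>, which is below \<open>T\<close>, the integral of \<open>f\<close>
    from this point is 0, and its derivative at \<open>t\<close> is \<open>f t\<close>.\<close>
  define p where "p = t - 1"
  have "f t = 0"
  proof -
    have hi: "((\<lambda>u. integral {p..u} f) has_vector_derivative f t) (at t within {p..(t + T) / 2})"
      using \<open>t < T\<close> by (intro integral_has_vector_derivative continuous_on_subset[OF cont]) (auto simp: p_def)
    have "integral {p..u} f = 0" if u: "u \<in> {p..(t + T) / 2}" for u
    proof -
      have uT: "u < T" "p < T" "p \<le> u" using u \<open>t < T\<close> by (auto simp: p_def)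
      have "set_integrable lborel {p..u} f"
        using int by (simp add: set_integrable_def integrable_mult_indicator)
      then have "integral {p..u} f = (LINT x:{p..u}|lborel. f x)"
        by (simp add: set_borel_integral_eq_integral(2))
      also have "\<dots> = (LINT x|lborel. indicator {..<u} x *\<^sub>R f x - indicator {..<p} x *\<^sub>R f x)"
        unfolding set_lebesgue_integral_def
      proof (rule integral_cong_AE)
        show "AE x in lborel. indicat_real {p..u} x *\<^sub>R f x = indicat_real {..<u} x *\<^sub>R f x - indicat_real {..<p} x *\<^sub>R f x"
          using AE_lborel_singleton[of u] by eventually_elim (use uT in \<open>auto simp: indicator_def\<close>)
      qed measurable
      also have "\<dots> = 0"
        using int zero uT by (subst Bochner_Integration.integral_diff) (auto intro!: integrable_mult_indicator)
      finally show ?thesis .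
    qed
    then have "((\<lambda>u. 0) has_vector_derivative f t) (at t within {p..(t + T) / 2})"
      using hi \<open>t < T\<close> by (rule_tac has_vector_derivative_transform[OF _ _ hi]) (auto simp: p_def)
    moreover have "at t within {p..(t + T) / 2} \<noteq> bot"
      using \<open>t < T\<close> by (auto simp: p_def trivial_limit_within islimpt_Icc)
    ultimately show ?thesis
      using vector_derivative_unique_within has_vector_derivative_const by blast
  qed
  then show ?thesis .
qed

section \<open>Smooth plateaus in time\<close>

lemma Ck_inverse:
  fixes f :: "'a::euclidean_space \<Rightarrow> real"
  shows "Ck k f \<Longrightarrow> (\<And>x. f x \<noteq> 0) \<Longrightarrow> Ck k (\<lambda>x. inverse (f x))"
proof (induction k)
  case 0
  then show ?case by (auto intro!: continuous_intros)
next
  case (Suc k)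
  have 1: "Ck k (\<lambda>x. inverse (f x))"
    using Suc Ck_Suc_imp_Ck by blast
  show ?case
  proof (rule Ck_SucI)
    show "((\<lambda>x. inverse (f x)) has_derivative
        (\<lambda>v. - (inverse (f x) * frechet_derivative f (at x) v * inverse (f x)))) (at x)" for x
      using Suc.prems(2) by (intro Deriv.has_derivative_inverse Ck_Suc_has_derivative[OF Suc.prems(1)])
    show "Ck k (\<lambda>x. - (inverse (f x) * frechet_derivative f (at x) b * inverse (f x)))" if "b \<in> Basis" for b
      using Suc.prems(1) that
      by (intro Ck_bounded_linear_compose[OF bounded_linear_minus[OF bounded_linear_ident]] Ck_mult 1) auto
  qed
qed

lemma Ck_exp_linear: "Ck k (\<lambda>t::real. exp (c * t))"
proof (induction k)
  case (Suc k)
  show ?case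
  proof (rule Ck_real_SucI)
    show "((\<lambda>t. exp (c * t)) has_vector_derivative c * exp (c * s)) (at s)" for s
      unfolding has_real_derivative_iff_has_vector_derivative[symmetric]
      by (auto intro!: derivative_eq_intros)
    show "Ck k (\<lambda>s. c * exp (c * s))"
      by (intro Ck_mult Suc) simp
  qed
qed (auto intro!: continuous_intros)

text \<open>The denominator never vanishes, since \<open>s\<close> and \<open>1 - s\<close> are
  never both nonpositive.\<close>

definition smooth_step :: "real \<Rightarrow> real" where
  "smooth_step s = kap s * inverse (kap s + kap (1 - s))"

lemma smooth_step_denominator: "kap s + kap (1 - s) > 0"
  by (cases "s > 0") (use kap_pos[of s] kap_pos[of "1 - s"] kap_nonneg in \<open>auto intro: add_pos_nonneg add_nonneg_pos\<close>)

lemma Ck_smooth_step: "Ck k smooth_step"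
proof -
  have "Ck k (\<lambda>s. kap (- s + 1))"
    by (intro Ck_compose_affine Ck_kap bounded_linear_minus bounded_linear_ident)
  then have "Ck k (\<lambda>s. kap s + kap (1 - s))"
    by (intro Ck_add Ck_kap) simp
  then show ?thesis
    unfolding smooth_step_def using smooth_step_denominator
    by (intro Ck_mult Ck_kap Ck_inverse) (auto simp: less_imp_neq[symmetric])
qed

lemma smooth_step_0: "s \<le> 0 \<Longrightarrow> smooth_step s = 0"
  by (simp add: smooth_step_def kap_eq_0)

lemma smooth_step_1: "s \<ge> 1 \<Longrightarrow> smooth_step s = 1"
  using smooth_step_denominator[of s] by (simp add: smooth_step_def kap_eq_0)

text \<open>Rises on \<open>[-1, 0]\<close>, where the solutions vanish, and falls on
  \<open>[T, T + 1]\<close>. Only the fall contributes to the truncation error.\<close>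

definition plateau :: "real \<Rightarrow> real \<Rightarrow> real" where
  "plateau T t = smooth_step (t + 1) * smooth_step (T + 1 - t)"

lemma Ck_plateau: "Ck k (plateau T)"
proof -
  have "Ck k (\<lambda>t. smooth_step (t + 1))" "Ck k (\<lambda>t. smooth_step (- t + (T + 1)))"
    by (intro Ck_compose_affine Ck_smooth_step bounded_linear_minus bounded_linear_ident)+
  then show ?thesis
    unfolding plateau_def by (intro Ck_mult) (auto simp: algebra_simps)
qed

lemma plateau_eq_1: "0 \<le> t \<Longrightarrow> t \<le> T \<Longrightarrow> plateau T t = 1"
  by (simp add: plateau_def smooth_step_1)

lemma plateau_eq_0: "t \<notin> {-1..T + 1} \<Longrightarrow> plateau T t = 0"
  by (auto simp: plateau_def smooth_step_0)

lemma plateau_has_derivative: "(plateau T has_real_derivative deriv (plateau T) t) (at t)"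
proof -
  have "plateau T differentiable (at t)"
    using Ck_plateau[of "Suc 0" T] by simp
  then show ?thesis by (simp add: DERIV_deriv_iff_real_differentiable)
qed

lemma continuous_deriv_plateau: "continuous_on UNIV (deriv (plateau T))"
proof -
  have "Ck 0 (\<lambda>t. frechet_derivative (plateau T) (at t) 1)"
    using Ck_plateau[of "Suc 0" T] by simp
  moreover have "frechet_derivative (plateau T) (at t) 1 = deriv (plateau T) t" for t
    using frechet_derivative_at[OF plateau_has_derivative[unfolded has_field_derivative_def]] by (metis mult_1_right)
  ultimately show ?thesis by simp
qed

lemma deriv_plateau_eq_0: "t \<notin> {-1..T + 1} \<or> t \<in> {0<..<T} \<Longrightarrow> deriv (plateau T) t = 0"
proof -
  assume "t \<notin> {-1..T + 1} \<or> t \<in> {0<..<T}"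
  then have "(\<forall>\<^sub>F s in nhds t. plateau T s = 0) \<or> (\<forall>\<^sub>F s in nhds t. plateau T s = 1)"
  proof
    assume "t \<notin> {-1..T + 1}"
    then have "\<forall>\<^sub>F s in nhds t. s \<in> - {-1..T + 1}"
      by (intro eventually_nhds_in_open) auto
    then have "\<forall>\<^sub>F s in nhds t. plateau T s = 0"
      by (rule eventually_mono) (auto intro: plateau_eq_0)
    then show ?thesis ..
  next
    assume "t \<in> {0<..<T}"
    then have "\<forall>\<^sub>F s in nhds t. s \<in> {0<..<T}"
      by (intro eventually_nhds_in_open) auto
    then have "\<forall>\<^sub>F s in nhds t. plateau T s = 1"
      by (rule eventually_mono) (auto intro: plateau_eq_1)
    then show ?thesis ..
  qed
  then show ?thesis
    using deriv_cong_ev[of "plateau T" "\<lambda>_. 0" t t] deriv_cong_ev[of "plateau T" "\<lambda>_. 1" t t] by auto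
qed

text \<open>The cylinder over a null set is null: its measure is a product of one-dimensional
  integrals, of which the one in direction \<open>e\<close> is 0, and in the extended reals 0
  absorbs the infinite factors.\<close>

lemma AE_coord:
  assumes "AE s in lborel. P s"
  shows "AE x::real^'d in lborel. P (x $ e)"
proof -
  obtain N where N: "{s. \<not> P s} \<subseteq> N" "emeasure lborel N = 0" "N \<in> sets lborel"
    using AE_E[OF assms] by auto
  have [measurable]: "N \<in> sets borel" using N(3) by simp
  define f :: "real^'d \<Rightarrow> real \<Rightarrow> real" where "f b = (if b = axis e 1 then indicator N else (\<lambda>_. 1))" for b
  have ax: "axis e 1 \<in> (Basis :: (real^'d) set)" by (auto simp: Basis_vec_def)
  have "(\<integral>\<^sup>+x. ennreal (\<Prod>b\<in>Basis. f b (x \<bullet> b)) \<partial>lborel) = (\<Prod>b\<in>Basis. (\<integral>\<^sup>+x. f b x \<partial>lborel))"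
    using nn_integral_lborel_prod[of f] by (simp add: f_def prod_ennreal)
  also have "\<dots> = 0"
    using N(2) ax by (intro prod_zero finite_Basis) (auto intro!: bexI[of _ "axis e 1"] simp: f_def ennreal_indicator)
  finally have "(\<integral>\<^sup>+x. ennreal (\<Prod>b\<in>Basis. f b (x \<bullet> b)) \<partial>lborel) = 0" .
  moreover have "(\<Prod>b\<in>Basis. f b (x \<bullet> b)) = indicator N (x $ e)" for x :: "real^'d"
  proof -
    have "(\<Prod>b\<in>Basis. f b (x \<bullet> b)) = (\<Prod>b\<in>(Basis::(real^'d) set). if b = axis e 1 then indicator N (x $ e) else 1)"
      by (intro prod.cong refl) (auto simp: f_def inner_axis)
    then show ?thesis using ax by simp
  qed
  ultimately have "(\<integral>\<^sup>+x. indicator N ((x::real^'d) $ e) \<partial>lborel) = 0" by (simp add: ennreal_indicator)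
  then have "AE x::real^'d in lborel. indicator N (x $ e) = (0::ennreal)"
    by (subst (asm) nn_integral_0_iff_AE) auto
  then show ?thesis
    by eventually_elim (use N(1) in \<open>auto simp: indicator_def split: if_splits\<close>)
qed

text \<open>Continuous approximations that converge almost everywhere are clipped to the range of
  \<sigma> and then replaced by polynomials, with error \<open>1 / Suc m\<close> on the growing
  interval; this error makes \<open>C\<close> into \<open>C + 1\<close>. Polynomials have explicit
  primitives and keep the stretching smooth.\<close>

lemma bounded_polynomial_approximation:
  fixes \<sigma> :: "real \<Rightarrow> real"
  assumes "\<sigma> \<in> borel_measurable borel" "AE s in lborel. \<bar>\<sigma> s\<bar> \<le> C" "C \<ge> 0"
  obtains p :: "nat \<Rightarrow> real poly" where
    "\<And>m s. \<bar>s\<bar> \<le> real (Suc m) \<Longrightarrow> \<bar>poly (p m) s\<bar> \<le> C + 1" "AE s in lborel. (\<lambda>m. poly (p m) s) \<longlonglongrightarrow> \<sigma> s"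
proof -
  have "\<sigma> measurable_on UNIV"
    using assms(1) by (intro lebesgue_measurable_imp_measurable_on_real) (auto intro: measurable_completion)
  then obtain N g where N: "negligible N" and g: "\<And>n. continuous_on UNIV (g n)" "\<And>x. x \<notin> N \<Longrightarrow> (\<lambda>n. g n x) \<longlonglongrightarrow> \<sigma> x"
    unfolding measurable_on_def by auto
  define h where "h n s = max (- C) (min C (g n s))" for n :: nat and s
  have h: "continuous_on UNIV (h n)" for n
    unfolding h_def by (intro continuous_intros g)
  have "\<exists>q. \<forall>s. \<bar>s\<bar> \<le> real (Suc m) \<longrightarrow> \<bar>h m s - poly q s\<bar> < 1 / real (Suc m)" for m
  proof -
    obtain r where r: "real_polynomial_function r" "\<And>s. s \<in> cball 0 (real (Suc m)) \<Longrightarrow> \<bar>h m s - r s\<bar> < 1 / real (Suc m)"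
      using Stone_Weierstrass_real_polynomial_function[of "cball 0 (real (Suc m))" "h m" "1 / real (Suc m)"]
        continuous_on_subset[OF h] by auto
    then obtain a n where a: "r = (\<lambda>x. \<Sum>i\<le>n. a i * x ^ i)"
      using real_polynomial_function_iff_sum by blast
    have "r s = poly (\<Sum>i\<le>n. monom (a i) i) s" for s
      by (simp add: a poly_sum poly_monom)
    with r(2) show ?thesis by (intro exI[of _ "\<Sum>i\<le>n. monom (a i) i"]) auto
  qed
  then obtain p where p: "\<And>m s. \<bar>s\<bar> \<le> real (Suc m) \<Longrightarrow> \<bar>h m s - poly (p m) s\<bar> < 1 / real (Suc m)"
    by metis
  show ?thesis
  proof (rule that)
    fix m s assume s: "\<bar>s\<bar> \<le> real (Suc m)"
    have "\<bar>h m s\<bar> \<le> C" using assms(3) by (auto simp: h_def)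
    moreover have "1 / real (Suc m) \<le> 1" by simp
    ultimately show "\<bar>poly (p m) s\<bar> \<le> C + 1" using p[OF s] by linarith
  next
    have "N \<in> null_sets lebesgue" using N by (simp add: negligible_iff_null_sets)
    then have "AE s in lebesgue. s \<notin> N" by (rule AE_not_in)
    then have "AE s in lborel. s \<notin> N" by (simp add: AE_completion_iff)
    with assms(2) show "AE s in lborel. (\<lambda>m. poly (p m) s) \<longlonglongrightarrow> \<sigma> s"
    proof eventually_elim
      fix s assume s: "\<bar>\<sigma> s\<bar> \<le> C" "s \<notin> N"
      have "(\<lambda>m. h m s) \<longlonglongrightarrow> max (- C) (min C (\<sigma> s))"
        unfolding h_def by (intro tendsto_intros g(2) s)
      then have hl: "(\<lambda>m. h m s) \<longlonglongrightarrow> \<sigma> s" using s by (simp add: abs_le_iff min_def max_def split: if_splits)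
      have "(\<lambda>m. h m s - poly (p m) s) \<longlonglongrightarrow> 0"
      proof (rule Lim_null_comparison)
        show "(\<lambda>m. 1 / real (Suc m)) \<longlonglongrightarrow> 0"
          using LIMSEQ_inverse_real_of_nat by (simp add: inverse_eq_divide)
        obtain M :: nat where "\<bar>s\<bar> \<le> real M" using real_arch_simple by blast
        then have "norm (h m s - poly (p m) s) \<le> 1 / real (Suc m)" if "m \<ge> M" for m
          using that by (intro order_trans[OF _ less_imp_le[OF p]]) auto
        then show "\<forall>\<^sub>F m in sequentially. norm (h m s - poly (p m) s) \<le> 1 / real (Suc m)"
          by (rule eventually_sequentiallyI)
      qed
      from tendsto_diff[OF hl this] show "(\<lambda>m. poly (p m) s) \<longlonglongrightarrow> \<sigma> s" by simp
    qed
  qed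
qed

section \<open>Pairings with continuous curves in the space of square integrable functions\<close>

lemma power2_norm_diff_le: "(norm (u - v))\<^sup>2 \<le> 2 * (norm u)\<^sup>2 + 2 * (norm v)\<^sup>2"
  for u v :: "'b::real_normed_vector"
proof -
  have "(norm (u - v))\<^sup>2 \<le> (norm u + norm v)\<^sup>2"
    by (intro power_mono norm_triangle_ineq4) simp
  also have "\<dots> \<le> 2 * (norm u)\<^sup>2 + 2 * (norm v)\<^sup>2"
    using sum_squares_bound[of "norm u" "norm v"] by (simp add: power2_sum)
  finally show ?thesis .
qed

lemma in_L2_dominated:
  assumes "in_L2 D" "w \<in> borel_measurable borel" "AE x in lborel. norm (w x) \<le> c * norm (D x)"
  shows "in_L2 w"
proof -
  have "integrable lborel (\<lambda>x. (norm (w x))\<^sup>2)"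
  proof (rule Bochner_Integration.integrable_bound)
    show "integrable lborel (\<lambda>x. c\<^sup>2 * (norm (D x))\<^sup>2)"
      using assms(1) by (simp add: in_L2_def)
    show "AE x in lborel. norm ((norm (w x))\<^sup>2) \<le> norm (c\<^sup>2 * (norm (D x))\<^sup>2)"
      using assms(3)
    proof eventually_elim
      fix x assume "norm (w x) \<le> c * norm (D x)"
      then have "(norm (w x))\<^sup>2 \<le> (c * norm (D x))\<^sup>2" by (intro power_mono) auto
      then show "norm ((norm (w x))\<^sup>2) \<le> norm (c\<^sup>2 * (norm (D x))\<^sup>2)" by (simp add: power_mult_distrib)
    qed
  qed (use assms(2) in measurable)
  then show ?thesis using assms(2) by (simp add: in_L2_def)
qed

lemma in_L2_diff: "in_L2 u \<Longrightarrow> in_L2 v \<Longrightarrow> in_L2 (\<lambda>x. u x - v x)"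
proof -
  assume u: "in_L2 u" and v: "in_L2 v"
  then have [measurable]: "u \<in> borel_measurable borel" "v \<in> borel_measurable borel"
    by (auto simp: in_L2_def)
  have "integrable lborel (\<lambda>x. 2 * (norm (u x))\<^sup>2 + 2 * (norm (v x))\<^sup>2)"
    using u v by (simp add: in_L2_def)
  then have "integrable lborel (\<lambda>x. (norm (u x - v x))\<^sup>2)"
    by (rule Bochner_Integration.integrable_bound)
      (use power2_norm_diff_le[of "u _" "v _"] in auto)
  then show ?thesis by (simp add: in_L2_def)
qed

definition pairing :: "('a::euclidean_space \<Rightarrow> complex) \<Rightarrow> (real \<Rightarrow> 'a \<Rightarrow> complex^'m) \<Rightarrow> 'm \<Rightarrow> real \<Rightarrow> complex" where
  "pairing w V p t = (LINT x|lborel. w x * V t x $ p)"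

lemma norm_product_le: "cmod (w * v $ p) \<le> ((cmod w)\<^sup>2 + (norm v)\<^sup>2) / 2"
proof -
  have "cmod (w * v $ p) \<le> cmod w * norm v"
    unfolding norm_mult by (intro mult_left_mono Finite_Cartesian_Product.norm_nth_le) simp
  also have "\<dots> \<le> ((cmod w)\<^sup>2 + (norm v)\<^sup>2) / 2"
    using sum_squares_bound[of "cmod w" "norm v"] by simp
  finally show ?thesis .
qed

lemma in_L2_product_integrable:
  fixes w :: "'a::euclidean_space \<Rightarrow> complex" and v :: "'a \<Rightarrow> complex^'m"
  assumes w: "in_L2 w" and v: "in_L2 v"
  shows "integrable lborel (\<lambda>x. w x * v x $ p)"
proof (rule Bochner_Integration.integrable_bound)
  show "integrable lborel (\<lambda>x. ((cmod (w x))\<^sup>2 + (norm (v x))\<^sup>2) / 2)"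
    using w v by (simp add: in_L2_def)
  have [measurable]: "w \<in> borel_measurable borel" "v \<in> borel_measurable borel"
    using w v by (auto simp: in_L2_def)
  have "(\<lambda>x. v x $ p) \<in> borel_measurable borel"
    by (rule borel_measurable_continuous_on[of "\<lambda>z. z $ p"]) (auto intro: continuous_intros)
  then show "(\<lambda>x. w x * v x $ p) \<in> borel_measurable lborel" by measurable
  show "AE x in lborel. norm (w x * v x $ p) \<le> norm (((cmod (w x))\<^sup>2 + (norm (v x))\<^sup>2) / 2)"
    unfolding real_norm_def by (intro AE_I2 order_trans[OF norm_product_le abs_ge_self])
qed

lemma norm_pairing_le:
  fixes w :: "'a::euclidean_space \<Rightarrow> complex" and v :: "'a \<Rightarrow> complex^'m"
  assumes w: "in_L2 w" and v: "in_L2 v"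
  shows "cmod (LINT x|lborel. w x * v x $ p) \<le>
    ((LINT x|lborel. (cmod (w x))\<^sup>2) + (LINT x|lborel. (norm (v x))\<^sup>2)) / 2"
proof -
  have "cmod (LINT x|lborel. w x * v x $ p) \<le> (LINT x|lborel. ((cmod (w x))\<^sup>2 + (norm (v x))\<^sup>2) / 2)"
    using w v by (intro Bochner_Integration.integral_norm_bound_integral in_L2_product_integrable norm_product_le)
      (auto simp: in_L2_def)
  then show ?thesis using w v by (simp add: in_L2_def)
qed

text \<open>A crude form of the Cauchy-Schwarz inequality: the arithmetic-geometric bound applied to
  \<open>v\<close> divided by its norm. It is homogeneous in \<open>v\<close> only, which is what
  continuity in time asks for.\<close>

lemma norm_pairing_le_L2_norm:
  fixes w :: "'a::euclidean_space \<Rightarrow> complex" and v :: "'a \<Rightarrow> complex^'m"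
  assumes w: "in_L2 w" and v: "in_L2 v"
  shows "cmod (LINT x|lborel. w x * v x $ p) \<le> L2_norm v * ((LINT x|lborel. (cmod (w x))\<^sup>2) + 1) / 2"
proof (cases "L2_norm v = 0")
  case True
  then have "(LINT x|lborel. (norm (v x))\<^sup>2) = 0" by (simp add: L2_norm_def)
  then have "AE x in lborel. (norm (v x))\<^sup>2 = 0"
    using v integral_nonneg_eq_0_iff_AE[of lborel "\<lambda>x. (norm (v x))\<^sup>2"] by (simp add: in_L2_def)
  then have "AE x in lborel. w x * v x $ p = 0" by eventually_elim simp
  then have "(LINT x|lborel. w x * v x $ p) = 0" by (rule integral_eq_zero_AE)
  with True show ?thesis by simp
next
  case False
  define r where "r = L2_norm v"
  have r: "r > 0" using False by (simp add: r_def L2_norm_def less_le)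
  have r2: "(LINT x|lborel. (norm (v x))\<^sup>2) = r\<^sup>2"
    by (simp add: r_def L2_norm_def)
  have v': "in_L2 (\<lambda>x. (1 / r) *\<^sub>R v x)"
    using v by (intro in_L2_dominated[OF v, of _ "1 / r"]) (use r in \<open>auto simp: in_L2_def\<close>)
  have "cmod (LINT x|lborel. w x * v x $ p) = r * cmod (LINT x|lborel. w x * ((1 / r) *\<^sub>R v x) $ p)"
    using r by simp
  also have "\<dots> \<le> r * (((LINT x|lborel. (cmod (w x))\<^sup>2) + (LINT x|lborel. (norm ((1 / r) *\<^sub>R v x))\<^sup>2)) / 2)"
    using r by (intro mult_left_mono norm_pairing_le w v') simp
  also have "(LINT x|lborel. (norm ((1 / r) *\<^sub>R v x))\<^sup>2) = 1"
    using r r2 by (simp add: power_mult_distrib power_divide)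
  finally show ?thesis by (simp add: r_def)
qed

lemma pairing_continuous:
  assumes V: "L2_continuous_on UNIV V" and w: "in_L2 w"
  shows "continuous_on UNIV (pairing w V p)"
proof (rule continuous_at_imp_continuous_on, rule ballI)
  fix t
  have L2: "in_L2 (V s)" for s using V by (simp add: L2_continuous_on_def)
  have lim: "((\<lambda>s. L2_norm (\<lambda>x. V s x - V t x)) \<longlongrightarrow> 0) (at t)"
    using V by (simp add: L2_continuous_on_def)
  have "((\<lambda>s. L2_norm (\<lambda>x. V s x - V t x) * ((LINT x|lborel. (cmod (w x))\<^sup>2) + 1) / 2) \<longlongrightarrow>
      0 * ((LINT x|lborel. (cmod (w x))\<^sup>2) + 1) / 2) (at t)"
    by (intro tendsto_intros lim) simp
  then have "((\<lambda>s. L2_norm (\<lambda>x. V s x - V t x) * ((LINT x|lborel. (cmod (w x))\<^sup>2) + 1) / 2) \<longlongrightarrow> 0) (at t)"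
    by simp
  then have "((\<lambda>s. pairing w V p s - pairing w V p t) \<longlongrightarrow> 0) (at t)"
  proof (rule Lim_null_comparison[rotated], intro always_eventually allI)
    fix s
    have "pairing w V p s - pairing w V p t = (LINT x|lborel. w x * (V s x - V t x) $ p)"
      unfolding pairing_def
      by (simp add: right_diff_distrib in_L2_product_integrable[OF w L2])
    then show "cmod (pairing w V p s - pairing w V p t)
        \<le> L2_norm (\<lambda>x. V s x - V t x) * ((LINT x|lborel. (cmod (w x))\<^sup>2) + 1) / 2"
      using norm_pairing_le_L2_norm[OF w in_L2_diff[OF L2 L2]] by simp
  qed
  then show "isCont (pairing w V p) t"
    by (simp add: isCont_def LIM_zero_iff)
qed

text \<open>Times of unbounded norm would accumulate at some \<open>t\<close>; near \<open>t\<close>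
  continuity bounds the squared norm by 2 plus twice its value at \<open>t\<close>.\<close>

lemma L2_locally_bounded:
  assumes V: "L2_continuous_on UNIV V"
  obtains B where "\<And>t. t \<in> {\<alpha>..\<beta>} \<Longrightarrow> (LINT x|lborel. (norm (V t x))\<^sup>2) \<le> B"
proof -
  have L2: "in_L2 (V s)" for s using V by (simp add: L2_continuous_on_def)
  define N where "N t = (LINT x|lborel. (norm (V t x))\<^sup>2)" for t
  have "\<exists>B. \<forall>t\<in>{\<alpha>..\<beta>}. N t \<le> B"
  proof (rule ccontr)
    assume "\<nexists>B. \<forall>t\<in>{\<alpha>..\<beta>}. N t \<le> B"
    then have "\<forall>n. \<exists>t\<in>{\<alpha>..\<beta>}. N t > real n" by (meson not_le)
    then obtain T where T: "\<And>n. T n \<in> {\<alpha>..\<beta>}" "\<And>n. N (T n) > real n" by metis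
    obtain t r where r: "strict_mono r" "(T \<circ> r) \<longlonglongrightarrow> t"
      using compact_Icc[of \<alpha> \<beta>] T(1) unfolding compact_def by meson
    have "((\<lambda>s. L2_norm (\<lambda>x. V s x - V t x)) \<longlongrightarrow> 0) (nhds t)"
      using V by (subst tendsto_nhds_iff) (simp add: L2_continuous_on_def L2_norm_def)
    from filterlim_compose[OF this r(2)]
    have "\<forall>\<^sub>F n in sequentially. L2_norm (\<lambda>x. V ((T \<circ> r) n) x - V t x) < 1"
      by (intro order_tendstoD) auto
    then obtain n0 where n0: "\<And>n. n \<ge> n0 \<Longrightarrow> L2_norm (\<lambda>x. V (T (r n)) x - V t x) < 1"
      by (auto simp: eventually_sequentially)
    have bd: "N (T (r n)) \<le> 2 + 2 * N t" if "n \<ge> n0" for n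
    proof -
      let ?u = "V (T (r n))"
      have d: "in_L2 (\<lambda>x. ?u x - V t x)" by (rule in_L2_diff[OF L2 L2])
      have "(LINT x|lborel. (norm (?u x - V t x))\<^sup>2) \<le> 1"
        using n0[OF that] by (simp add: L2_norm_def real_sqrt_lt_1_iff)
      moreover have "N (T (r n)) \<le> (LINT x|lborel. 2 * (norm (?u x - V t x))\<^sup>2 + 2 * (norm (V t x))\<^sup>2)"
        unfolding N_def
      proof (rule integral_mono)
        show "(norm (?u x))\<^sup>2 \<le> 2 * (norm (?u x - V t x))\<^sup>2 + 2 * (norm (V t x))\<^sup>2" for x
          using power2_norm_diff_le[of "?u x - V t x" "- V t x"] by simp
      qed (use d L2[of t] L2[of "T (r n)"] in \<open>auto simp: in_L2_def\<close>)
      moreover have "\<dots> = 2 * (LINT x|lborel. (norm (?u x - V t x))\<^sup>2) + 2 * N t"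
        using d L2[of t] by (simp add: in_L2_def N_def)
      ultimately show ?thesis by linarith
    qed
    obtain m :: nat where m: "2 + 2 * N t \<le> real m" using real_arch_simple by blast
    have "real (max m n0) \<le> real (r (max m n0))" using seq_suble[OF r(1)] by simp
    with bd[of "max m n0"] T(2)[of "r (max m n0)"] m show False by simp
  qed
  then show ?thesis using that unfolding N_def by blast
qed

text \<open>Dominated convergence twice: in space at each fixed time, with the dominating function
  \<open>D\<close>, and then in time on the support of \<open>a\<close>, with the local bound of the
  norms of \<open>V\<close>.\<close>

lemma pairing_limit:
  fixes V :: "real \<Rightarrow> 'a::euclidean_space \<Rightarrow> complex^'m" and D :: "'a \<Rightarrow> real"
  assumes V: "L2_continuous_on UNIV V"
    and a: "continuous_on UNIV a" "\<And>t. t \<notin> {\<alpha>..\<beta>} \<Longrightarrow> a t = 0"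
    and w: "\<And>n. w n \<in> borel_measurable borel" "w' \<in> borel_measurable borel"
    and D: "in_L2 D" "\<And>n. AE x in lborel. cmod (w n x) \<le> D x"
    and lim: "AE x in lborel. (\<lambda>n. w n x) \<longlonglongrightarrow> w' x"
  shows "in_L2 w'" "(\<lambda>n. LINT t|lborel. a t * pairing (w n) V p t) \<longlonglongrightarrow> (LINT t|lborel. a t * pairing w' V p t)"
proof -
  have L2: "in_L2 (V s)" for s using V by (simp add: L2_continuous_on_def)
  have Dn: "AE x in lborel. cmod (w n x) \<le> 1 * norm (D x)" for n
    using D(2)[of n] by eventually_elim simp
  have wn: "in_L2 (w n)" for n
    by (rule in_L2_dominated[OF D(1) w(1) Dn])
  have "AE x in lborel. \<forall>n. cmod (w n x) \<le> 1 * norm (D x)"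
    using Dn by (simp add: AE_all_countable)
  with lim have D': "AE x in lborel. cmod (w' x) \<le> 1 * norm (D x)"
  proof eventually_elim
    case (elim x)
    then show ?case by (intro tendsto_upperbound[OF tendsto_norm[OF elim(1)]]) auto
  qed
  show w': "in_L2 w'"
    by (rule in_L2_dominated[OF D(1) w(2) D'])
  obtain B where B: "\<And>t. t \<in> {\<alpha>..\<beta>} \<Longrightarrow> (LINT x|lborel. (norm (V t x))\<^sup>2) \<le> B"
    using L2_locally_bounded[OF V] by blast
  define E where "E = (LINT x|lborel. (norm (D x))\<^sup>2)"
  have meas: "(\<lambda>t. a t * pairing u V p t) \<in> borel_measurable lborel" if "in_L2 u" for u
    using borel_measurable_continuous_onI[OF continuous_on_mult[OF a(1) pairing_continuous[OF V that]]] by simp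
  show "(\<lambda>n. LINT t|lborel. a t * pairing (w n) V p t) \<longlonglongrightarrow> (LINT t|lborel. a t * pairing w' V p t)"
  proof (rule integral_dominated_convergence)
    show "integrable lborel (\<lambda>t. cmod (a t) * ((E + B) / 2))"
      using integrable_norm[OF integrable_compact_support[OF a(1) compact_Icc a(2)]] by simp
    show "AE t in lborel. (\<lambda>n. a t * pairing (w n) V p t) \<longlonglongrightarrow> a t * pairing w' V p t"
    proof (intro AE_I2 tendsto_mult tendsto_const)
      fix t
      have [measurable]: "V t \<in> borel_measurable borel" using L2 by (simp add: in_L2_def)
      have [measurable]: "(\<lambda>x. V t x $ p) \<in> borel_measurable borel"
        by (rule borel_measurable_continuous_on[of "\<lambda>z. z $ p"]) (auto intro: continuous_intros)
      note [measurable] = w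
      show "(\<lambda>n. pairing (w n) V p t) \<longlonglongrightarrow> pairing w' V p t"
        unfolding pairing_def
      proof (rule integral_dominated_convergence)
        show "integrable lborel (\<lambda>x. ((norm (D x))\<^sup>2 + (norm (V t x))\<^sup>2) / 2)"
          using D(1) L2[of t] by (simp add: in_L2_def)
        show "AE x in lborel. (\<lambda>n. w n x * V t x $ p) \<longlonglongrightarrow> w' x * V t x $ p"
          using lim by eventually_elim (intro tendsto_intros)
        show "AE x in lborel. norm (w n x * V t x $ p) \<le> ((norm (D x))\<^sup>2 + (norm (V t x))\<^sup>2) / 2" for n
          using Dn[of n]
        proof eventually_elim
          case (elim x)
          then have "(cmod (w n x))\<^sup>2 \<le> (norm (D x))\<^sup>2" by (intro power_mono) auto
          then show ?case using norm_product_le[of "w n x" "V t x" p] by simp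
        qed
      qed measurable
    qed
    show "AE t in lborel. norm (a t * pairing (w n) V p t) \<le> cmod (a t) * ((E + B) / 2)" for n
    proof (rule AE_I2)
      fix t
      show "norm (a t * pairing (w n) V p t) \<le> cmod (a t) * ((E + B) / 2)"
      proof (cases "t \<in> {\<alpha>..\<beta>}")
        case True
        have "(LINT x|lborel. (cmod (w n x))\<^sup>2) \<le> E"
          unfolding E_def
        proof (rule integral_mono_AE)
          show "AE x in lborel. (cmod (w n x))\<^sup>2 \<le> (norm (D x))\<^sup>2"
            using Dn[of n]
          proof eventually_elim
            case (elim x)
            then show ?case using power_mono[of "cmod (w n x)" "\<bar>D x\<bar>" 2] by simp
          qed
        qed (use wn D(1) in \<open>auto simp: in_L2_def\<close>)
        with norm_pairing_le[OF wn L2, of n t p] B[OF True]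
        have "cmod (pairing (w n) V p t) \<le> (E + B) / 2" by (simp add: pairing_def)
        then show ?thesis unfolding norm_mult by (intro mult_left_mono) auto
      qed (simp add: a(2))
    qed
  qed (use meas[OF w'] meas[OF wn] in auto)
qed

section \<open>Integrals of vectors, and functions with vanishing integrals over boxes\<close>

lemma integrable_vec_nth:
  fixes f :: "'a \<Rightarrow> complex^'n"
  assumes "\<And>i. integrable M (\<lambda>x. f x $ i)"
  shows "integrable M f"
proof -
  have "bounded_linear (\<lambda>c::complex. axis i c :: complex^'n)" for i
    by (rule linear_conv_bounded_linear[THEN iffD1], rule linearI) (auto simp: vec_eq_iff axis_def)
  from integrable_bounded_linear[OF this assms]
  have "integrable M (\<lambda>x. \<Sum>i\<in>UNIV. axis i (f x $ i))"
    by (rule Bochner_Integration.integrable_sum)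
  moreover have "(\<Sum>i\<in>UNIV. axis i (f x $ i)) = f x" for x
    by (simp add: vec_eq_iff axis_def if_distrib cong: if_cong)
  ultimately show ?thesis by simp
qed

lemma integral_vec_nth:
  fixes f :: "'a \<Rightarrow> complex^'n"
  assumes "\<And>i. integrable M (\<lambda>x. f x $ i)"
  shows "(LINT x|M. f x) $ i = (LINT x|M. f x $ i)"
  using integral_bounded_linear[OF bounded_linear_vec_nth integrable_vec_nth[OF assms], of i] by simp

text \<open>Since \<open>ennreal\<close> cuts off negative values, the two densities are the
  positive and the negative part of \<open>f\<close>. The measures agree and are finite on boxes, an
  intersection stable generator, hence they are equal, and so are the two parts.\<close>

lemma AE_zero_of_box_integrals:
  fixes f :: "'a::euclidean_space \<Rightarrow> real"
  assumes meas[measurable]: "f \<in> borel_measurable borel"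
    and int: "\<And>a b. integrable lborel (\<lambda>x. indicator (box a b) x * f x)"
    and zero: "\<And>a b. (LINT x|lborel. indicator (box a b) x * f x) = 0"
  shows "AE x in lborel. f x = 0"
proof -
  let ?P = "density lborel (\<lambda>x. ennreal (f x))" and ?N = "density lborel (\<lambda>x. ennreal (- f x))"
  have eq: "emeasure ?P (box a b) = emeasure ?N (box a b)" and fin: "emeasure ?P (box a b) \<noteq> \<infinity>" for a b
  proof -
    let ?g = "\<lambda>x. indicator (box a b) x * f x"
    have P: "emeasure ?P (box a b) = (\<integral>\<^sup>+x. ennreal (?g x) \<partial>lborel)"
      by (subst emeasure_density) (auto intro!: nn_integral_cong simp: indicator_def)
    have N: "emeasure ?N (box a b) = (\<integral>\<^sup>+x. ennreal (- ?g x) \<partial>lborel)"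
      by (subst emeasure_density) (auto intro!: nn_integral_cong simp: indicator_def)
    have fP: "(\<integral>\<^sup>+x. ennreal (?g x) \<partial>lborel) \<noteq> \<infinity>" and fN: "(\<integral>\<^sup>+x. ennreal (- ?g x) \<partial>lborel) \<noteq> \<infinity>"
      using int[of a b] by (auto simp: real_integrable_def)
    define I J where "I = (\<integral>\<^sup>+x. ennreal (?g x) \<partial>lborel)" and "J = (\<integral>\<^sup>+x. ennreal (- ?g x) \<partial>lborel)"
    have IJ: "I \<noteq> top" "J \<noteq> top" using fP fN by (simp_all add: I_def J_def)
    have "enn2real I = enn2real J"
      using real_lebesgue_integral_def[OF int[of a b]] zero[of a b] unfolding I_def J_def by linarith
    from arg_cong[OF this, of ennreal] have "I = J" using IJ by (simp add: ennreal_enn2real_if)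
    then have "(\<integral>\<^sup>+x. ennreal (?g x) \<partial>lborel) = (\<integral>\<^sup>+x. ennreal (- ?g x) \<partial>lborel)"
      unfolding I_def J_def .
    then show "emeasure ?P (box a b) = emeasure ?N (box a b)" using P N by simp
    show "emeasure ?P (box a b) \<noteq> \<infinity>" using P fP by simp
  qed
  have "?P = ?N"
  proof (rule measure_eqI_generator_eq[where E = "range (\<lambda>(a, b). box a b)" and \<Omega> = UNIV
        and A = "\<lambda>n. box (- real n *\<^sub>R One) (real n *\<^sub>R One)"])
    show "Int_stable (range (\<lambda>(a, b). box a b :: 'a set))"
      by (auto simp: Int_stable_def box_Int_box)
    show "(\<Union>n. box (- real n *\<^sub>R One) (real n *\<^sub>R One)) = (UNIV :: 'a set)"
      using UN_box_eq_UNIV by simp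
    show "sets ?P = sigma_sets UNIV (range (\<lambda>(a, b). box a b))" "sets ?N = sigma_sets UNIV (range (\<lambda>(a, b). box a b))"
      by (simp_all add: borel_eq_box sets_measure_of)
  qed (use eq fin in auto)
  then have "AE x in lborel. ennreal (f x) = ennreal (- f x)"
    by (subst (asm) sigma_finite_measure.density_unique_iff[OF sigma_finite_lborel]) auto
  then show ?thesis
  proof eventually_elim
    case (elim x)
    consider "f x > 0" | "f x < 0" | "f x = 0" by linarith
    then show ?case
    proof cases
      case 1
      with elim have "ennreal (f x) = 0" by (simp add: ennreal_neg)
      with 1 show ?thesis by simp
    next
      case 2
      with elim have "ennreal (- f x) = 0" by (simp add: ennreal_neg)
      with 2 show ?thesis by simp
    qed
  qed
qed

lemma AE_zero_of_box_bump_integrals: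
  fixes v :: "real^'d \<Rightarrow> complex^'m"
  assumes v: "in_L2 v"
    and zero: "\<And>a b n. cbox a b \<subseteq> {x. x $ e < 0} \<Longrightarrow> n > 0 \<Longrightarrow> (LINT x|lborel. box_bump (real n) a b x * v x $ p) = 0"
  shows "AE x in lborel. x $ e < 0 \<longrightarrow> v x $ p = 0"
proof -
  define H where "H = {x::real^'d. x $ e < 0}"
  have H: "H \<in> sets borel"
    unfolding H_def by (rule borel_open) (auto intro!: open_Collect_less continuous_intros)
  note [measurable] = H
  have [measurable]: "v \<in> borel_measurable borel" using v by (simp add: in_L2_def)
  have [measurable]: "(\<lambda>x. v x $ p) \<in> borel_measurable borel"
    by (rule borel_measurable_continuous_on[of "\<lambda>z. z $ p"]) (auto intro: continuous_intros)
  have box_L2: "in_L2 (indicator S :: real^'d \<Rightarrow> complex)" if S: "S \<in> sets borel" "S \<subseteq> cbox a b" for S a b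
  proof -
    have "emeasure lborel S \<le> emeasure lborel (cbox a b)"
      using S by (intro emeasure_mono) auto
    also have "\<dots> < \<infinity>" using emeasure_lborel_cbox_finite by simp
    finally have "integrable lborel (indicator S :: real^'d \<Rightarrow> real)" using S by (intro integrable_real_indicator) auto
    moreover have "(\<lambda>x. (cmod (indicator S x))\<^sup>2) = (indicator S :: real^'d \<Rightarrow> real)"
      by (auto simp: indicator_def)
    ultimately show ?thesis using S by (simp add: in_L2_def)
  qed
  have int: "integrable lborel (\<lambda>x. indicator S x * v x $ p)" if S: "S \<in> sets borel" "S \<subseteq> cbox a b" for S a b
    by (rule in_L2_product_integrable[OF box_L2[OF that] v])
  have zero1: "(LINT x|lborel. indicator (box a b) x * v x $ p) = 0" if ab: "cbox a b \<subseteq> H" for a b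
  proof -
    have lim: "(\<lambda>n. LINT x|lborel. box_bump (real (Suc n)) a b x * v x $ p) \<longlonglongrightarrow> (LINT x|lborel. indicator (box a b) x * v x $ p)"
    proof (rule integral_dominated_convergence[where w = "\<lambda>x. cmod (indicator (cbox a b) x * v x $ p)"])
      show "integrable lborel (\<lambda>x. cmod (indicator (cbox a b) x * v x $ p))"
        by (intro integrable_norm int[of _ a b]) auto
      show "AE x in lborel. (\<lambda>n. box_bump (real (Suc n)) a b x * v x $ p) \<longlonglongrightarrow> indicator (box a b) x * v x $ p"
        by (intro AE_I2 tendsto_intros LIMSEQ_Suc[OF box_bump_tendsto])
      show "AE x in lborel. norm (box_bump (real (Suc n)) a b x * v x $ p) \<le> cmod (indicator (cbox a b) x * v x $ p)" for n
      proof (rule AE_I2)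
        fix x
        have "box_bump (real (Suc n)) a b x = 0" if "x \<notin> cbox a b"
          using box_bump_neq_0[of "real (Suc n)" a b x] that by (auto simp: mem_box_cart less_imp_le)
        then show "norm (box_bump (real (Suc n)) a b x * v x $ p) \<le> cmod (indicator (cbox a b) x * v x $ p)"
          using norm_box_bump_le_1[of "real (Suc n)" a b x]
          by (auto simp: norm_mult indicator_def intro: mult_left_le_one_le)
      qed
      show "(\<lambda>x. box_bump (real (Suc n)) a b x * v x $ p) \<in> borel_measurable lborel" for n
        using borel_measurable_continuous_onI[OF Ck_imp_continuous[OF Ck_box_bump[of 0 "real (Suc n)" a b]]] by measurable
    qed measurable
    have "(LINT x|lborel. box_bump (real (Suc n)) a b x * v x $ p) = 0" for n
      by (rule zero[OF ab[unfolded H_def]]) simp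
    from lim[unfolded this] show ?thesis by (rule LIMSEQ_unique[OF _ tendsto_const])
  qed
  have zero2: "(LINT x|lborel. indicator (box a b \<inter> H) x * v x $ p) = 0" for a b
  proof -
    \<comment> \<open>Stops the box at distance \<open>1 / Suc n\<close> from the hyperplane, so
      that the closed box lies in the open half-space; the limit recovers the part of the full box
      in the half-space.\<close>
    define b' where "b' n = (\<chi> l. if l = e then min (b $ e) (- 1 / real (Suc n)) else b $ l)" for n
    have lim: "(\<lambda>n. LINT x|lborel. indicator (box a (b' n)) x * v x $ p) \<longlonglongrightarrow> (LINT x|lborel. indicator (box a b \<inter> H) x * v x $ p)"
    proof (rule integral_dominated_convergence[where w = "\<lambda>x. cmod (indicator (cbox a b) x * v x $ p)"])
      show "integrable lborel (\<lambda>x. cmod (indicator (cbox a b) x * v x $ p))"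
        by (intro integrable_norm int[of _ a b]) auto
      have sub: "x \<in> box a b \<inter> H" if "x \<in> box a (b' n)" for x n
      proof -
        have *: "a $ l < x $ l" "x $ l < b' n $ l" for l using that by (auto simp: mem_box_cart)
        have "x $ l < b $ l" for l using *(2)[of l] by (auto simp: b'_def split: if_splits)
        moreover have "x $ e < 0"
        proof -
          have "x $ e < - 1 / real (Suc n)" using *(2)[of e] by (simp add: b'_def)
          also have "\<dots> < 0" by simp
          finally show ?thesis .
        qed
        ultimately show ?thesis using * by (auto simp: mem_box_cart H_def)
      qed
      show "AE x in lborel. (\<lambda>n. indicator (box a (b' n)) x * v x $ p) \<longlonglongrightarrow> indicator (box a b \<inter> H) x * v x $ p"
      proof (rule AE_I2)
        fix x :: "real^'d"
        have "\<forall>\<^sub>F n in sequentially. indicator (box a (b' n)) x * v x $ p = indicator (box a b \<inter> H) x * v x $ p"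
        proof (cases "x \<in> box a b \<inter> H")
          case True
          then have "x $ e < 0" by (simp add: H_def)
          have "(\<lambda>n. 1 / real (Suc n)) \<longlonglongrightarrow> 0"
            using LIMSEQ_inverse_real_of_nat by (simp add: inverse_eq_divide)
          then have "\<forall>\<^sub>F n in sequentially. 1 / real (Suc n) < - (x $ e)"
            using \<open>x $ e < 0\<close> by (intro order_tendstoD) auto
          then show ?thesis
          proof eventually_elim
            case (elim n)
            then have "x \<in> box a (b' n)" using True by (auto simp: mem_box_cart b'_def)
            with True show ?case by simp
          qed
        next
          case False
          then have "x \<notin> box a (b' n)" for n using sub by blast
          with False show ?thesis by simp
        qed
        then show "(\<lambda>n. indicator (box a (b' n)) x * v x $ p) \<longlonglongrightarrow> indicator (box a b \<inter> H) x * v x $ p"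
          by (rule tendsto_eventually)
      qed
      show "AE x in lborel. norm (indicator (box a (b' n)) x * v x $ p) \<le> cmod (indicator (cbox a b) x * v x $ p)" for n
        using sub[of _ n] box_subset_cbox[of a b] by (intro AE_I2) (auto simp: norm_mult indicator_def)
    qed measurable
    have "(LINT x|lborel. indicator (box a (b' n)) x * v x $ p) = 0" for n
    proof (rule zero1)
      show "cbox a (b' n) \<subseteq> H"
      proof
        fix x assume "x \<in> cbox a (b' n)"
        then have "x $ e \<le> b' n $ e" by (simp add: mem_box_cart)
        also have "\<dots> \<le> - 1 / real (Suc n)" by (simp add: b'_def)
        also have "\<dots> < 0" by simp
        finally show "x \<in> H" by (simp add: H_def)
      qed
    qed
    from lim[unfolded this] show ?thesis by (rule LIMSEQ_unique[OF _ tendsto_const])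
  qed
  have part: "AE x in lborel. indicator H x * h (v x $ p) = 0" if h: "bounded_linear h" for h :: "complex \<Rightarrow> real"
  proof (rule AE_zero_of_box_integrals)
    have [measurable]: "h \<in> borel_measurable borel"
      by (intro borel_measurable_continuous_onI linear_continuous_on h)
    show "(\<lambda>x. indicator H x * h (v x $ p)) \<in> borel_measurable borel" by measurable
    fix a b :: "real^'d"
    have i: "integrable lborel (\<lambda>x. indicator (box a b \<inter> H) x * v x $ p)"
      using box_subset_cbox[of a b] by (intro int[of _ a b]) auto
    have eq: "indicator (box a b) x * (indicator H x * h (v x $ p)) = h (indicator (box a b \<inter> H) x * v x $ p)" for x
      using linear_0[OF bounded_linear.linear[OF h]] by (auto simp: indicator_def)
    show "integrable lborel (\<lambda>x. indicator (box a b) x * (indicator H x * h (v x $ p)))"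
      unfolding eq by (rule integrable_bounded_linear[OF h i])
    show "(LINT x|lborel. indicator (box a b) x * (indicator H x * h (v x $ p))) = 0"
      unfolding eq integral_bounded_linear[OF h i] zero2 using linear_0[OF bounded_linear.linear[OF h]] .
  qed
  from part[OF bounded_linear_Re] part[OF bounded_linear_Im] show ?thesis
    by eventually_elim (auto simp: H_def complex_eq_iff)
qed

section \<open>The weak equation tested with products of a function of time and one of space\<close>

lemma test_function_in_L2:
  fixes w :: "real^'d \<Rightarrow> complex"
  assumes "w \<in> test_functions S"
  shows "in_L2 w"
proof -
  have c: "continuous_on UNIV w" "compact (closure {x. w x \<noteq> 0})"
    using assms Ck_imp_continuous[of 0 w] by (auto simp: test_functions_def)
  have "integrable lborel (\<lambda>x. (cmod (w x))\<^sup>2)"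
    by (rule integrable_compact_support[OF _ c(2)])
      (use c(1) closure_subset[of "{x. w x \<noteq> 0}"] in \<open>auto intro!: continuous_intros\<close>)
  then show ?thesis using borel_measurable_continuous_onI[OF c(1)] by (simp add: in_L2_def)
qed

lemma test_functions_mono: "S \<subseteq> T \<Longrightarrow> f \<in> test_functions S \<Longrightarrow> f \<in> test_functions T"
  by (auto simp: test_functions_def)

lemma product_test_function:
  fixes a :: "real \<Rightarrow> complex" and w :: "real^'d \<Rightarrow> complex"
  assumes a: "\<And>k. Ck k a" "\<And>t. t \<notin> {\<alpha>..\<beta>} \<Longrightarrow> a t = 0" and w: "w \<in> test_functions UNIV"
  shows "(\<lambda>p. a (fst p) * w (snd p)) \<in> test_functions (UNIV \<times> UNIV)"
proof -
  let ?\<phi> = "\<lambda>p. a (fst p) * w (snd p)" and ?K = "closure {x. w x \<noteq> 0}"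
  have "Ck k (\<lambda>p::real \<times> (real^'d). a (fst p))" "Ck k (\<lambda>p::real \<times> (real^'d). w (snd p))" for k
    using Ck_compose_affine[OF bounded_linear_fst, of k a 0] Ck_compose_affine[OF bounded_linear_snd, of k w 0]
      a(1) w by (auto simp: test_functions_def)
  then have "Ck k ?\<phi>" for k by (intro Ck_mult)
  moreover have sub: "closure {p. ?\<phi> p \<noteq> 0} \<subseteq> {\<alpha>..\<beta>} \<times> ?K"
  proof (rule closure_minimal)
    show "closed ({\<alpha>..\<beta>} \<times> ?K)" by (intro closed_Times) auto
    show "{p. ?\<phi> p \<noteq> 0} \<subseteq> {\<alpha>..\<beta>} \<times> ?K"
      using a(2) closure_subset[of "{x. w x \<noteq> 0}"] by force
  qed
  moreover have "compact ({\<alpha>..\<beta>} \<times> ?K)"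
    using w by (intro compact_Times) (auto simp: test_functions_def)
  then have "compact (closure {p. ?\<phi> p \<noteq> 0})"
    using compact_Int_closed[of "{\<alpha>..\<beta>} \<times> ?K" "closure {p. ?\<phi> p \<noteq> 0}"] sub by (simp add: Int_absorb1)
  ultimately show ?thesis by (simp add: test_functions_def)
qed

text \<open>The projection of the support to the space variables is compact, so the values at all
  times are dominated by one constant times one indicator.\<close>

lemma test_function_L2_continuous:
  fixes F :: "real \<times> (real^'d) \<Rightarrow> complex^'m"
  assumes F: "F \<in> test_functions S"
  shows "L2_continuous_on UNIV (\<lambda>t x. F (t, x))"
proof -
  let ?K = "closure {p. F p \<noteq> 0}"
  have c: "continuous_on UNIV F" "compact ?K"
    using F Ck_imp_continuous[of 0 F] by (auto simp: test_functions_def)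
  obtain B where B: "\<And>p. norm (F p) \<le> B"
    using compact_support_bounded[OF c] by blast
  have K: "compact (snd ` ?K)"
    by (intro compact_continuous_image c(2) continuous_intros)
  have z: "F (t, x) = 0" if "x \<notin> snd ` ?K" for t x
    using that closure_subset[of "{p. F p \<noteq> 0}"] by force
  have ct: "continuous_on UNIV (\<lambda>x. F (t, x))" for t
    by (intro continuous_on_compose2[OF c(1)] continuous_intros) auto
  have csq: "continuous_on UNIV (\<lambda>x. (norm (F (t, x)))\<^sup>2)" for t
    by (intro continuous_intros ct)
  have L2: "in_L2 (\<lambda>x. F (t, x))" for t
    unfolding in_L2_def
    using integrable_compact_support[OF csq K, of t] z borel_measurable_continuous_onI[OF ct[of t]] by auto
  have "((\<lambda>s. L2_norm (\<lambda>x. F (s, x) - F (t, x))) \<longlongrightarrow> 0) (at t)" for t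
    unfolding tendsto_at_iff_sequentially
  proof (intro allI impI)
    fix X :: "nat \<Rightarrow> real" assume X: "X \<longlonglongrightarrow> t"
    have "(\<lambda>n. LINT x|lborel. (norm (F (X n, x) - F (t, x)))\<^sup>2) \<longlonglongrightarrow> (LINT x::real^'d|lborel. 0)"
    proof (rule integral_dominated_convergence)
      show "integrable lborel (\<lambda>x. indicator (snd ` ?K) x *\<^sub>R (2 * B)\<^sup>2)"
        by (intro borel_integrable_compact K continuous_intros)
      show "AE x in lborel. (\<lambda>n. (norm (F (X n, x) - F (t, x)))\<^sup>2) \<longlonglongrightarrow> 0"
      proof (rule AE_I2)
        fix x
        have "isCont F (t, x)" using c(1) by (simp add: continuous_on_eq_continuous_at)
        moreover have "(\<lambda>n. (X n, x)) \<longlonglongrightarrow> (t, x)" by (intro tendsto_intros X)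
        ultimately have "(\<lambda>n. F (X n, x)) \<longlonglongrightarrow> F (t, x)" by (rule isCont_tendsto_compose)
        then have "(\<lambda>n. (norm (F (X n, x) - F (t, x)))\<^sup>2) \<longlonglongrightarrow> (norm (F (t, x) - F (t, x)))\<^sup>2"
          by (intro tendsto_intros)
        then show "(\<lambda>n. (norm (F (X n, x) - F (t, x)))\<^sup>2) \<longlonglongrightarrow> 0" by simp
      qed
      show "AE x in lborel. norm ((norm (F (X n, x) - F (t, x)))\<^sup>2) \<le> indicator (snd ` ?K) x *\<^sub>R (2 * B)\<^sup>2" for n
      proof (rule AE_I2)
        fix x
        have "norm (F (X n, x) - F (t, x)) \<le> 2 * B"
          using norm_triangle_ineq4[of "F (X n, x)" "F (t, x)"] B[of "(X n, x)"] B[of "(t, x)"] by linarith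
        from power_mono[OF this norm_ge_zero, of 2]
        show "norm ((norm (F (X n, x) - F (t, x)))\<^sup>2) \<le> indicator (snd ` ?K) x *\<^sub>R (2 * B)\<^sup>2"
          using z[of x] by (auto simp: indicator_def)
      qed
      show "(\<lambda>x. (norm (F (X n, x) - F (t, x)))\<^sup>2) \<in> borel_measurable lborel" for n
        using borel_measurable_continuous_onI[OF ct[of t]] borel_measurable_continuous_onI[OF ct[of "X n"]] by measurable
    qed simp
    then have "(\<lambda>n. L2_norm (\<lambda>x. F (X n, x) - F (t, x))) \<longlonglongrightarrow> sqrt 0"
      unfolding L2_norm_def by (intro tendsto_real_sqrt) simp
    then show "((\<lambda>s. L2_norm (\<lambda>x. F (s, x) - F (t, x))) \<circ> X) \<longlonglongrightarrow> 0"
      by (simp add: comp_def)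
  qed
  with L2 show ?thesis by (simp add: L2_continuous_on_def)
qed

definition tpair :: "(real \<Rightarrow> complex) \<Rightarrow> ('a::euclidean_space \<Rightarrow> complex) \<Rightarrow> (real \<Rightarrow> 'a \<Rightarrow> complex^'m) \<Rightarrow> 'm \<Rightarrow> complex" where
  "tpair a w V p = (LINT t|lborel. a t * pairing w V p t)"

lemma tpair_integrable:
  assumes "L2_continuous_on UNIV V" "continuous_on UNIV a" "\<And>t. t \<notin> {\<alpha>..\<beta>} \<Longrightarrow> a t = 0" "in_L2 w"
  shows "integrable lborel (\<lambda>t. a t * pairing w V p t)"
  by (rule integrable_compact_support[of _ "{\<alpha>..\<beta>}"])
    (use assms in \<open>auto intro!: continuous_on_mult pairing_continuous\<close>)

lemma pairing_integrable:
  fixes V :: "real \<Rightarrow> 'a::euclidean_space \<Rightarrow> complex^'m"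
  shows "L2_continuous_on UNIV V \<Longrightarrow> in_L2 w \<Longrightarrow> integrable lborel (\<lambda>x. w x * V t x $ p)"
  by (intro in_L2_product_integrable) (auto simp: L2_continuous_on_def)

lemma coefficient_in_L2:
  fixes w :: "real^'d \<Rightarrow> complex"
  assumes w: "in_L2 w" and \<sigma>: "\<sigma> \<in> borel_measurable borel" "AE s in lborel. \<bar>\<sigma> s\<bar> \<le> C"
  shows "in_L2 (\<lambda>x. of_real (\<sigma> (x $ e)) * w x)"
proof (rule in_L2_dominated[OF w, of _ C])
  have [measurable]: "w \<in> borel_measurable borel" using w by (simp add: in_L2_def)
  have "(\<lambda>x::real^'d. \<sigma> (x $ e)) \<in> borel_measurable borel"
    by (rule measurable_compose[OF _ \<sigma>(1)]) (intro borel_measurable_continuous_onI continuous_intros)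
  then show "(\<lambda>x. of_real (\<sigma> (x $ e)) * w x) \<in> borel_measurable borel" by measurable
  show "AE x in lborel. cmod (of_real (\<sigma> (x $ e)) * w x) \<le> C * cmod (w x)"
    using AE_coord[OF \<sigma>(2), of e] by eventually_elim (simp add: norm_mult mult_right_mono)
qed

lemma double_integral_vec_nth:
  fixes G :: "real \<Rightarrow> 'a::euclidean_space \<Rightarrow> complex^'n"
  assumes "\<And>t i. integrable lborel (\<lambda>x. G t x $ i)" "\<And>t i. (LINT x|lborel. G t x $ i) = g i t"
    "\<And>i. integrable lborel (g i)"
  shows "(LINT t|lborel. LINT x|lborel. G t x) $ i = (LINT t|lborel. g i t)"
proof -
  have *: "(LINT x|lborel. G t x) $ i = g i t" for t i
    using integral_vec_nth[OF assms(1)] assms(2) by simp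
  show ?thesis using integral_vec_nth[of lborel "\<lambda>t. LINT x|lborel. G t x" i] assms(3) by (simp add: *)
qed

text \<open>Component \<open>i\<close> of block \<open>l\<close>, tested with \<open>a\<close> times
  \<open>w\<close>. In the double sum \<open>k\<close> runs over the blocks, whose sum is
  differentiated, and \<open>j\<close> over the components. The integrability facts allow linearity
  in both integrations.\<close>

lemma weak_form:
  fixes A :: "'d::finite \<Rightarrow> complex^'n::finite^'n" and U :: "real \<Rightarrow> real^'d \<Rightarrow> complex^('d \<times> 'n)"
  assumes U: "L2_continuous_on UNIV U" and eq: "split_equation UNIV e A \<sigma> U F"
    and F: "L2_continuous_on UNIV (\<lambda>t x. F (t, x))"
    and \<sigma>: "\<sigma> \<in> borel_measurable borel" "AE s in lborel. \<bar>\<sigma> s\<bar> \<le> C"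
    and a: "\<And>k. Ck k a" "\<And>t. t \<notin> {\<alpha>..\<beta>} \<Longrightarrow> a t = 0"
    and a': "\<And>t. (a has_vector_derivative a' t) (at t)" "continuous_on UNIV a'" "\<And>t. t \<notin> {\<alpha>..\<beta>} \<Longrightarrow> a' t = 0"
    and w: "w \<in> test_functions UNIV"
  shows "- tpair a' w U (l, i) - (\<Sum>j\<in>UNIV. \<Sum>k\<in>UNIV. A l $ i $ j * tpair a (pd l w) U (k, j))
      + (if l = e then tpair a (\<lambda>x. of_real (\<sigma> (x $ e)) * w x) U (l, i) else 0)
    = tpair a w (\<lambda>t x. F (t, x)) (l, i)"
proof -
  define \<phi> where "\<phi> = (\<lambda>p. a (fst p) * w (snd p))"
  have \<phi>: "\<phi> \<in> test_functions (UNIV \<times> UNIV)"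
    unfolding \<phi>_def by (rule product_test_function[OF a w])
  have ca: "continuous_on UNIV a" using a(1)[of 0] by simp
  have L2: "in_L2 w" "in_L2 (pd l w)" "in_L2 (\<lambda>x. of_real (\<sigma> (x $ e)) * w x)"
    using test_function_in_L2[OF w] test_function_in_L2[OF test_function_pd[OF w]] coefficient_in_L2[OF _ \<sigma>]
    by blast+
  have wd: "w differentiable (at x)" for x
    using w Ck.simps(2)[of 0 w] by (auto simp: test_functions_def)
  have der: "(\<phi> has_derivative (\<lambda>h. a t * (\<Sum>l\<in>UNIV. snd h $ l *\<^sub>R pd l w x) + (fst h *\<^sub>R a' t) * w x)) (at (t, x))" for t x
  proof -
    have 1: "((\<lambda>p. a (fst p)) has_derivative (\<lambda>h. fst h *\<^sub>R a' t)) (at (t, x))"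
      by (rule has_derivative_compose[of fst fst "(t, x)" UNIV a, OF bounded_linear_imp_has_derivative[OF bounded_linear_fst]])
        (use a'(1)[of t] in \<open>simp add: has_vector_derivative_def\<close>)
    have 2: "((\<lambda>p. w (snd p)) has_derivative (\<lambda>h. \<Sum>l\<in>UNIV. snd h $ l *\<^sub>R pd l w x)) (at (t, x))"
      by (rule has_derivative_compose[of snd snd "(t, x)" UNIV w, OF bounded_linear_imp_has_derivative[OF bounded_linear_snd]])
        (use has_derivative_pd[OF wd[of x]] in simp)
    show ?thesis using has_derivative_mult[OF 1 2] by (simp add: \<phi>_def)
  qed
  have fd: "frechet_derivative \<phi> (at (t, x)) = (\<lambda>h. a t * (\<Sum>l\<in>UNIV. snd h $ l *\<^sub>R pd l w x) + (fst h *\<^sub>R a' t) * w x)" for t x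
    using frechet_derivative_at[OF der] by simp
  have pt: "frechet_derivative \<phi> (at (t, x)) (1, 0) = a' t * w x" for t x
    by (simp add: fd)
  have px: "frechet_derivative \<phi> (at (t, x)) (0, axis l 1) = a t * pd l w x" for t x
    by (simp add: fd axis_def if_distrib[of "\<lambda>c. c *\<^sub>R _"] cong: if_cong)
  define G where "G t x = - (frechet_derivative \<phi> (at (t, x)) (1, 0) *s split_part (U t x) l)
        - frechet_derivative \<phi> (at (t, x)) (0, axis l 1) *s (A l *v (\<Sum>j\<in>UNIV. split_part (U t x) j))
        + (if l = e then (\<phi> (t, x) * complex_of_real (\<sigma> (x $ e))) *s split_part (U t x) l else 0)" for t x
  define g where "g i t = - a' t * pairing w U (l, i) t
      - (\<Sum>j\<in>UNIV. \<Sum>k\<in>UNIV. A l $ i $ j * (a t * pairing (pd l w) U (k, j) t))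
      + (if l = e then a t * pairing (\<lambda>x. of_real (\<sigma> (x $ e)) * w x) U (l, i) t else 0)" for i t
  have G_nth: "G t x $ i = - a' t * (w x * U t x $ (l, i))
      - (\<Sum>j\<in>UNIV. \<Sum>k\<in>UNIV. A l $ i $ j * (a t * (pd l w x * U t x $ (k, j))))
      + (if l = e then a t * ((of_real (\<sigma> (x $ e)) * w x) * U t x $ (l, i)) else 0)" for t x i
    unfolding G_def pt px
    by (simp add: \<phi>_def split_part_def matrix_vector_mult_def sum_distrib_left mult_ac)
  note pint = pairing_integrable[OF U L2(1)] pairing_integrable[OF U L2(2)] pairing_integrable[OF U L2(3)]
  have Gint: "integrable lborel (\<lambda>x. G t x $ i)" for t i
    unfolding G_nth
    by (cases "l = e")
      (use pint in \<open>auto intro!: Bochner_Integration.integrable_add Bochner_Integration.integrable_diff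
        Bochner_Integration.integrable_sum integrable_mult_right simp del: integrable_mult_left_iff integrable_mult_right_iff\<close>)
  have Gg: "(LINT x|lborel. G t x $ i) = g i t" for t i
    unfolding G_nth g_def pairing_def
    by (cases "l = e")
      (use pint in \<open>simp_all add: Bochner_Integration.integrable_sum\<close>)
  have gint: "integrable lborel (g i)" for i
    unfolding g_def
    using tpair_integrable[OF U ca a(2) L2(2)] tpair_integrable[OF U ca a(2) L2(3)] tpair_integrable[OF U a'(2,3) L2(1)]
    by (cases "l = e")
      (auto intro!: Bochner_Integration.integrable_add Bochner_Integration.integrable_diff
        Bochner_Integration.integrable_sum integrable_mult_right simp del: integrable_mult_left_iff integrable_mult_right_iff)
  have L: "split_pairing e A \<sigma> U \<phi> l $ i = (LINT t|lborel. g i t)"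
    unfolding split_pairing_def G_def[symmetric] by (rule double_integral_vec_nth[OF Gint Gg gint])
  have R: "(LINT t|lborel. LINT x|lborel. \<phi> (t, x) *s split_part (F (t, x)) l) $ i = tpair a w (\<lambda>t x. F (t, x)) (l, i)"
    unfolding tpair_def
  proof (rule double_integral_vec_nth)
    show "integrable lborel (\<lambda>x. (\<phi> (t, x) *s split_part (F (t, x)) l) $ i)" for t i
      using pairing_integrable[OF F L2(1), of t "(l, i)"] by (simp add: \<phi>_def split_part_def mult.assoc)
    show "(LINT x|lborel. (\<phi> (t, x) *s split_part (F (t, x)) l) $ i) = a t * pairing w (\<lambda>t x. F (t, x)) (l, i) t" for t i
      by (simp add: \<phi>_def split_part_def mult.assoc pairing_def)
    show "integrable lborel (\<lambda>t. a t * pairing w (\<lambda>t x. F (t, x)) (l, i) t)" for i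
      by (rule tpair_integrable[OF F ca a(2) L2(1)])
  qed
  have "split_pairing e A \<sigma> U \<phi> l = (LINT t|lborel. LINT x|lborel. \<phi> (t, x) *s split_part (F (t, x)) l)"
    using eq \<phi> unfolding split_equation_def by blast
  then have "(LINT t|lborel. g i t) = tpair a w (\<lambda>t x. F (t, x)) (l, i)"
    using L R by simp
  moreover have "(LINT t|lborel. g i t) = - tpair a' w U (l, i) - (\<Sum>j\<in>UNIV. \<Sum>k\<in>UNIV. A l $ i $ j * tpair a (pd l w) U (k, j))
      + (if l = e then tpair a (\<lambda>x. of_real (\<sigma> (x $ e)) * w x) U (l, i) else 0)"
    unfolding g_def tpair_def
    using tpair_integrable[OF U ca a(2) L2(2)] tpair_integrable[OF U ca a(2) L2(3)] tpair_integrable[OF U a'(2,3) L2(1)]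
    by (cases "l = e") (simp_all add: Bochner_Integration.integrable_sum)
  ultimately show ?thesis by simp
qed

text \<open>Extends the weak equation to weights that need not be differentiable: \<open>v'\<close>
  takes the place of the derivative of \<open>w'\<close> along \<open>l\<close>. Derivatives along
  other directions do not enter block \<open>l\<close>, so only this one has to converge.\<close>

lemma weak_form_limit:
  fixes A :: "'d::finite \<Rightarrow> complex^'n::finite^'n" and U :: "real \<Rightarrow> real^'d \<Rightarrow> complex^('d \<times> 'n)"
  assumes U: "L2_continuous_on UNIV U" and eq: "split_equation UNIV e A \<sigma> U F"
    and F: "L2_continuous_on UNIV (\<lambda>t x. F (t, x))"
    and \<sigma>: "\<sigma> \<in> borel_measurable borel" "AE s in lborel. \<bar>\<sigma> s\<bar> \<le> C"
    and a: "\<And>k. Ck k a" "\<And>t. t \<notin> {\<alpha>..\<beta>} \<Longrightarrow> a t = 0"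
    and a': "\<And>t. (a has_vector_derivative a' t) (at t)" "continuous_on UNIV a'" "\<And>t. t \<notin> {\<alpha>..\<beta>} \<Longrightarrow> a' t = 0"
    and w: "\<And>n. w n \<in> test_functions UNIV" and w': "w' \<in> borel_measurable borel" and v': "v' \<in> borel_measurable borel"
    and D: "in_L2 D" "\<And>n x. cmod (w n x) \<le> D x" "\<And>n x. cmod (pd l (w n) x) \<le> D x"
    and lim: "AE x in lborel. (\<lambda>n. w n x) \<longlonglongrightarrow> w' x" "AE x in lborel. (\<lambda>n. pd l (w n) x) \<longlonglongrightarrow> v' x"
  shows "- tpair a' w' U (l, i) - (\<Sum>j\<in>UNIV. \<Sum>k\<in>UNIV. A l $ i $ j * tpair a v' U (k, j))
      + (if l = e then tpair a (\<lambda>x. of_real (\<sigma> (x $ e)) * w' x) U (l, i) else 0)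
    = tpair a w' (\<lambda>t x. F (t, x)) (l, i)"
proof -
  have ca: "continuous_on UNIV a" using a(1)[of 0] by simp
  have wm: "w n \<in> borel_measurable borel" "pd l (w n) \<in> borel_measurable borel" for n
    using test_function_in_L2[OF w] test_function_in_L2[OF test_function_pd[OF w]] by (auto simp: in_L2_def)
  have [measurable]: "(\<lambda>x::real^'d. \<sigma> (x $ e)) \<in> borel_measurable borel"
    by (rule measurable_compose[OF _ \<sigma>(1)]) (intro borel_measurable_continuous_onI continuous_intros)
  note [measurable] = wm w'
  have CD: "in_L2 (\<lambda>x. C * D x)"
    using D(1) by (intro in_L2_dominated[OF D(1), of _ "\<bar>C\<bar>"]) (auto simp: in_L2_def abs_mult)
  have lw: "(\<lambda>n. tpair b (w n) V p) \<longlonglongrightarrow> tpair b w' V p"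
    if "L2_continuous_on UNIV V" "continuous_on UNIV b" "\<And>t. t \<notin> {\<alpha>..\<beta>} \<Longrightarrow> b t = 0"
    for b V and p :: "'d \<times> 'n"
    unfolding tpair_def
    by (rule pairing_limit(2)[OF that wm(1) w' D(1) _ lim(1)]) (auto simp: D(2))
  have lv: "(\<lambda>n. tpair a (pd l (w n)) U p) \<longlonglongrightarrow> tpair a v' U p" for p
    unfolding tpair_def
    by (rule pairing_limit(2)[OF U ca a(2) wm(2) v' D(1) _ lim(2)]) (auto simp: D(3))
  have ls: "(\<lambda>n. tpair a (\<lambda>x. of_real (\<sigma> (x $ e)) * w n x) U p) \<longlonglongrightarrow> tpair a (\<lambda>x. of_real (\<sigma> (x $ e)) * w' x) U p" for p
    unfolding tpair_def
  proof (rule pairing_limit(2)[OF U ca a(2) _ _ CD])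
    show "AE x in lborel. cmod (of_real (\<sigma> (x $ e)) * w n x) \<le> C * D x" for n
      using AE_coord[OF \<sigma>(2), of e]
      by eventually_elim (auto simp: norm_mult intro!: mult_mono D(2) order_trans[OF norm_ge_zero D(2)])
    show "AE x in lborel. (\<lambda>n. of_real (\<sigma> (x $ e)) * w n x) \<longlonglongrightarrow> of_real (\<sigma> (x $ e)) * w' x"
      using lim(1) by eventually_elim (intro tendsto_intros)
  qed (measurable, measurable)
  have "(\<lambda>n. - tpair a' (w n) U (l, i) - (\<Sum>j\<in>UNIV. \<Sum>k\<in>UNIV. A l $ i $ j * tpair a (pd l (w n)) U (k, j))
      + (if l = e then tpair a (\<lambda>x. of_real (\<sigma> (x $ e)) * w n x) U (l, i) else 0))
    \<longlonglongrightarrow> - tpair a' w' U (l, i) - (\<Sum>j\<in>UNIV. \<Sum>k\<in>UNIV. A l $ i $ j * tpair a v' U (k, j))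
      + (if l = e then tpair a (\<lambda>x. of_real (\<sigma> (x $ e)) * w' x) U (l, i) else 0)"
    by (cases "l = e") (use lw[OF U a'(2,3)] lv ls in \<open>auto intro!: tendsto_intros\<close>)
  moreover have "(\<lambda>n. tpair a (w n) (\<lambda>t x. F (t, x)) (l, i)) \<longlonglongrightarrow> tpair a w' (\<lambda>t x. F (t, x)) (l, i)"
    by (rule lw[OF F ca a(2)])
  moreover have "- tpair a' (w n) U (l, i) - (\<Sum>j\<in>UNIV. \<Sum>k\<in>UNIV. A l $ i $ j * tpair a (pd l (w n)) U (k, j))
      + (if l = e then tpair a (\<lambda>x. of_real (\<sigma> (x $ e)) * w n x) U (l, i) else 0)
    = tpair a (w n) (\<lambda>t x. F (t, x)) (l, i)" for n
    by (rule weak_form[OF U eq F \<sigma> a a' w])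
  ultimately show ?thesis
    by (simp only: LIMSEQ_unique)
qed

section \<open>The real stretching\<close>

text \<open>The difference of the indicators orients the integral from 0 to \<open>s\<close>,
  whatever the sign of \<open>s\<close>.\<close>

definition primitive :: "(real \<Rightarrow> real) \<Rightarrow> real \<Rightarrow> real" where
  "primitive \<sigma> s = (LINT u|lborel. (indicator {0..s} u - indicator {s..0} u) * \<sigma> u)"

lemma poly_primitive:
  fixes p :: "real poly"
  obtains q where "pderiv q = p" "poly q 0 = 0"
proof
  let ?q = "\<Sum>i\<le>degree p. monom (coeff p i / real (Suc i)) (Suc i)"
  have "pderiv ?q = (\<Sum>i\<le>degree p. monom (coeff p i) i)"
  proof -
    have "pderiv (\<Sum>i\<le>n. f i) = (\<Sum>i\<le>n. pderiv (f i))" for f :: "nat \<Rightarrow> real poly" and n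
      by (induction n) (auto simp: pderiv_add)
    then show ?thesis by (simp add: pderiv_monom del: of_nat_Suc)
  qed
  then show "pderiv ?q = p" by (simp add: poly_as_sum_of_monoms)
  show "poly ?q 0 = 0" by (simp add: poly_sum poly_monom)
qed

lemma primitive_poly:
  assumes "pderiv q = p" "poly q 0 = 0"
  shows "primitive (poly p) s = poly q s"
proof -
  have FTC: "(LINT x|lborel. poly p x * indicator {a..b} x) = poly q b - poly q a" if "a \<le> b" for a b
    using that assms(1) by (intro integral_FTC_Icc_real) (auto intro!: derivative_eq_intros)
  consider "s > 0" | "s = 0" | "s < 0" by linarith
  then show ?thesis
  proof cases
    case 1
    then show ?thesis using FTC[of 0 s] assms(2) by (simp add: primitive_def mult.commute)
  next
    case 3
    then show ?thesis using FTC[of s 0] assms(2) by (simp add: primitive_def mult.commute)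
  qed (simp add: primitive_def assms)
qed

lemma poly_primitive_bound:
  fixes p q :: "real poly"
  assumes q: "pderiv q = p" "poly q 0 = 0" and p: "\<And>s. \<bar>s\<bar> \<le> r \<Longrightarrow> \<bar>poly p s\<bar> \<le> K" and s: "\<bar>s\<bar> \<le> r"
  shows "\<bar>poly q s\<bar> \<le> K * \<bar>s\<bar>"
proof -
  consider "s > 0" | "s = 0" | "s < 0" by linarith
  then show ?thesis
  proof cases
    case 1
    then obtain x where "0 < x" "x < s" "poly q s - poly q 0 = (s - 0) * poly p x"
      using poly_MVT[of 0 s q] q by auto
    then show ?thesis using p[of x] s q 1 by (simp add: abs_mult mult.commute)
  next
    case 3
    then obtain x where "s < x" "x < 0" "poly q 0 - poly q s = (0 - s) * poly p x"
      using poly_MVT[of s 0 q] q by auto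
    moreover from this have "poly q s = s * poly p x" using q by simp
    ultimately show ?thesis using p[of x] s 3 by (simp add: abs_mult mult.commute)
  qed (use q in simp)
qed

lemma primitive_limit:
  assumes \<sigma>: "\<sigma> \<in> borel_measurable borel"
    and p: "\<And>m s. \<bar>s\<bar> \<le> real (Suc m) \<Longrightarrow> \<bar>poly (p m) s\<bar> \<le> K" "AE s in lborel. (\<lambda>m. poly (p m) s) \<longlonglongrightarrow> \<sigma> s"
  shows "(\<lambda>m. primitive (poly (p m)) s) \<longlonglongrightarrow> primitive \<sigma> s"
proof -
  note [measurable] = \<sigma>
  \<comment> \<open>The polynomials are bounded only for arguments up to \<open>Suc m\<close>;
    starting the sequence at \<open>M\<close> brings the interval between 0 and \<open>s\<close>
    into this range.\<close>
  obtain M :: nat where M: "\<bar>s\<bar> \<le> real M" using real_arch_simple by blast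
  have [measurable]: "poly (p m) \<in> borel_measurable borel" for m
    by (intro borel_measurable_continuous_onI continuous_intros)
  have "(\<lambda>m. primitive (poly (p (m + M))) s) \<longlonglongrightarrow> primitive \<sigma> s"
    unfolding primitive_def
  proof (rule integral_dominated_convergence)
    show "integrable lborel (\<lambda>u. indicator {- \<bar>s\<bar>..\<bar>s\<bar>} u *\<^sub>R K)"
      by (intro borel_integrable_compact continuous_intros) simp
    show "AE u in lborel. (\<lambda>m. (indicator {0..s} u - indicator {s..0} u) * poly (p (m + M)) u)
        \<longlonglongrightarrow> (indicator {0..s} u - indicator {s..0} u) * \<sigma> u"
      using p(2) by eventually_elim (intro tendsto_intros LIMSEQ_ignore_initial_segment)
    show "AE u in lborel. norm ((indicator {0..s} u - indicator {s..0} u) * poly (p (m + M)) u)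
        \<le> indicator {- \<bar>s\<bar>..\<bar>s\<bar>} u *\<^sub>R K" for m
    proof (rule AE_I2)
      fix u
      show "norm ((indicator {0..s} u - indicator {s..0} u) * poly (p (m + M)) u)
        \<le> indicator {- \<bar>s\<bar>..\<bar>s\<bar>} u *\<^sub>R K"
      proof (cases "u \<in> {- \<bar>s\<bar>..\<bar>s\<bar>}")
        case True
        then have "\<bar>poly (p (m + M)) u\<bar> \<le> K"
          using M by (intro p(1)) auto
        with True show ?thesis by (auto simp: indicator_def)
      qed (auto simp: indicator_def)
    qed
  qed measurable
  then show ?thesis by (rule LIMSEQ_offset)
qed

text \<open>The polynomials approximate the primitive, and their derivatives approximate \<sigma>,
  so that one sequence serves both for the displacement and for the factor.\<close>

lemma coefficient_approximation:
  assumes \<sigma>: "\<sigma> \<in> borel_measurable borel" "AE s in lborel. \<bar>\<sigma> s\<bar> \<le> C" "C \<ge> 0"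
  obtains q :: "nat \<Rightarrow> real poly" where
    "\<And>m s. \<bar>s\<bar> \<le> real (Suc m) \<Longrightarrow> \<bar>poly (pderiv (q m)) s\<bar> \<le> C + 1"
    "\<And>m s. \<bar>s\<bar> \<le> real (Suc m) \<Longrightarrow> \<bar>poly (q m) s\<bar> \<le> (C + 1) * \<bar>s\<bar>"
    "AE s in lborel. (\<lambda>m. poly (pderiv (q m)) s) \<longlonglongrightarrow> \<sigma> s"
    "\<And>s. (\<lambda>m. poly (q m) s) \<longlonglongrightarrow> primitive \<sigma> s"
proof -
  obtain p where p: "\<And>m s. \<bar>s\<bar> \<le> real (Suc m) \<Longrightarrow> \<bar>poly (p m) s\<bar> \<le> C + 1"
    "AE s in lborel. (\<lambda>m. poly (p m) s) \<longlonglongrightarrow> \<sigma> s"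
    using bounded_polynomial_approximation[OF \<sigma>] by blast
  have "\<exists>q. pderiv q = p m \<and> poly q 0 = 0" for m
    using poly_primitive by metis
  then obtain q where q: "\<And>m. pderiv (q m) = p m" "\<And>m. poly (q m) 0 = 0" by metis
  show ?thesis
  proof (rule that)
    show "\<bar>poly (q m) s\<bar> \<le> (C + 1) * \<bar>s\<bar>" if "\<bar>s\<bar> \<le> real (Suc m)" for m s
      by (rule poly_primitive_bound[OF q p(1) that])
    show "(\<lambda>m. poly (q m) s) \<longlonglongrightarrow> primitive \<sigma> s" for s
      using primitive_limit[OF \<sigma>(1) p] unfolding primitive_poly[OF q] .
  qed (use p in \<open>auto simp: q(1)\<close>)
qed

lemma primitive_eq_0:
  assumes "AE s in lborel. s < 0 \<longrightarrow> \<sigma> s = 0" "s \<le> 0"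
  shows "primitive \<sigma> s = 0"
  unfolding primitive_def
proof (rule integral_eq_zero_AE)
  show "AE u in lborel. (indicator {0..s} u - indicator {s..0} u) * \<sigma> u = 0"
    using assms(1) AE_lborel_singleton[of 0] by eventually_elim (use assms(2) in \<open>auto simp: indicator_def\<close>)
qed

lemma primitive_bound_measurable:
  assumes \<sigma>: "\<sigma> \<in> borel_measurable borel" "AE s in lborel. \<bar>\<sigma> s\<bar> \<le> C" "C \<ge> 0"
  shows "\<bar>primitive \<sigma> s\<bar> \<le> (C + 1) * \<bar>s\<bar>" "primitive \<sigma> \<in> borel_measurable borel"
proof -
  obtain q :: "nat \<Rightarrow> real poly" where
    q: "\<And>m s. \<bar>s\<bar> \<le> real (Suc m) \<Longrightarrow> \<bar>poly (q m) s\<bar> \<le> (C + 1) * \<bar>s\<bar>" "\<And>s. (\<lambda>m. poly (q m) s) \<longlonglongrightarrow> primitive \<sigma> s"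
    using coefficient_approximation[OF \<sigma>] by metis
  obtain M :: nat where M: "\<bar>s\<bar> \<le> real M" using real_arch_simple by blast
  show "\<bar>primitive \<sigma> s\<bar> \<le> (C + 1) * \<bar>s\<bar>"
    by (rule LIMSEQ_le_const2[OF tendsto_rabs[OF q(2)]])
      (use M in \<open>auto intro!: exI[of _ M] q(1)\<close>)
  show "primitive \<sigma> \<in> borel_measurable borel"
    by (rule borel_measurable_LIMSEQ_real[OF q(2)])
      (intro borel_measurable_continuous_onI continuous_intros)
qed

text \<open>The parameter \<open>S\<close> is the displacement of coordinate \<open>e\<close>, not
  its new value; the map of the layer is obtained from
  \<open>primitive \<sigma> s / \<tau>\<close>.\<close>

definition stretch :: "'d \<Rightarrow> (real \<Rightarrow> real) \<Rightarrow> real^'d \<Rightarrow> real^'d" where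
  "stretch e S x = x + S (x $ e) *\<^sub>R axis e 1"

text \<open>A displacement of at most half the coordinate keeps the weights comparable, so rapid
  decrease survives the composition with the stretching.\<close>

lemma l1_weight_stretch:
  assumes "\<bar>S (x $ e)\<bar> \<le> \<bar>x $ e\<bar> / 2"
  shows "l1_weight x \<le> 2 * l1_weight (stretch e S x)"
proof -
  have "\<bar>x $ l\<bar> \<le> \<bar>stretch e S x $ l\<bar> + (if l = e then \<bar>S (x $ e)\<bar> else 0)" for l
    by (auto simp: stretch_def axis_def)
  then have "(\<Sum>l\<in>UNIV. \<bar>x $ l\<bar>) \<le> (\<Sum>l\<in>UNIV. \<bar>stretch e S x $ l\<bar> + (if l = e then \<bar>S (x $ e)\<bar> else 0))"
    by (intro sum_mono)
  then have "l1_weight x \<le> l1_weight (stretch e S x) + \<bar>S (x $ e)\<bar>"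
    by (simp add: l1_weight_def sum.distrib)
  then show ?thesis using assms nth_le_l1_weight[of x e] by linarith
qed

lemma stretch_comp_has_derivative:
  fixes f :: "real^'d \<Rightarrow> complex"
  assumes "(S has_real_derivative S') (at (x $ e))" "f differentiable (at (stretch e S x))"
  shows "((\<lambda>x. f (stretch e S x)) has_derivative
    (\<lambda>v. \<Sum>l\<in>UNIV. v $ l *\<^sub>R (of_real (if l = e then 1 + S' else 1) * pd l f (stretch e S x)))) (at x)"
proof -
  have "((\<lambda>x::real^'d. S (x $ e)) has_derivative (\<lambda>v. v $ e * S')) (at x)"
    by (rule has_derivative_compose[OF bounded_linear_imp_has_derivative[OF bounded_linear_vec_nth]])
      (use assms(1) in \<open>simp add: has_field_derivative_def mult.commute[of _ S'] cong: if_cong\<close>)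
  then have "(stretch e S has_derivative (\<lambda>v. v + (v $ e * S') *\<^sub>R axis e 1)) (at x)"
    unfolding stretch_def[abs_def] by (auto intro!: derivative_eq_intros)
  from has_derivative_compose[OF this has_derivative_pd[OF assms(2)]]
  show ?thesis
  proof (rule has_derivative_eq_rhs, intro ext sum.cong refl)
    fix v l
    have "(v + (v $ e * S') *\<^sub>R axis e 1) $ l = v $ l * (if l = e then 1 + S' else 1)"
      by (simp add: axis_def algebra_simps)
    then show "(v + (v $ e * S') *\<^sub>R axis e 1) $ l *\<^sub>R pd l f (stretch e S x) =
        v $ l *\<^sub>R (of_real (if l = e then 1 + S' else 1) * pd l f (stretch e S x))"
      by (simp only: scaleR_conv_of_real of_real_mult mult.assoc)
  qed
qed

lemma Ck_poly: "Ck k (poly (p :: real poly))"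
proof (induction k arbitrary: p)
  case (Suc k)
  show ?case
    by (rule Ck_real_SucI[OF poly_DERIV[where 'a = real, unfolded has_real_derivative_iff_has_vector_derivative] Suc])
qed (auto intro!: continuous_intros)

lemma Ck_poly_coord: "Ck k (\<lambda>x::real^'d. poly p (x $ e))"
  using Ck_compose_affine[OF bounded_linear_vec_nth[of e] Ck_poly[of k p], of 0] by simp

text \<open>Each derivative is a smooth coefficient times the composition of a derivative of
  \<open>f\<close>, so the induction runs over all Schwartz functions at once.\<close>

lemma Ck_stretch_comp:
  fixes f :: "real^'d \<Rightarrow> complex"
  assumes "schwartz (\<lambda>n::nat. f)"
  shows "Ck k (\<lambda>x. f (stretch e (poly r) x))"
  using assms
proof (induction k arbitrary: f)
  case 0
  have "continuous_on UNIV (stretch e (poly r))"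
    unfolding stretch_def by (intro continuous_intros)
  then show ?case
    using continuous_on_compose2[OF schwartz_continuous[OF 0]] by auto
next
  case (Suc k)
  show ?case
  proof (rule Ck_SucI[OF stretch_comp_has_derivative[OF poly_DERIV schwartz_differentiable[OF Suc.prems]]])
    fix b :: "real^'d" assume "b \<in> Basis"
    then obtain j where b: "b = axis j 1" by (rule Basis_cart_cases)
    have *: "(\<Sum>l\<in>UNIV. b $ l *\<^sub>R (of_real (if l = e then 1 + poly (pderiv r) (x $ e) else 1) * pd l f (stretch e (poly r) x)))
      = of_real (if j = e then 1 + poly (pderiv r) (x $ e) else 1) * pd j f (stretch e (poly r) x)" for x
      by (simp add: b axis_def if_distrib[of "\<lambda>c. c *\<^sub>R _"] cong: if_cong)
    have c: "Ck k (\<lambda>x::real^'d. complex_of_real (if j = e then 1 + poly (pderiv r) (x $ e) else 1))"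
      by (cases "j = e") (auto intro!: Ck_add Ck_of_real_comp Ck_poly_coord simp del: of_real_add)
    show "Ck k (\<lambda>x. \<Sum>l\<in>UNIV. b $ l *\<^sub>R (of_real (if l = e then 1 + poly (pderiv r) (x $ e) else 1) * pd l f (stretch e (poly r) x)))"
      unfolding * by (intro Ck_mult c Suc.IH schwartz_pd[OF Suc.prems])
  qed
qed

lemma pd_mult:
  fixes f g :: "real^'d \<Rightarrow> complex"
  assumes "f differentiable (at x)" "g differentiable (at x)"
  shows "pd l (\<lambda>x. f x * g x) x = f x * pd l g x + pd l f x * g x"
  using pd_eqI[OF has_derivative_mult[OF has_derivative_pd[OF assms(1)] has_derivative_pd[OF assms(2)]], of l]
  by (simp add: axis_def if_distrib[of "\<lambda>c. c *\<^sub>R _"] cong: if_cong)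

lemma Ck_differentiable: "Ck (Suc k) f \<Longrightarrow> f differentiable (at x)"
  by simp

text \<open>Normalized at the origin only. This suffices, because the cut-off is used at
  \<open>x / Suc m\<close>, which tends to 0.\<close>

definition cutoff :: "real^'d \<Rightarrow> complex" where
  "cutoff x = box_bump 1 (\<chi> i. -1) (\<chi> i. 1) x / box_bump 1 (\<chi> i. -1) (\<chi> i. 1) (0 :: real^'d)"

lemma cutoff_0: "cutoff 0 = 1"
  using box_bump_neq_0[of 1 "\<chi> i. -1" "\<chi> i. 1" 0] by (simp add: cutoff_def)

lemma Ck_cutoff: "Ck k (cutoff :: real^'d \<Rightarrow> complex)"
proof -
  have "bounded_linear (\<lambda>z. z / box_bump 1 (\<chi> i. -1) (\<chi> i. 1) (0 :: real^'d))"
    by (rule bounded_linear_divide)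
  from Ck_bounded_linear_compose[OF this Ck_box_bump] show ?thesis
    unfolding cutoff_def[abs_def] .
qed

lemma cutoff_eq_0: "\<bar>x $ l\<bar> > 1 \<Longrightarrow> cutoff x = 0"
proof -
  assume "\<bar>x $ l\<bar> > 1"
  then have "\<not> (- 1 < x $ l \<and> x $ l < 1)" by auto
  then have "box_bump 1 (\<chi> i. -1) (\<chi> i. 1) x = 0"
    using box_bump_neq_0[of 1 "\<chi> i. -1" "\<chi> i. 1" x] by auto
  then show ?thesis by (simp add: cutoff_def)
qed

lemma cutoff_test_function: "(cutoff :: real^'d \<Rightarrow> complex) \<in> test_functions UNIV"
proof -
  have "{x::real^'d. cutoff x \<noteq> 0} \<subseteq> cbox (\<chi> i. -1) (\<chi> i. 1)"
  proof
    fix x :: "real^'d" assume x: "x \<in> {x. cutoff x \<noteq> 0}"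
    have "\<bar>x $ i\<bar> \<le> 1" for i
      using x cutoff_eq_0[of x i] by force
    then show "x \<in> cbox (\<chi> i. -1) (\<chi> i. 1)"
      by (simp add: mem_box_cart abs_le_iff minus_le_iff)
  qed
  then have "closure {x::real^'d. cutoff x \<noteq> 0} \<subseteq> cbox (\<chi> i. -1) (\<chi> i. 1)"
    by (rule closure_minimal) (rule closed_cbox)
  then have "compact (closure {x::real^'d. cutoff x \<noteq> 0})"
    by (meson bounded_cbox bounded_subset closed_closure compact_eq_bounded_closed)
  then show ?thesis by (simp add: test_functions_def Ck_cutoff)
qed

lemma cutoff_bounds:
  obtains B where "\<And>x::real^'d. cmod (cutoff x) \<le> B" "\<And>l (x::real^'d). cmod (pd l cutoff x) \<le> B" "B \<ge> 0"
proof -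
  obtain B0 where B0: "\<And>x::real^'d. cmod (cutoff x) \<le> B0"
    using compact_support_bounded[OF Ck_imp_continuous[OF Ck_cutoff[of 0]]] cutoff_test_function
    by (auto simp: test_functions_def)
  have "\<exists>B. \<forall>x::real^'d. cmod (pd l cutoff x) \<le> B" for l
    using test_function_pd[OF cutoff_test_function, of l] Ck_imp_continuous[of 0 "pd l cutoff"]
    by (intro compact_support_bounded) (auto simp: test_functions_def)
  then obtain B1 where B1: "\<And>l (x::real^'d). cmod (pd l cutoff x) \<le> B1 l" by metis
  have B0': "0 \<le> B0" using order_trans[OF norm_ge_zero B0] .
  have B1': "0 \<le> B1 l" for l using order_trans[OF norm_ge_zero B1] .
  show ?thesis
  proof (rule that[of "B0 + (\<Sum>l\<in>UNIV. B1 l)"])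
    show "cmod (cutoff x) \<le> B0 + (\<Sum>l\<in>UNIV. B1 l)" for x :: "real^'d"
      using B0[of x] sum_nonneg[of UNIV B1] B1' by simp
    show "cmod (pd l cutoff x) \<le> B0 + (\<Sum>l\<in>UNIV. B1 l)" for l and x :: "real^'d"
    proof -
      have "B1 l \<le> (\<Sum>l\<in>UNIV. B1 l)" using B1' by (intro member_le_sum) auto
      then show ?thesis using B1[of l x] B0' by linarith
    qed
    show "0 \<le> B0 + (\<Sum>l\<in>UNIV. B1 l)" using B0' sum_nonneg[of UNIV B1] B1' by simp
  qed
qed

text \<open>Replace \<open>\<sigma>\<close> by polynomials that converge to it almost everywhere, and cut off in \<open>x\<close>.\<close>

lemma stretched_approximation:
  fixes \<psi> :: "real^'d \<Rightarrow> complex" and \<sigma> :: "real \<Rightarrow> real" and C \<tau> K B :: real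
  assumes \<sigma>: "\<sigma> \<in> borel_measurable borel" "AE s in lborel. \<bar>\<sigma> s\<bar> \<le> C" "C \<ge> 0" and \<tau>: "\<tau> \<ge> 2 * (C + 1)"
    and \<psi>: "schwartz (\<lambda>n::nat. \<psi>)" "K \<ge> 0" "\<And>x. cmod (\<psi> x) \<le> K * inverse (l1_weight x ^ q)" "\<And>x. cmod (pd l \<psi> x) \<le> K * inverse (l1_weight x ^ q)"
    and B: "\<And>x::real^'d. cmod (cutoff x) \<le> B" "\<And>l (x::real^'d). cmod (pd l cutoff x) \<le> B" "B \<ge> 0"
  obtains w where "\<And>m. w m \<in> test_functions UNIV"
    "\<And>m x. cmod (w m x) \<le> 4 * B * K * 2 ^ q * inverse (l1_weight x ^ q)"
    "\<And>m x. cmod (pd l (w m) x) \<le> 4 * B * K * 2 ^ q * inverse (l1_weight x ^ q)"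
    "AE x in lborel. (\<lambda>m. w m x) \<longlonglongrightarrow> of_real (if l = e then 1 else 1 + \<sigma> (x $ e) / \<tau>) * \<psi> (stretch e (\<lambda>s. primitive \<sigma> s / \<tau>) x)"
    "AE x in lborel. (\<lambda>m. pd l (w m) x) \<longlonglongrightarrow> of_real (1 + \<sigma> (x $ e) / \<tau>) * pd l \<psi> (stretch e (\<lambda>s. primitive \<sigma> s / \<tau>) x)"
proof -
  have \<tau>0: "\<tau> > 0"
    by (rule less_le_trans[OF _ \<tau>]) (use \<sigma>(3) in auto)
  obtain Q :: "nat \<Rightarrow> real poly" where
    Q: "\<And>m s. \<bar>s\<bar> \<le> real (Suc m) \<Longrightarrow> \<bar>poly (pderiv (Q m)) s\<bar> \<le> C + 1"
    "\<And>m s. \<bar>s\<bar> \<le> real (Suc m) \<Longrightarrow> \<bar>poly (Q m) s\<bar> \<le> (C + 1) * \<bar>s\<bar>"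
    "AE s in lborel. (\<lambda>m. poly (pderiv (Q m)) s) \<longlonglongrightarrow> \<sigma> s"
    "\<And>s. (\<lambda>m. poly (Q m) s) \<longlonglongrightarrow> primitive \<sigma> s"
    using coefficient_approximation[OF \<sigma>] by blast
  define r where "r m = smult (1 / \<tau>) (Q m)" for m
  have r: "poly (r m) s = poly (Q m) s / \<tau>" "poly (pderiv (r m)) s = poly (pderiv (Q m)) s / \<tau>" for m s
    by (simp_all add: r_def pderiv_smult)
  define \<Xi> where "\<Xi> m = stretch e (poly (r m))" for m
  \<comment> \<open>Block \<open>e\<close> gets no factor, since the chain rule will supply it; in
    the other blocks the factor depends on \<open>x_e\<close> alone and passes through the
    derivative along \<open>l\<close>. Hence the uniform formula \<open>pd_g\<close>.\<close>
  define c where "c m x = (if l = e then 1 else 1 + poly (pderiv (r m)) (x $ e))" for m and x :: "real^'d"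
  define b where "b m x = cutoff ((1 / real (Suc m)) *\<^sub>R x)" for m and x :: "real^'d"
  define g where "g m x = of_real (c m x) * \<psi> (\<Xi> m x)" for m x
  define w where "w m x = b m x * g m x" for m x
  have Ck_c: "Ck k (\<lambda>x. complex_of_real (c m x))" for k m
    unfolding c_def by (cases "l = e") (auto intro!: Ck_add Ck_of_real_comp Ck_poly_coord simp del: of_real_add)
  have Ck_f: "Ck k (\<lambda>x. \<psi> (\<Xi> m x))" for k m
    unfolding \<Xi>_def by (rule Ck_stretch_comp[OF \<psi>(1)])
  have Ck_g: "Ck k (g m)" for k m
    unfolding g_def by (intro Ck_mult Ck_c Ck_f)
  have Ck_b: "Ck k (b m)" for k m
    using Ck_compose_affine[OF bounded_linear_scaleR_right Ck_cutoff, of k "1 / real (Suc m)" 0] by (simp add: b_def[abs_def])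
  have pd_b: "pd j (b m) x = (1 / real (Suc m)) *\<^sub>R pd j cutoff ((1 / real (Suc m)) *\<^sub>R x)" for j m x
  proof -
    have "((\<lambda>x. cutoff ((1 / real (Suc m)) *\<^sub>R x)) has_derivative
      (\<lambda>v. \<Sum>l\<in>UNIV. ((1 / real (Suc m)) *\<^sub>R v) $ l *\<^sub>R pd l cutoff ((1 / real (Suc m)) *\<^sub>R x))) (at x)"
      by (rule has_derivative_compose[OF bounded_linear_imp_has_derivative[OF bounded_linear_scaleR_right]
            has_derivative_pd[OF Ck_differentiable[OF Ck_cutoff[of "Suc 0"]]]])
    from pd_eqI[OF this, of j] show ?thesis
      by (simp add: b_def[abs_def] axis_def if_distrib[of "\<lambda>c. c *\<^sub>R _"] if_distrib[of "\<lambda>c. _ * c"] if_distrib[of "\<lambda>c. c / _"] cong: if_cong)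
  qed
  have pd_g: "pd l (g m) x = of_real (1 + poly (pderiv (r m)) (x $ e)) * pd l \<psi> (\<Xi> m x)" for m x
  proof -
    have pd_f: "pd l (\<lambda>x. \<psi> (\<Xi> m x)) x = of_real (if l = e then 1 + poly (pderiv (r m)) (x $ e) else 1) * pd l \<psi> (\<Xi> m x)"
      using pd_eqI[OF stretch_comp_has_derivative[OF poly_DERIV schwartz_differentiable[OF \<psi>(1)]], of l]
      by (simp add: \<Xi>_def axis_def if_distrib[of "\<lambda>c. c *\<^sub>R _"] cong: if_cong)
    show ?thesis
    proof (cases "l = e")
      case True
      then have "g m = (\<lambda>x. \<psi> (\<Xi> m x))" by (auto simp: g_def c_def)
      with pd_f True show ?thesis by simp
    next
      case False
      have "((\<lambda>x::real^'d. poly (pderiv (r m)) (x $ e)) has_derivative (\<lambda>v. v $ e * poly (pderiv (pderiv (r m))) (x $ e))) (at x)"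
        by (rule has_derivative_compose[OF bounded_linear_imp_has_derivative[OF bounded_linear_vec_nth]])
          (use poly_DERIV[of "pderiv (r m)" "x $ e"] in \<open>simp add: has_field_derivative_def mult.commute[of _ "poly _ _"]\<close>)
      then have dc: "((\<lambda>x. complex_of_real (1 + poly (pderiv (r m)) (x $ e))) has_derivative
          (\<lambda>v. complex_of_real (v $ e * poly (pderiv (pderiv (r m))) (x $ e)))) (at x)"
        by (intro bounded_linear.has_derivative[OF bounded_linear_of_real]) (auto intro!: derivative_eq_intros)
      then have "pd l (\<lambda>x. complex_of_real (c m x)) x = 0"
        using pd_eqI[OF dc, of l] False by (simp add: c_def axis_def)
      then show ?thesis
        unfolding g_def using False
        by (subst pd_mult[OF Ck_differentiable[OF Ck_c] Ck_differentiable[OF Ck_f]]) (simp add: pd_f c_def)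
    qed
  qed
  have pd_w: "pd l (w m) x = b m x * pd l (g m) x + pd l (b m) x * g m x" for m x
    unfolding w_def by (rule pd_mult[OF Ck_differentiable[OF Ck_b] Ck_differentiable[OF Ck_g]])
  define E where "E x = K * 2 ^ q * inverse (l1_weight x ^ q)" for x :: "real^'d"
  have E0: "E x \<ge> 0" for x using \<psi>(2) l1_weight_nonneg[of x] by (simp add: E_def)
  have b_bound: "cmod (b m x) \<le> B" "cmod (pd l (b m) x) \<le> B" for m x
  proof -
    show "cmod (b m x) \<le> B" using B(1) by (simp add: b_def)
    have "cmod (pd l (b m) x) \<le> (1 / real (Suc m)) * B"
      unfolding pd_b norm_scaleR using B(2) by (simp add: divide_right_mono)
    also have "\<dots> \<le> 1 * B" by (intro mult_right_mono B(3)) simp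
    finally show "cmod (pd l (b m) x) \<le> B" by simp
  qed
  \<comment> \<open>The bounds on the polynomials hold in this slab, which is where the cut-off
    lives. There \<open>\<tau> \<ge> 2 * (C + 1)\<close> bounds the factor by 2 and the displacement
    by half the coordinate.\<close>
  have g_bound: "cmod (g m x) \<le> 2 * E x" "cmod (pd l (g m) x) \<le> 2 * E x" if x: "\<bar>x $ e\<bar> \<le> real (Suc m)" for m x
  proof -
    have "\<bar>poly (pderiv (r m)) (x $ e)\<bar> \<le> 1"
      using Q(1)[OF x] \<tau> \<tau>0 \<sigma>(3) by (simp add: r abs_divide divide_le_eq)
    then have cb: "\<bar>c m x\<bar> \<le> 2" "\<bar>1 + poly (pderiv (r m)) (x $ e)\<bar> \<le> 2" by (auto simp: c_def)
    have "\<bar>poly (r m) (x $ e)\<bar> \<le> \<bar>x $ e\<bar> / 2"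
    proof -
      have "\<bar>poly (r m) (x $ e)\<bar> \<le> (C + 1) * \<bar>x $ e\<bar> / \<tau>"
        using Q(2)[OF x] \<tau>0 by (simp add: r abs_divide divide_right_mono)
      also have "\<dots> \<le> (\<tau> / 2) * \<bar>x $ e\<bar> / \<tau>"
        using \<tau> \<tau>0 by (intro divide_right_mono mult_right_mono) auto
      finally show ?thesis using \<tau>0 by simp
    qed
    from l1_weight_stretch[of "poly (r m)", OF this]
    have "l1_weight x ^ q \<le> (2 * l1_weight (\<Xi> m x)) ^ q" by (intro power_mono) (auto simp: \<Xi>_def l1_weight_nonneg)
    then have "inverse (l1_weight (\<Xi> m x) ^ q) \<le> 2 ^ q * inverse (l1_weight x ^ q)"
      using l1_weight_pos[of x] l1_weight_pos[of "\<Xi> m x"] by (simp add: power_mult_distrib field_simps)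
    from mult_left_mono[OF this \<psi>(2)]
    have pb: "cmod (\<psi> (\<Xi> m x)) \<le> E x" "cmod (pd l \<psi> (\<Xi> m x)) \<le> E x"
      using \<psi>(3,4)[of "\<Xi> m x"] by (auto simp: E_def mult.assoc)
    show "cmod (g m x) \<le> 2 * E x" "cmod (pd l (g m) x) \<le> 2 * E x"
      unfolding g_def pd_g norm_mult norm_of_real by (auto intro!: mult_mono cb pb)
  qed
  have far: "b m x = 0" "pd l (b m) x = 0" if x: "\<not> \<bar>x $ e\<bar> \<le> real (Suc m)" for m x
  proof -
    have out: "1 < \<bar>((1 / real (Suc m)) *\<^sub>R x) $ e\<bar>"
      using x by (simp add: abs_mult field_simps)
    show "b m x = 0" unfolding b_def by (rule cutoff_eq_0[OF out])
    have "closure {x::real^'d. cutoff x \<noteq> 0} \<subseteq> {x. \<bar>x $ e\<bar> \<le> 1}"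
      using cutoff_eq_0 by (intro closure_minimal closed_Collect_le continuous_intros) (auto simp: not_less[symmetric])
    then have "pd l cutoff ((1 / real (Suc m)) *\<^sub>R x) = 0"
      using out by (intro pd_zero_outside_support) auto
    then show "pd l (b m) x = 0" by (simp add: pd_b)
  qed
  have D0: "0 \<le> 4 * B * K * 2 ^ q * inverse (l1_weight x ^ q)" for x :: "real^'d"
    using B(3) \<psi>(2) l1_weight_nonneg[of x] by (intro mult_nonneg_nonneg) auto
  show ?thesis
  proof (rule that[of w])
    show "w m \<in> test_functions UNIV" for m
    proof -
      have "{x. w m x \<noteq> 0} \<subseteq> cbox (\<chi> i. - real (Suc m)) (\<chi> i. real (Suc m))"
      proof
        fix x assume "x \<in> {x. w m x \<noteq> 0}"
        then have nz: "cutoff ((1 / real (Suc m)) *\<^sub>R x) \<noteq> 0" by (auto simp: w_def b_def)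
        have "\<bar>((1 / real (Suc m)) *\<^sub>R x) $ i\<bar> \<le> 1" for i
          using nz cutoff_eq_0[of "(1 / real (Suc m)) *\<^sub>R x" i] by force
        then have *: "\<bar>x $ i\<bar> \<le> real (Suc m)" for i
          by (simp add: abs_mult field_simps)
        have "- real (Suc m) \<le> x $ i" "x $ i \<le> real (Suc m)" for i
          using *[of i] by linarith+
        then show "x \<in> cbox (\<chi> i. - real (Suc m)) (\<chi> i. real (Suc m))"
          by (simp add: mem_box_cart del: of_nat_Suc)
      qed
      then have "closure {x. w m x \<noteq> 0} \<subseteq> cbox (\<chi> i. - real (Suc m)) (\<chi> i. real (Suc m))"
        by (rule closure_minimal) (rule closed_cbox)
      then have "compact (closure {x. w m x \<noteq> 0})"
        by (meson bounded_cbox bounded_subset closed_closure compact_eq_bounded_closed)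
      moreover have "Ck k (w m)" for k unfolding w_def by (intro Ck_mult Ck_b Ck_g)
      ultimately show ?thesis by (simp add: test_functions_def)
    qed
    show "cmod (w m x) \<le> 4 * B * K * 2 ^ q * inverse (l1_weight x ^ q)" for m x
    proof (cases "\<bar>x $ e\<bar> \<le> real (Suc m)")
      case True
      have "cmod (w m x) \<le> B * (2 * E x)"
        unfolding w_def norm_mult by (intro mult_mono b_bound g_bound[OF True] B(3)) simp
      also have "\<dots> \<le> 4 * (B * E x)" using mult_nonneg_nonneg[OF B(3) E0[of x]] by simp
      finally show ?thesis by (simp add: E_def mult_ac)
    next
      case False
      then have "w m x = 0" using far by (simp add: w_def)
      then show ?thesis using D0[of x] by (simp only: norm_zero)
    qed
    show "cmod (pd l (w m) x) \<le> 4 * B * K * 2 ^ q * inverse (l1_weight x ^ q)" for m x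
    proof (cases "\<bar>x $ e\<bar> \<le> real (Suc m)")
      case True
      have "cmod (pd l (w m) x) \<le> cmod (b m x) * cmod (pd l (g m) x) + cmod (pd l (b m) x) * cmod (g m x)"
        unfolding pd_w norm_mult[symmetric] by (rule norm_triangle_ineq)
      \<comment> \<open>The two terms of the product rule account for the constant 4 in the
        dominating function.\<close>
      also have "\<dots> \<le> B * (2 * E x) + B * (2 * E x)"
        by (intro add_mono mult_mono b_bound g_bound[OF True] B(3)) auto
      finally show ?thesis by (simp add: E_def mult_ac)
    next
      case False
      then have "pd l (w m) x = 0" using far by (simp add: pd_w)
      then show ?thesis using D0[of x] by (simp only: norm_zero)
    qed
    have inv: "(\<lambda>m. 1 / real (Suc m)) \<longlonglongrightarrow> 0"
      using LIMSEQ_inverse_real_of_nat by (simp add: inverse_eq_divide)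
    have b_lim: "(\<lambda>m. b m x) \<longlonglongrightarrow> 1" for x
    proof -
      have "(\<lambda>m. (1 / real (Suc m)) *\<^sub>R x) \<longlonglongrightarrow> 0 *\<^sub>R x" by (intro tendsto_intros inv)
      moreover have "isCont cutoff (0::real^'d)"
        using Ck_imp_continuous[OF Ck_cutoff[where 'd = 'd, of 0]] by (simp add: continuous_on_eq_continuous_at)
      ultimately have "(\<lambda>m. cutoff ((1 / real (Suc m)) *\<^sub>R x)) \<longlonglongrightarrow> cutoff (0 :: real^'d)"
        using isCont_tendsto_compose[of 0 cutoff "\<lambda>m. (1 / real (Suc m)) *\<^sub>R x"] by simp
      then show ?thesis by (simp add: b_def cutoff_0)
    qed
    have pb_lim: "(\<lambda>m. pd l (b m) x) \<longlonglongrightarrow> 0" for x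
    proof (rule Lim_null_comparison)
      show "\<forall>\<^sub>F m in sequentially. norm (pd l (b m) x) \<le> (1 / real (Suc m)) * B"
        unfolding pd_b norm_scaleR using B(2) by (intro always_eventually allI) (simp add: divide_right_mono)
      show "(\<lambda>m. (1 / real (Suc m)) * B) \<longlonglongrightarrow> 0"
        using tendsto_mult_right[OF inv, of B] by simp
    qed
    have \<Xi>_lim: "(\<lambda>m. \<Xi> m x) \<longlonglongrightarrow> stretch e (\<lambda>s. primitive \<sigma> s / \<tau>) x" for x
      unfolding \<Xi>_def stretch_def r by (intro tendsto_intros Q(4)) (use \<tau>0 in simp)
    have comp_lim: "(\<lambda>m. f (\<Xi> m x)) \<longlonglongrightarrow> f (stretch e (\<lambda>s. primitive \<sigma> s / \<tau>) x)"
      if "schwartz (\<lambda>n::nat. f)" for f :: "real^'d \<Rightarrow> complex" and x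
      using schwartz_continuous[OF that] \<Xi>_lim by (intro isCont_tendsto_compose[of _ f]) (auto simp: continuous_on_eq_continuous_at)
    note Q3 = AE_coord[OF Q(3), of e]
    have g_lim: "AE x in lborel. (\<lambda>m. g m x) \<longlonglongrightarrow> of_real (if l = e then 1 else 1 + \<sigma> (x $ e) / \<tau>) * \<psi> (stretch e (\<lambda>s. primitive \<sigma> s / \<tau>) x)"
      using Q3
    proof eventually_elim
      case (elim x)
      then have "(\<lambda>m. c m x) \<longlonglongrightarrow> (if l = e then 1 else 1 + \<sigma> (x $ e) / \<tau>)"
        unfolding c_def r using \<tau>0 by (cases "l = e") (auto intro!: tendsto_intros)
      then show ?case unfolding g_def by (intro tendsto_mult tendsto_of_real comp_lim[OF \<psi>(1)])
    qed
    then show "AE x in lborel. (\<lambda>m. w m x) \<longlonglongrightarrow> of_real (if l = e then 1 else 1 + \<sigma> (x $ e) / \<tau>) * \<psi> (stretch e (\<lambda>s. primitive \<sigma> s / \<tau>) x)"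
    proof eventually_elim
      case (elim x)
      from tendsto_mult[OF b_lim elim] show ?case unfolding w_def mult_1 .
    qed
    from Q3 g_lim
    show "AE x in lborel. (\<lambda>m. pd l (w m) x) \<longlonglongrightarrow> of_real (1 + \<sigma> (x $ e) / \<tau>) * pd l \<psi> (stretch e (\<lambda>s. primitive \<sigma> s / \<tau>) x)"
    proof eventually_elim
      case (elim x)
      have "(\<lambda>m. pd l (g m) x) \<longlonglongrightarrow> of_real (1 + \<sigma> (x $ e) / \<tau>) * pd l \<psi> (stretch e (\<lambda>s. primitive \<sigma> s / \<tau>) x)"
        unfolding pd_g r using \<tau>0 elim(1)
        by (intro tendsto_mult tendsto_of_real comp_lim[OF schwartz_pd[OF \<psi>(1)]] tendsto_add tendsto_divide tendsto_const) auto
      from tendsto_add[OF tendsto_mult[OF b_lim this] tendsto_mult[OF pb_lim elim(2)]]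
      show ?case unfolding pd_w by simp
    qed
  qed
qed

section \<open>Perfect matching\<close>

definition damp :: "real \<Rightarrow> real \<Rightarrow> real \<Rightarrow> complex" where
  "damp \<tau> T t = of_real (exp (- \<tau> * t) * plateau T t)"

text \<open>The part of the time derivative of \<open>damp\<close> that falls on the plateau; the
  rest is \<open>- \<tau>\<close> times \<open>damp\<close>.\<close>

definition damp_error :: "real \<Rightarrow> real \<Rightarrow> real \<Rightarrow> complex" where
  "damp_error \<tau> T t = of_real (exp (- \<tau> * t) * deriv (plateau T) t)"

lemma Ck_damp: "Ck k (damp \<tau> T)"
  unfolding damp_def by (intro Ck_of_real_comp Ck_mult Ck_exp_linear Ck_plateau)

lemma damp_has_vector_derivative:
  "(damp \<tau> T has_vector_derivative (of_real (- \<tau>) * damp \<tau> T t + damp_error \<tau> T t)) (at t)"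
proof -
  have "((\<lambda>t. exp (- \<tau> * t) * plateau T t) has_real_derivative
      (- \<tau>) * (exp (- \<tau> * t) * plateau T t) + exp (- \<tau> * t) * deriv (plateau T) t) (at t)"
    by (auto intro!: derivative_eq_intros plateau_has_derivative)
  from has_vector_derivative_of_real[OF this]
  show ?thesis unfolding damp_def[abs_def] damp_error_def by simp
qed

lemma continuous_damp: "continuous_on UNIV (damp \<tau> T)"
  using Ck_damp[of 0] by simp

lemma continuous_damp_error: "continuous_on UNIV (damp_error \<tau> T)"
  unfolding damp_error_def by (intro continuous_intros continuous_deriv_plateau)

lemma damp_eq_0: "t \<notin> {-1..T + 1} \<Longrightarrow> damp \<tau> T t = 0"
  by (simp add: damp_def plateau_eq_0)

lemma damp_error_eq_0: "t \<notin> {-1..T + 1} \<Longrightarrow> damp_error \<tau> T t = 0"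
  by (simp add: damp_error_def deriv_plateau_eq_0)

section \<open>Linearity of the pairings, and the size of the truncation error\<close>

lemma tpair_lincomb_coefficient:
  assumes V: "L2_continuous_on UNIV V" and w: "in_L2 w"
    and a: "continuous_on UNIV a" "\<And>t. t \<notin> {\<alpha>..\<beta>} \<Longrightarrow> a t = 0"
    and b: "continuous_on UNIV b" "\<And>t. t \<notin> {\<alpha>..\<beta>} \<Longrightarrow> b t = 0"
  shows "tpair (\<lambda>t. c * a t + b t) w V p = c * tpair a w V p + tpair b w V p"
  unfolding tpair_def
  using tpair_integrable[OF V a w] tpair_integrable[OF V b w] by (simp add: distrib_right mult.assoc)

lemma tpair_add:
  assumes V: "L2_continuous_on UNIV V" and w: "in_L2 w" "in_L2 v"
    and a: "continuous_on UNIV a" "\<And>t. t \<notin> {\<alpha>..\<beta>} \<Longrightarrow> a t = 0"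
  shows "tpair a (\<lambda>x. c * w x + d * v x) V p = c * tpair a w V p + d * tpair a v V p"
proof -
  have "pairing (\<lambda>x. c * w x + d * v x) V p t = c * pairing w V p t + d * pairing v V p t" for t
    unfolding pairing_def using pairing_integrable[OF V w(1)] pairing_integrable[OF V w(2)]
    by (simp add: distrib_right mult.assoc)
  then show ?thesis
    unfolding tpair_def using tpair_integrable[OF V a w(1)] tpair_integrable[OF V a w(2)]
    by (simp add: distrib_left mult.left_commute[of "a _"])
qed

lemma in_L2_cmult: "in_L2 w \<Longrightarrow> in_L2 (\<lambda>x. c * w x)" for w :: "'a::euclidean_space \<Rightarrow> complex"
  by (rule in_L2_dominated[of w _ "cmod c"]) (auto simp: in_L2_def norm_mult)

lemma in_L2_add: "in_L2 u \<Longrightarrow> in_L2 v \<Longrightarrow> in_L2 (\<lambda>x. u x + v x)" for u v :: "'a::euclidean_space \<Rightarrow> complex"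
  using in_L2_diff[of u "\<lambda>x. - 1 * v x"] in_L2_cmult[of v "- 1"] by simp

lemma in_L2_zero: "in_L2 (\<lambda>x. 0 :: complex)"
  by (simp add: in_L2_def)

lemma in_L2_sum:
  fixes w :: "'i \<Rightarrow> 'a::euclidean_space \<Rightarrow> complex"
  shows "(\<And>i. i \<in> I \<Longrightarrow> in_L2 (w i)) \<Longrightarrow> in_L2 (\<lambda>x. \<Sum>i\<in>I. w i x)"
  by (induction I rule: infinite_finite_induct) (auto intro: in_L2_add in_L2_zero)

lemma tpair_sum:
  assumes V: "L2_continuous_on UNIV V"
    and a: "continuous_on UNIV a" "\<And>t. t \<notin> {\<alpha>..\<beta>} \<Longrightarrow> a t = 0"
  shows "(\<And>i. i \<in> I \<Longrightarrow> in_L2 (w i)) \<Longrightarrow>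
    tpair a (\<lambda>x. \<Sum>i\<in>I. c i * w i x) V p = (\<Sum>i\<in>I. c i * tpair a (w i) V p)"
proof (induction I rule: infinite_finite_induct)
  case (insert i I)
  then have "tpair a (\<lambda>x. c i * w i x + 1 * (\<Sum>i\<in>I. c i * w i x)) V p
    = c i * tpair a (w i) V p + 1 * tpair a (\<lambda>x. \<Sum>i\<in>I. c i * w i x) V p"
    by (intro tpair_add[OF V _ _ a] in_L2_sum in_L2_cmult) auto
  with insert show ?case by simp
qed (simp_all add: tpair_def pairing_def)

lemma tpair_cong_AE:
  assumes V: "L2_continuous_on UNIV V" and w: "in_L2 w" "in_L2 v"
    and eq: "\<And>t. AE x in lborel. w x * V t x $ p = v x * V t x $ p"
  shows "tpair a w V p = tpair a v V p"
proof -
  have "pairing w V p t = pairing v V p t" for t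
    unfolding pairing_def
    using pairing_integrable[OF V w(1)] pairing_integrable[OF V w(2)]
    by (intro integral_cong_AE eq borel_measurable_integrable) auto
  then show ?thesis by (simp add: tpair_def)
qed

lemma pairing_eq_0: "AE x in lborel. V t x = 0 \<Longrightarrow> pairing w V p t = 0"
  unfolding pairing_def by (rule integral_eq_zero_AE) (auto elim: eventually_mono)

text \<open>The derivative of the plateau lives on \<open>[-1, 0]\<close>, where \<open>V\<close>
  vanishes, and on \<open>[T, T + 1]\<close>, where the exponential is at most
  \<open>exp (- \<tau> * T)\<close>. The constant depends on \<open>D\<close> only through its norm,
  so it serves all weights below \<open>D\<close> and all \<tau> at once.\<close>

lemma tpair_damp_error_bound:
  fixes V :: "real \<Rightarrow> 'a::euclidean_space \<Rightarrow> complex^'m" and D :: "'a \<Rightarrow> real"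
  assumes V: "L2_continuous_on UNIV V" "\<And>t. t \<le> 0 \<Longrightarrow> AE x in lborel. V t x = 0" and D: "in_L2 D"
  obtains M where "\<And>\<tau> w p. \<tau> \<ge> 0 \<Longrightarrow> w \<in> borel_measurable borel \<Longrightarrow> AE x in lborel. cmod (w x) \<le> D x \<Longrightarrow>
    cmod (tpair (damp_error \<tau> T) w V p) \<le> M * exp (- \<tau> * T)"
proof -
  obtain B where B: "\<And>t. t \<in> {-1..T + 1} \<Longrightarrow> (LINT x|lborel. (norm (V t x))\<^sup>2) \<le> B"
    using L2_locally_bounded[OF V(1)] by blast
  define E where "E = (LINT x|lborel. (norm (D x))\<^sup>2)"
  have int: "integrable lborel (\<lambda>t. \<bar>deriv (plateau T) t\<bar>)"
    by (rule integrable_compact_support[of _ "{-1..T + 1}"])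
      (auto intro!: continuous_intros continuous_deriv_plateau deriv_plateau_eq_0)
  show ?thesis
  proof (rule that[of "(LINT t|lborel. \<bar>deriv (plateau T) t\<bar>) * ((E + B) / 2)"])
    fix \<tau> :: real and w and p :: 'm
    assume \<tau>: "\<tau> \<ge> 0" and w: "w \<in> borel_measurable borel" "AE x in lborel. cmod (w x) \<le> D x"
    have w': "AE x in lborel. cmod (w x) \<le> 1 * norm (D x)"
      using w(2) by eventually_elim simp
    have wL: "in_L2 w" by (rule in_L2_dominated[OF D w(1) w'])
    have "cmod (tpair (damp_error \<tau> T) w V p) \<le>
      (LINT t|lborel. \<bar>deriv (plateau T) t\<bar> * ((E + B) / 2 * exp (- \<tau> * T)))"
      unfolding tpair_def
    proof (rule Bochner_Integration.integral_norm_bound_integral)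
      show "integrable lborel (\<lambda>t. damp_error \<tau> T t * pairing w V p t)"
        by (rule tpair_integrable[OF V(1) continuous_damp_error damp_error_eq_0 wL])
      show "integrable lborel (\<lambda>t. \<bar>deriv (plateau T) t\<bar> * ((E + B) / 2 * exp (- \<tau> * T)))"
        using int by simp
      fix t
      show "cmod (damp_error \<tau> T t * pairing w V p t) \<le> \<bar>deriv (plateau T) t\<bar> * ((E + B) / 2 * exp (- \<tau> * T))"
      proof (cases "t \<le> 0 \<or> deriv (plateau T) t = 0")
        case True
        have "E \<ge> 0" unfolding E_def by (intro integral_nonneg_AE) auto
        moreover have "B \<ge> 0" if "deriv (plateau T) t \<noteq> 0"
        proof -
          have "t \<in> {-1..T + 1}" using that deriv_plateau_eq_0 by blast
          from order_trans[OF _ B[OF this]] show ?thesis by (simp add: integral_nonneg_AE)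
        qed
        moreover have "damp_error \<tau> T t * pairing w V p t = 0"
          using True pairing_eq_0[OF V(2)] by (auto simp: damp_error_def)
        ultimately show ?thesis by (cases "deriv (plateau T) t = 0") auto
      next
        case False
        then have t: "t \<in> {-1..T + 1}" "T \<le> t" using deriv_plateau_eq_0[of t T] by force+
        have "(LINT x|lborel. (cmod (w x))\<^sup>2) \<le> E"
          unfolding E_def
        proof (rule integral_mono_AE)
          show "AE x in lborel. (cmod (w x))\<^sup>2 \<le> (norm (D x))\<^sup>2"
            using w'
          proof eventually_elim
            case (elim x)
            then show ?case using power_mono[of "cmod (w x)" "norm (D x)" 2] by simp
          qed
        qed (use wL D in \<open>auto simp: in_L2_def\<close>)
        then have "cmod (pairing w V p t) \<le> (E + B) / 2"
          using norm_pairing_le[OF wL, of "V t" p] V(1) B[OF t(1)]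
          by (simp add: pairing_def L2_continuous_on_def)
        moreover have "exp (- \<tau> * t) \<le> exp (- \<tau> * T)"
          using \<tau> t(2) by (simp add: mult_left_mono)
        ultimately have "(exp (- \<tau> * t) * \<bar>deriv (plateau T) t\<bar>) * cmod (pairing w V p t)
            \<le> (exp (- \<tau> * T) * \<bar>deriv (plateau T) t\<bar>) * ((E + B) / 2)"
          by (intro mult_mono mult_right_mono) auto
        then show ?thesis by (simp add: damp_error_def norm_mult mult_ac)
      qed
    qed
    also have "\<dots> = (LINT t|lborel. \<bar>deriv (plateau T) t\<bar>) * ((E + B) / 2) * exp (- \<tau> * T)"
      by simp
    finally show "cmod (tpair (damp_error \<tau> T) w V p) \<le>
      (LINT t|lborel. \<bar>deriv (plateau T) t\<bar>) * ((E + B) / 2) * exp (- \<tau> * T)" .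
  qed
qed

lemma inverse_l1_weight_in_L2:
  assumes "CARD('d) \<le> q"
  shows "in_L2 (\<lambda>x::real^'d. M * inverse (l1_weight x ^ q))"
proof -
  have "integrable lborel (\<lambda>x::real^'d. M\<^sup>2 * inverse (l1_weight x ^ (2 * q)))"
    using assms by (intro integrable_mult_right integrable_inverse_l1_weight) simp
  moreover have "(norm (M * inverse (l1_weight x ^ q)))\<^sup>2 = M\<^sup>2 * inverse (l1_weight x ^ (2 * q))" for x :: "real^'d"
    unfolding real_norm_def power2_abs power_mult_distrib power_inverse
    by (simp only: power_mult[symmetric] mult.commute[of q 2])
  ultimately show ?thesis by (simp add: in_L2_def)
qed

text \<open>Multiplying the equation of block \<open>e\<close> by \<open>\<psi> \<circ> \<Xi>\<close> and those of the other blocks by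
  \<open>(1 + \<sigma> / \<tau>) (\<psi> \<circ> \<Xi>)\<close>, with the real stretching \<open>\<Xi>\<close> of \<open>x\<^sub>e\<close> by the factor \<open>1 + \<sigma> / \<tau>\<close>, the sum of the
  equations involves only the sum of the blocks, and the adjoint operator on \<open>\<psi>\<close>.\<close>

lemma stretched_identity:
  fixes A :: "'d::finite \<Rightarrow> complex^'n::finite^'n" and U :: "real \<Rightarrow> real^'d \<Rightarrow> complex^('d \<times> 'n)"
    and \<sigma> :: "real \<Rightarrow> real" and C \<tau> K B :: real
  assumes U: "L2_continuous_on UNIV U" "split_equation UNIV e A \<sigma> U F"
    and F: "F \<in> test_functions {(t, x). t > 0 \<and> x $ e < 0}"
    and \<sigma>: "\<sigma> \<in> borel_measurable borel" "AE s in lborel. \<bar>\<sigma> s\<bar> \<le> C" "C \<ge> 0"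
    and neg: "AE s in lborel. s < 0 \<longrightarrow> \<sigma> s = 0" and \<tau>: "\<tau> \<ge> 2 * (C + 1)"
    and \<psi>: "\<And>i. schwartz (\<lambda>n::nat. \<psi> i)"
    and adj: "\<And>j x. of_real \<tau> * \<psi> j x - (\<Sum>l\<in>UNIV. \<Sum>i\<in>UNIV. A l $ i $ j * pd l (\<psi> i) x) = (if j = k then \<gamma> x else 0)"
    and K: "K \<ge> 0" "\<And>i x. cmod (\<psi> i x) \<le> K * inverse (l1_weight x ^ q)" "\<And>i l x. cmod (pd l (\<psi> i) x) \<le> K * inverse (l1_weight x ^ q)"
    and q: "CARD('d) \<le> q"
    and B: "\<And>x::real^'d. cmod (cutoff x) \<le> B" "\<And>l (x::real^'d). cmod (pd l cutoff x) \<le> B" "B \<ge> 0"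
    and \<gamma>: "\<gamma> \<in> test_functions {x. x $ e < 0}"
  obtains W where "\<And>l i. W l i \<in> borel_measurable borel"
    "\<And>l i. AE x in lborel. cmod (W l i x) \<le> 4 * B * K * 2 ^ q * inverse (l1_weight x ^ q)"
    "\<And>T. (\<Sum>k'\<in>UNIV. tpair (damp \<tau> T) \<gamma> U (k', k)) =
      (\<Sum>l\<in>UNIV. \<Sum>i\<in>UNIV. tpair (damp \<tau> T) (\<psi> i) (\<lambda>t x. F (t, x)) (l, i))
      + (\<Sum>l\<in>UNIV. \<Sum>i\<in>UNIV. tpair (damp_error \<tau> T) (W l i) U (l, i))"
proof -
  have \<tau>0: "\<tau> > 0"
    by (rule less_le_trans[OF _ \<tau>]) (use \<sigma>(3) in auto)
  define \<Xi> where "\<Xi> = stretch e (\<lambda>s. primitive \<sigma> s / \<tau>)"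
  define \<theta> where "\<theta> x = 1 + \<sigma> (x $ e) / \<tau>" for x :: "real^'d"
  define W where "W l i x = of_real (if l = e then 1 else \<theta> x) * \<psi> i (\<Xi> x)" for l i x
  define V where "V l i x = of_real (\<theta> x) * pd l (\<psi> i) (\<Xi> x)" for l i x
  define P where "P i x = of_real (\<theta> x) * \<psi> i (\<Xi> x)" for i x
  define D where "D x = 4 * B * K * 2 ^ q * inverse (l1_weight x ^ q)" for x :: "real^'d"
  have DL: "in_L2 D" unfolding D_def by (rule inverse_l1_weight_in_L2[OF q])
  have coord[measurable]: "(\<lambda>x::real^'d. x $ e) \<in> borel_measurable borel"
    by (intro borel_measurable_continuous_onI continuous_intros)
  note [measurable] = \<sigma>(1) primitive_bound_measurable(2)[OF \<sigma>] schwartz_measurable[OF \<psi>] schwartz_measurable[OF schwartz_pd[OF \<psi>]]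
  have \<Xi>m[measurable]: "\<Xi> \<in> borel_measurable borel"
    unfolding \<Xi>_def stretch_def by measurable
  have \<theta>m[measurable]: "\<theta> \<in> borel_measurable borel"
    unfolding \<theta>_def by measurable
  have Wm[measurable]: "W l i \<in> borel_measurable borel" for l i
    unfolding W_def by (cases "l = e") simp_all
  have Vm[measurable]: "V l i \<in> borel_measurable borel" for l i
    unfolding V_def by measurable
  have Pm[measurable]: "P i \<in> borel_measurable borel" for i
    unfolding P_def by measurable
  have FL: "L2_continuous_on UNIV (\<lambda>t x. F (t, x))"
    by (rule test_function_L2_continuous[OF F])
  have approx: "\<exists>w. (\<forall>m. w m \<in> test_functions UNIV) \<and> (\<forall>m x. cmod (w m x) \<le> D x) \<and> (\<forall>m x. cmod (pd l (w m) x) \<le> D x) \<and>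
      (AE x in lborel. (\<lambda>m. w m x) \<longlonglongrightarrow> W l i x) \<and> (AE x in lborel. (\<lambda>m. pd l (w m) x) \<longlonglongrightarrow> V l i x)" for l i
    unfolding W_def V_def \<Xi>_def \<theta>_def D_def
    by (rule stretched_approximation[OF \<sigma> \<tau> \<psi>[of i] K(1) K(2)[of i] K(3)[of l i] B, where e = e]) blast
  \<comment> \<open>The bounds of the approximating test functions pass to their limits, almost
    everywhere only, as the limits exist almost everywhere.\<close>
  have W_D: "AE x in lborel. cmod (W l i x) \<le> D x" and V_D: "AE x in lborel. cmod (V l i x) \<le> D x" for l i
  proof -
    obtain w where w: "\<And>m x. cmod (w m x) \<le> D x" "\<And>m x. cmod (pd l (w m) x) \<le> D x"
      "AE x in lborel. (\<lambda>m. w m x) \<longlonglongrightarrow> W l i x" "AE x in lborel. (\<lambda>m. pd l (w m) x) \<longlonglongrightarrow> V l i x"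
      using approx[of l i] by blast
    show "AE x in lborel. cmod (W l i x) \<le> D x"
      using w(3) by eventually_elim (rule tendsto_upperbound[OF tendsto_norm], auto simp: w(1))
    show "AE x in lborel. cmod (V l i x) \<le> D x"
      using w(4) by eventually_elim (rule tendsto_upperbound[OF tendsto_norm], auto simp: w(2))
  qed
  have absD: "AE x in lborel. cmod (u x) \<le> 1 * norm (D x)" if "AE x in lborel. cmod (u x) \<le> D x" for u
    using that by eventually_elim simp
  have WL: "in_L2 (W l i)" for l i by (rule in_L2_dominated[OF DL Wm absD[OF W_D]])
  have VL: "in_L2 (V l i)" for l i by (rule in_L2_dominated[OF DL Vm absD[OF V_D]])
  have \<sigma>WL: "in_L2 (\<lambda>x. of_real (\<sigma> (x $ e)) * W l i x)" for l i
    by (rule coefficient_in_L2[OF WL \<sigma>(1,2)])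
  \<comment> \<open>Exhibits the common weight of all blocks as that of block \<open>e\<close> plus
    the absorption term divided by \<tau>.\<close>
  have P_W: "P i = (\<lambda>x. 1 * W e i x + of_real (1 / \<tau>) * (of_real (\<sigma> (x $ e)) * W e i x))" for i
    by (auto simp: P_def W_def \<theta>_def distrib_right)
  have PL: "in_L2 (P i)" for i
    unfolding P_W by (intro in_L2_add in_L2_cmult WL \<sigma>WL)
  have \<psi>L: "in_L2 (\<psi> i)" for i
  proof (rule in_L2_dominated[OF inverse_l1_weight_in_L2[OF q, of K], of _ 1])
    show "\<psi> i \<in> borel_measurable borel" by measurable
    show "AE x in lborel. cmod (\<psi> i x) \<le> 1 * norm (K * inverse (l1_weight x ^ q))"
      unfolding mult_1 real_norm_def by (intro AE_I2 order_trans[OF K(2) abs_ge_self])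
  qed
  have \<gamma>L: "in_L2 \<gamma>" by (rule test_function_in_L2[OF \<gamma>])
  have left: "\<Xi> x = x" if "x $ e \<le> 0" for x
    using primitive_eq_0[OF neg that] by (simp add: \<Xi>_def stretch_def)
  \<comment> \<open>The stretching also maps the closed right half-space to itself, so \<gamma>
    after the stretching vanishes there just as \<gamma> does.\<close>
  have right: "(\<Xi> x) $ e \<ge> 0" if "x $ e \<ge> 0" for x
  proof -
    have "\<bar>primitive \<sigma> (x $ e)\<bar> \<le> (C + 1) * (x $ e)"
      using primitive_bound_measurable(1)[OF \<sigma>, of "x $ e"] that by simp
    also have "\<dots> \<le> \<tau> * (x $ e)"
      using \<tau> \<sigma>(3) that by (intro mult_right_mono) auto
    finally have "\<bar>primitive \<sigma> (x $ e) / \<tau>\<bar> \<le> x $ e"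
      using \<tau>0 by (simp add: abs_divide divide_le_eq mult.commute)
    then have "0 \<le> x $ e + primitive \<sigma> (x $ e) / \<tau>" by linarith
    then show ?thesis by (simp add: \<Xi>_def stretch_def axis_def)
  qed
  have neg': "AE x::real^'d in lborel. x $ e < 0 \<longrightarrow> \<theta> x = 1"
    using AE_coord[OF neg, of e] by eventually_elim (simp add: \<theta>_def)
  have \<gamma>0: "\<gamma> x = 0" if "x $ e \<ge> 0" for x
    using \<gamma> that closure_subset[of "{x. \<gamma> x \<noteq> 0}"] by (force simp: test_functions_def)
  have F0: "F (t, x) = 0" if "x $ e \<ge> 0" for t x
    using F that closure_subset[of "{p. F p \<noteq> 0}"] by (force simp: test_functions_def)
  show ?thesis
  proof (rule that[of W])
    show "AE x in lborel. cmod (W l i x) \<le> 4 * B * K * 2 ^ q * inverse (l1_weight x ^ q)" for l i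
      using W_D unfolding D_def .
    fix T
    define a where "a = damp \<tau> T"
    define b where "b = damp_error \<tau> T"
    have a: "\<And>k. Ck k a" "\<And>t. t \<notin> {-1..T + 1} \<Longrightarrow> a t = 0"
      by (auto simp: a_def Ck_damp damp_eq_0)
    have ca: "continuous_on UNIV a" unfolding a_def by (rule continuous_damp)
    have b: "continuous_on UNIV b" "\<And>t. t \<notin> {-1..T + 1} \<Longrightarrow> b t = 0"
      by (auto simp: b_def continuous_damp_error damp_error_eq_0)
    have a': "\<And>t. (a has_vector_derivative (of_real (- \<tau>) * a t + b t)) (at t)"
      "continuous_on UNIV (\<lambda>t. of_real (- \<tau>) * a t + b t)" "\<And>t. t \<notin> {-1..T + 1} \<Longrightarrow> of_real (- \<tau>) * a t + b t = 0"
      using damp_has_vector_derivative[of \<tau> T] ca a b by (auto simp: a_def b_def intro!: continuous_intros)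
    \<comment> \<open>In block \<open>e\<close> the term \<tau> from the exponential and the
      absorption \<sigma> add up to \<tau> times \<open>1 + \<sigma> / \<tau>\<close>; in the other
      blocks the weight already contains this factor. So each block ends with the same
      \<open>P i\<close>. On the support of \<open>F\<close> the stretching is the identity and the
      factor is 1, which leaves \<psi>.\<close>
    have block: "of_real \<tau> * tpair a (P i) U (l, i) - (\<Sum>j\<in>UNIV. \<Sum>k\<in>UNIV. A l $ i $ j * tpair a (V l i) U (k, j))
        = tpair a (\<psi> i) (\<lambda>t x. F (t, x)) (l, i) + tpair b (W l i) U (l, i)" for l i
    proof -
      obtain w where w: "\<And>m. w m \<in> test_functions UNIV" "\<And>m x. cmod (w m x) \<le> D x" "\<And>m x. cmod (pd l (w m) x) \<le> D x"
        "AE x in lborel. (\<lambda>m. w m x) \<longlonglongrightarrow> W l i x" "AE x in lborel. (\<lambda>m. pd l (w m) x) \<longlonglongrightarrow> V l i x"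
        using approx[of l i] by blast
      have "- tpair (\<lambda>t. of_real (- \<tau>) * a t + b t) (W l i) U (l, i) - (\<Sum>j\<in>UNIV. \<Sum>k\<in>UNIV. A l $ i $ j * tpair a (V l i) U (k, j))
          + (if l = e then tpair a (\<lambda>x. of_real (\<sigma> (x $ e)) * W l i x) U (l, i) else 0)
        = tpair a (W l i) (\<lambda>t x. F (t, x)) (l, i)"
        by (rule weak_form_limit[OF U FL \<sigma>(1,2) a a' w(1) Wm Vm DL w(2-5)])
      moreover have "tpair (\<lambda>t. of_real (- \<tau>) * a t + b t) (W l i) U (l, i)
          = of_real (- \<tau>) * tpair a (W l i) U (l, i) + tpair b (W l i) U (l, i)"
        by (rule tpair_lincomb_coefficient[OF U(1) WL ca a(2) b])
      moreover have "of_real \<tau> * tpair a (W l i) U (l, i) + (if l = e then tpair a (\<lambda>x. of_real (\<sigma> (x $ e)) * W l i x) U (l, i) else 0)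
          = of_real \<tau> * tpair a (P i) U (l, i)"
      proof (cases "l = e")
        case True
        have "tpair a (P i) U (l, i) = 1 * tpair a (W e i) U (l, i) + of_real (1 / \<tau>) * tpair a (\<lambda>x. of_real (\<sigma> (x $ e)) * W e i x) U (l, i)"
          unfolding P_W by (rule tpair_add[OF U(1) WL \<sigma>WL ca a(2)])
        with True \<tau>0 show ?thesis by (simp add: distrib_left)
      next
        case False
        then have "W l i = P i" by (auto simp: W_def P_def)
        with False show ?thesis by simp
      qed
      moreover have "tpair a (W l i) (\<lambda>t x. F (t, x)) (l, i) = tpair a (\<psi> i) (\<lambda>t x. F (t, x)) (l, i)"
      proof (rule tpair_cong_AE[OF FL WL \<psi>L])
        fix t
        show "AE x in lborel. W l i x * F (t, x) $ (l, i) = \<psi> i x * F (t, x) $ (l, i)"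
          using neg'
        proof eventually_elim
          case (elim x)
          then show ?case
            using left[of x] F0[of x t] by (cases "x $ e < 0") (auto simp: W_def)
        qed
      qed
      \<comment> \<open>The algebra is isolated in complex variables, to be instantiated by the
        pairings above.\<close>
      moreover have "t * p - s = z + r" if "- x - s + j = y" "x = of_real (- \<tau>) * a + r" "t * a + j = t * p" "y = z"
        "t = of_real \<tau>" for t p s z r x j y a :: complex
      proof -
        have "j = y + x + s" using that(1) by (simp add: algebra_simps)
        then show ?thesis unfolding that(3)[symmetric] using that(2,4,5) by simp
      qed
      ultimately show ?thesis by blast
    qed
    \<comment> \<open>For fixed component \<open>j\<close> and solution block \<open>k'\<close>, the
      factor \<theta> comes out and leaves the adjoint equation at the stretched point. The result
      \<theta> times stretched \<gamma> is \<gamma> again: on the left nothing changes, on the right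
      both vanish.\<close>
    have bracket: "of_real \<tau> * tpair a (P j) U (k', j) - (\<Sum>l\<in>UNIV. \<Sum>i\<in>UNIV. A l $ i $ j * tpair a (V l i) U (k', j))
        = (if j = k then tpair a \<gamma> U (k', k) else 0)" for j k'
    proof -
      \<comment> \<open>The coefficients \<open>1\<close> and \<open>- 1\<close> give the integrand
        the shape of \<open>tpair_add\<close> and \<open>tpair_sum\<close>.\<close>
      have "tpair a (\<lambda>x. of_real \<tau> * P j x + (- 1) * (\<Sum>l\<in>UNIV. 1 * (\<Sum>i\<in>UNIV. A l $ i $ j * V l i x))) U (k', j)
        = of_real \<tau> * tpair a (P j) U (k', j) + (- 1) * tpair a (\<lambda>x. \<Sum>l\<in>UNIV. 1 * (\<Sum>i\<in>UNIV. A l $ i $ j * V l i x)) U (k', j)"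
        by (intro tpair_add[OF U(1) _ _ ca a(2)] PL in_L2_sum in_L2_cmult VL)
      also have "tpair a (\<lambda>x. \<Sum>l\<in>UNIV. 1 * (\<Sum>i\<in>UNIV. A l $ i $ j * V l i x)) U (k', j)
        = (\<Sum>l\<in>UNIV. 1 * tpair a (\<lambda>x. \<Sum>i\<in>UNIV. A l $ i $ j * V l i x) U (k', j))"
      proof (rule tpair_sum[OF U(1) ca])
        show "a t = 0" if "t \<notin> {-1..T + 1}" for t using that by (rule a(2))
        show "in_L2 (\<lambda>x. \<Sum>i\<in>UNIV. A l $ i $ j * V l i x)" for l
          by (intro in_L2_sum in_L2_cmult VL)
      qed
      also have "\<dots> = (\<Sum>l\<in>UNIV. \<Sum>i\<in>UNIV. A l $ i $ j * tpair a (V l i) U (k', j))"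
        unfolding mult_1 by (intro sum.cong refl tpair_sum[OF U(1) ca a(2)] VL)
      finally have 1: "of_real \<tau> * tpair a (P j) U (k', j) - (\<Sum>l\<in>UNIV. \<Sum>i\<in>UNIV. A l $ i $ j * tpair a (V l i) U (k', j))
        = tpair a (\<lambda>x. of_real \<tau> * P j x + (- 1) * (\<Sum>l\<in>UNIV. 1 * (\<Sum>i\<in>UNIV. A l $ i $ j * V l i x))) U (k', j)"
        by simp
      have 2: "of_real \<tau> * P j x + (- 1) * (\<Sum>l\<in>UNIV. 1 * (\<Sum>i\<in>UNIV. A l $ i $ j * V l i x))
          = (if j = k then of_real (\<theta> x) * \<gamma> (\<Xi> x) else 0)" for x
      proof -
        have "of_real \<tau> * P j x + (- 1) * (\<Sum>l\<in>UNIV. 1 * (\<Sum>i\<in>UNIV. A l $ i $ j * V l i x))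
          = of_real (\<theta> x) * (of_real \<tau> * \<psi> j (\<Xi> x) - (\<Sum>l\<in>UNIV. \<Sum>i\<in>UNIV. A l $ i $ j * pd l (\<psi> i) (\<Xi> x)))"
          by (simp add: P_def V_def right_diff_distrib sum_distrib_left sum_negf mult_ac)
        then show ?thesis unfolding adj by simp
      qed
      have \<gamma>\<theta>: "AE x in lborel. of_real (\<theta> x) * \<gamma> (\<Xi> x) = \<gamma> x"
        using neg'
      proof eventually_elim
        case (elim x)
        then show ?case
          using left[of x] right[of x] \<gamma>0[of x] \<gamma>0[of "\<Xi> x"] by (cases "x $ e < 0") auto
      qed
      show ?thesis
      proof (cases "j = k")
        case True
        have [measurable]: "\<gamma> \<in> borel_measurable borel" using \<gamma>L by (simp add: in_L2_def)
        have "in_L2 (\<lambda>x. of_real (\<theta> x) * \<gamma> (\<Xi> x))"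
          by (rule in_L2_dominated[OF \<gamma>L, of _ 1]) (measurable, use \<gamma>\<theta> in \<open>auto elim: eventually_mono\<close>)
        then have "tpair a (\<lambda>x. of_real (\<theta> x) * \<gamma> (\<Xi> x)) U (k', j) = tpair a \<gamma> U (k', j)"
          using \<gamma>\<theta> by (intro tpair_cong_AE[OF U(1) _ \<gamma>L]) (auto elim: eventually_mono)
        with True show ?thesis unfolding 1 2 by simp
      next
        case False
        then show ?thesis unfolding 1 2 by (simp add: tpair_def pairing_def)
      qed
    qed
    \<comment> \<open>The same fourfold sum is read in two ways: by block and component of the
      solution it is the adjoint equation, by block and component of the equation it is the weak
      form. The exchange uses pairs as indices.\<close>
    have "(\<Sum>k'\<in>UNIV. tpair a \<gamma> U (k', k)) = (\<Sum>k'\<in>UNIV. \<Sum>j\<in>UNIV. if j = k then tpair a \<gamma> U (k', k) else 0)"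
      by simp
    also have "\<dots> = (\<Sum>k'\<in>UNIV. \<Sum>j\<in>UNIV. of_real \<tau> * tpair a (P j) U (k', j))
        - (\<Sum>k'\<in>UNIV. \<Sum>j\<in>UNIV. \<Sum>l\<in>UNIV. \<Sum>i\<in>UNIV. A l $ i $ j * tpair a (V l i) U (k', j))"
      unfolding bracket[symmetric] by (simp only: sum_subtractf)
    also have "(\<Sum>k'\<in>UNIV. \<Sum>j\<in>UNIV. \<Sum>l\<in>UNIV. \<Sum>i\<in>UNIV. A l $ i $ j * tpair a (V l i) U (k', j))
        = (\<Sum>l\<in>UNIV. \<Sum>i\<in>UNIV. \<Sum>j\<in>UNIV. \<Sum>k'\<in>UNIV. A l $ i $ j * tpair a (V l i) U (k', j))"
      (is "(\<Sum>k'\<in>UNIV. \<Sum>j\<in>UNIV. \<Sum>l\<in>UNIV. \<Sum>i\<in>UNIV. ?f k' j l i) = _")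
    proof -
      have pairs: "(\<Sum>m\<in>UNIV. \<Sum>j\<in>UNIV. g m j) = (\<Sum>p\<in>UNIV. g (fst p) (snd p))" for g :: "'d \<Rightarrow> 'n \<Rightarrow> complex"
        by (simp add: sum.cartesian_product split_def)
      have "(\<Sum>k'\<in>UNIV. \<Sum>j\<in>UNIV. \<Sum>l\<in>UNIV. \<Sum>i\<in>UNIV. ?f k' j l i)
        = (\<Sum>p\<in>UNIV. \<Sum>r\<in>UNIV. ?f (fst p) (snd p) (fst r) (snd r))"
        by (simp only: pairs)
      also have "\<dots> = (\<Sum>r\<in>UNIV. \<Sum>p\<in>UNIV. ?f (fst p) (snd p) (fst r) (snd r))"
        by (rule sum.swap)
      also have "\<dots> = (\<Sum>l\<in>UNIV. \<Sum>i\<in>UNIV. \<Sum>k'\<in>UNIV. \<Sum>j\<in>UNIV. ?f k' j l i)"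
        by (simp only: pairs)
      also have "\<dots> = (\<Sum>l\<in>UNIV. \<Sum>i\<in>UNIV. \<Sum>j\<in>UNIV. \<Sum>k'\<in>UNIV. ?f k' j l i)"
        by (intro sum.cong refl sum.swap)
      finally show ?thesis .
    qed
    also have "(\<Sum>k'\<in>UNIV. \<Sum>j\<in>UNIV. of_real \<tau> * tpair a (P j) U (k', j))
        - (\<Sum>l\<in>UNIV. \<Sum>i\<in>UNIV. \<Sum>j\<in>UNIV. \<Sum>k'\<in>UNIV. A l $ i $ j * tpair a (V l i) U (k', j))
      = (\<Sum>l\<in>UNIV. \<Sum>i\<in>UNIV. tpair a (\<psi> i) (\<lambda>t x. F (t, x)) (l, i) + tpair b (W l i) U (l, i))"
      unfolding block[symmetric] by (simp only: sum_subtractf)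
    finally show "(\<Sum>k'\<in>UNIV. tpair (damp \<tau> T) \<gamma> U (k', k)) =
      (\<Sum>l\<in>UNIV. \<Sum>i\<in>UNIV. tpair (damp \<tau> T) (\<psi> i) (\<lambda>t x. F (t, x)) (l, i))
      + (\<Sum>l\<in>UNIV. \<Sum>i\<in>UNIV. tpair (damp_error \<tau> T) (W l i) U (l, i))"
      by (simp add: sum.distrib a_def b_def)
  qed (rule Wm)
qed

text \<open>Apply \<open>laplace_vanishing\<close> to the product of the plateau and
  \<open>g\<close>, which is compactly supported and equals \<open>g\<close> on
  \<open>[0, T]\<close>.\<close>

lemma eq_0_of_damped_integrals:
  fixes g :: "real \<Rightarrow> complex"
  assumes g: "continuous_on UNIV g" "\<And>t. t \<le> 0 \<Longrightarrow> g t = 0"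
    and bound: "\<And>n. n \<ge> m \<Longrightarrow> cmod (LINT t|lborel. damp (real n) T t * g t) \<le> M * exp (- real n * T)"
    and t: "t < T"
  shows "g t = 0"
proof (cases "t \<le> 0")
  case False
  have "of_real (plateau T t) * g t = 0"
  proof (rule laplace_vanishing[where S = "T + 1" and m = m and C = M and T = T])
    show "continuous_on UNIV (\<lambda>t. of_real (plateau T t) * g t)"
      using Ck_imp_continuous[OF Ck_plateau[of 0]] g(1) by (intro continuous_intros)
    show "of_real (plateau T t) * g t = 0" if "t \<notin> {0..T + 1}" for t
      using that g(2)[of t] plateau_eq_0[of t T] by (cases "t \<le> 0") auto
    show "cmod (LINT t|lborel. of_real (exp (- real n * t)) * (of_real (plateau T t) * g t)) \<le> M * exp (- real n * T)"
      if "n \<ge> m" for n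
      using bound[OF that] by (simp add: damp_def mult.assoc)
  qed fact
  with False t show ?thesis by (simp add: plateau_eq_1)
qed (simp add: g)

theorem theorem4p6:
  fixes e :: "'d::finite"
    and A :: "'d \<Rightarrow> complex^'n::finite^'n"
    and \<sigma> :: "real \<Rightarrow> real"
    and \<rho> :: real
  assumes hyperbolic: "weakly_hyperbolic A"
    and measurable: "\<sigma> \<in> borel_measurable borel"
    and bounded: "\<exists>C. AE s in lborel. \<bar>\<sigma> s\<bar> \<le> C"
    and "\<rho> > 0"
    and support: "AE s in lborel. s \<notin> {0..\<rho>} \<longrightarrow> \<sigma> s = 0"
    and nondegenerate: "nondegenerate e (split_coeff A)"
    and well_posed: "weakly_well_posed e A \<sigma>"
  shows "perfectly_matched e A \<sigma>"
  unfolding perfectly_matched_def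
proof (intro ballI allI impI, elim conjE)
  fix F :: "real \<times> (real^'d) \<Rightarrow> complex^('d \<times> 'n)" and U U' :: "real \<Rightarrow> real^'d \<Rightarrow> complex^('d \<times> 'n)" and t
  assume F: "F \<in> test_functions {(t, x). t > 0 \<and> x $ e < 0}"
    and "solves_forced e A (\<lambda>_. 0) F U" "solves_forced e A \<sigma> F U'"
  then have U: "L2_continuous_on UNIV U" "split_equation UNIV e A (\<lambda>_. 0) U F" "\<And>t. t \<le> 0 \<Longrightarrow> AE x in lborel. U t x = 0"
    and U': "L2_continuous_on UNIV U'" "split_equation UNIV e A \<sigma> U' F" "\<And>t. t \<le> 0 \<Longrightarrow> AE x in lborel. U' t x = 0"
    by (auto simp: solves_forced_def L2_eq_def)
  obtain C0 where "AE s in lborel. \<bar>\<sigma> s\<bar> \<le> C0" using bounded by blast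
  then have "AE s in lborel. \<bar>\<sigma> s\<bar> \<le> max C0 0" by eventually_elim simp
  then obtain C where C: "C \<ge> 0" "AE s in lborel. \<bar>\<sigma> s\<bar> \<le> C" by (meson max.cobounded2)
  have neg: "AE s in lborel. s < 0 \<longrightarrow> \<sigma> s = 0"
    using support by eventually_elim auto
  define q where "q = 2 * CARD('d)"
  have q: "CARD('d) \<le> q" by (simp add: q_def)
  obtain B where B: "\<And>x::real^'d. cmod (cutoff x) \<le> B" "\<And>l (x::real^'d). cmod (pd l cutoff x) \<le> B" "B \<ge> 0"
    using cutoff_bounds by metis
  have UL: "in_L2 (U t)" "in_L2 (U' t)" for t
    using U(1) U'(1) by (auto simp: L2_continuous_on_def)
  \<comment> \<open>Only the sums of the blocks are compared at this stage: the stretched identity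
    does not separate the blocks, and the space derivatives in each block act on the sum
    alone.\<close>
  have sums_eq: "(\<Sum>k'\<in>UNIV. pairing \<gamma> U (k', k) s) = (\<Sum>k'\<in>UNIV. pairing \<gamma> U' (k', k) s)"
    if \<gamma>: "\<gamma> \<in> test_functions {x. x $ e < 0}" for \<gamma> k s
  proof -
    \<comment> \<open>Any \<open>T\<close> beyond the time \<open>s\<close> would do.\<close>
    define T where "T = s + 1"
    have \<gamma>L: "in_L2 \<gamma>" by (rule test_function_in_L2[OF \<gamma>])
    obtain \<psi> where \<psi>: "\<And>i. schwartz (\<lambda>n. \<psi> n i)"
      and adj: "\<And>n j x. of_real (real (Suc n)) * \<psi> n j x - (\<Sum>l\<in>UNIV. \<Sum>i\<in>UNIV. A l $ i $ j * pd l (\<psi> n i) x) = (if j = k then \<gamma> x else 0)"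
    proof (rule stationary_adjoint_solution[OF hyperbolic test_function_schwartz[OF \<gamma>], of k])
      fix \<psi> :: "nat \<Rightarrow> 'n \<Rightarrow> real^'d \<Rightarrow> complex"
      assume "\<And>i. schwartz (\<lambda>n. \<psi> n i)"
        "\<And>n j x. of_real (real (Suc n)) * \<psi> n j x - (\<Sum>l\<in>UNIV. \<Sum>i\<in>UNIV. A l $ i $ j * pd l (\<psi> n i) x) = (if j = k then \<gamma> x else 0)"
      then show thesis by (rule that)
    qed
    have "\<exists>K\<ge>0. \<forall>n x. cmod (\<psi> n i x) \<le> K * inverse (l1_weight x ^ q)" for i
      by (rule rapid_bound[OF schwartz_rapid[OF \<psi>[of i]], where m = q]) blast
    then obtain K0 where K0: "\<And>i. K0 i \<ge> 0" "\<And>n i x. cmod (\<psi> n i x) \<le> K0 i * inverse (l1_weight x ^ q)" by metis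
    have "\<exists>K\<ge>0. \<forall>n x. cmod (pd l (\<psi> n i) x) \<le> K * inverse (l1_weight x ^ q)" for l i
      by (rule rapid_bound[OF schwartz_rapid[OF schwartz_pd[OF \<psi>[of i]]], where m = q]) blast
    then obtain K1 where K1: "\<And>l i. K1 l i \<ge> 0" "\<And>n l i x. cmod (pd l (\<psi> n i) x) \<le> K1 l i * inverse (l1_weight x ^ q)" by metis
    \<comment> \<open>One constant for all components and derivatives and for all \<tau>, so that
      \<open>D\<close>, and with it the truncation constants \<open>M\<close> and \<open>M'\<close>,
      is fixed before \<open>n\<close> is chosen.\<close>
    define K where "K = (\<Sum>i\<in>UNIV. K0 i) + (\<Sum>l\<in>UNIV. \<Sum>i\<in>UNIV. K1 l i)"
    have nonneg: "0 \<le> (\<Sum>i\<in>UNIV. K0 i)" "0 \<le> (\<Sum>l\<in>UNIV. \<Sum>i\<in>UNIV. K1 l i)"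
      by (intro sum_nonneg K0 K1)+
    have "K0 i \<le> K" for i
      using member_le_sum[of i UNIV K0] K0(1) nonneg(2) by (simp add: K_def)
    then have K2: "cmod (\<psi> n i x) \<le> K * inverse (l1_weight x ^ q)" for n i x
      by (rule order_trans[OF K0(2) mult_right_mono]) (simp add: l1_weight_nonneg)
    have "K1 l i \<le> K" for l i
    proof -
      have "K1 l i \<le> (\<Sum>i\<in>UNIV. K1 l i)"
        using K1(1) by (intro member_le_sum) auto
      also have "\<dots> \<le> (\<Sum>l\<in>UNIV. \<Sum>i\<in>UNIV. K1 l i)"
        using K1(1) by (intro member_le_sum[of l UNIV "\<lambda>l. \<Sum>i\<in>UNIV. K1 l i"]) (auto intro: sum_nonneg)
      finally show ?thesis using nonneg(1) by (simp add: K_def)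
    qed
    then have K3: "cmod (pd l (\<psi> n i) x) \<le> K * inverse (l1_weight x ^ q)" for n i l x
      by (rule order_trans[OF K1(2) mult_right_mono]) (simp add: l1_weight_nonneg)
    have K4: "K \<ge> 0" using nonneg by (simp add: K_def)
    define D where "D x = 4 * B * K * 2 ^ q * inverse (l1_weight x ^ q)" for x :: "real^'d"
    have DL: "in_L2 D" unfolding D_def by (rule inverse_l1_weight_in_L2[OF q])
    obtain M where M: "\<And>\<tau> w p. \<tau> \<ge> 0 \<Longrightarrow> w \<in> borel_measurable borel \<Longrightarrow> AE x in lborel. cmod (w x) \<le> D x \<Longrightarrow>
      cmod (tpair (damp_error \<tau> T) w U p) \<le> M * exp (- \<tau> * T)"
      using tpair_damp_error_bound[OF U(1) U(3) DL, of T] by blast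
    obtain M' where M': "\<And>\<tau> w p. \<tau> \<ge> 0 \<Longrightarrow> w \<in> borel_measurable borel \<Longrightarrow> AE x in lborel. cmod (w x) \<le> D x \<Longrightarrow>
      cmod (tpair (damp_error \<tau> T) w U' p) \<le> M' * exp (- \<tau> * T)"
      using tpair_damp_error_bound[OF U'(1) U'(3) DL, of T] by blast
    define g where "g r = (\<Sum>k'\<in>UNIV. pairing \<gamma> U (k', k) r) - (\<Sum>k'\<in>UNIV. pairing \<gamma> U' (k', k) r)" for r
    \<comment> \<open>Large enough for \<open>n \<ge> 2 * (C + 1)\<close>; the added 1 makes
      \<open>n\<close> a successor at sight, matching the index of \<psi>, which stands for
      \<open>\<tau> = Suc m\<close>.\<close>
    define n0 where "n0 = nat \<lceil>2 * (C + 1)\<rceil> + 1"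
    have "g s = 0"
    proof (rule eq_0_of_damped_integrals[where m = n0 and T = T])
      show "continuous_on UNIV g"
        unfolding g_def by (intro continuous_intros pairing_continuous U(1) U'(1) \<gamma>L)
      show "g r = 0" if "r \<le> 0" for r
        unfolding g_def using pairing_eq_0[where V = U, OF U(3)[OF that]] pairing_eq_0[where V = U', OF U'(3)[OF that]] by simp
      show "cmod (LINT r|lborel. damp (real n) T r * g r) \<le> (CARD('d) * CARD('n) * (M + M')) * exp (- real n * T)"
        if n: "n \<ge> n0" for n
      proof -
        obtain m where m: "n = Suc m" using n by (cases n) (auto simp: n0_def)
        have \<tau>: "real n \<ge> 2 * (C + 1)"
          using n real_nat_ceiling_ge[of "2 * (C + 1)"] by (simp add: n0_def)
        have \<tau>0: "real n \<ge> 2 * (0 + 1)" by (rule order_trans[OF _ \<tau>]) (use C(1) in simp)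
        have \<psi>': "schwartz (\<lambda>j::nat. \<psi> m i)" for i by (rule schwartz_single[OF \<psi>])
        obtain W where W: "\<And>l i. W l i \<in> borel_measurable borel" "\<And>l i. AE x in lborel. cmod (W l i x) \<le> D x"
          "\<And>T. (\<Sum>k'\<in>UNIV. tpair (damp (real n) T) \<gamma> U' (k', k)) =
            (\<Sum>l\<in>UNIV. \<Sum>i\<in>UNIV. tpair (damp (real n) T) (\<psi> m i) (\<lambda>t x. F (t, x)) (l, i))
            + (\<Sum>l\<in>UNIV. \<Sum>i\<in>UNIV. tpair (damp_error (real n) T) (W l i) U' (l, i))"
          by (rule stretched_identity[OF U'(1,2) F measurable C(2,1) neg \<tau> \<psi>' adj[of m, folded m] K4 K2 K3 q B \<gamma>]) (rule that, unfold D_def)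
        have zero: "(\<lambda>_::real. 0::real) \<in> borel_measurable borel" "AE s in lborel. \<bar>(\<lambda>_::real. 0::real) s\<bar> \<le> 0"
          "(0::real) \<ge> 0" "AE s in lborel. s < 0 \<longrightarrow> (\<lambda>_::real. 0::real) s = 0"
          by auto
        \<comment> \<open>The same identity for absorption 0 with bound 0. Its terms with
          \<open>F\<close> contain the same \<psi> as in the case of absorption, so they cancel in
          the difference and only truncation errors remain.\<close>
        obtain W0 where W0: "\<And>l i. W0 l i \<in> borel_measurable borel" "\<And>l i. AE x in lborel. cmod (W0 l i x) \<le> D x"
          "\<And>T. (\<Sum>k'\<in>UNIV. tpair (damp (real n) T) \<gamma> U (k', k)) =
            (\<Sum>l\<in>UNIV. \<Sum>i\<in>UNIV. tpair (damp (real n) T) (\<psi> m i) (\<lambda>t x. F (t, x)) (l, i))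
            + (\<Sum>l\<in>UNIV. \<Sum>i\<in>UNIV. tpair (damp_error (real n) T) (W0 l i) U (l, i))"
          by (rule stretched_identity[OF U(1,2) F zero \<tau>0 \<psi>' adj[of m, folded m] K4 K2 K3 q B \<gamma>]) (rule that, unfold D_def)
        note int = tpair_integrable[OF U(1) continuous_damp damp_eq_0 \<gamma>L] tpair_integrable[OF U'(1) continuous_damp damp_eq_0 \<gamma>L]
        have "(LINT r|lborel. damp (real n) T r * g r)
          = (\<Sum>k'\<in>UNIV. tpair (damp (real n) T) \<gamma> U (k', k)) - (\<Sum>k'\<in>UNIV. tpair (damp (real n) T) \<gamma> U' (k', k))"
          unfolding g_def tpair_def using int by (simp add: right_diff_distrib sum_distrib_left)
        also have "\<dots> = (\<Sum>l\<in>UNIV. \<Sum>i\<in>UNIV. tpair (damp_error (real n) T) (W0 l i) U (l, i) - tpair (damp_error (real n) T) (W l i) U' (l, i))"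
          unfolding W(3) W0(3) by (simp add: sum_subtractf)
        also have "cmod \<dots> \<le> (\<Sum>l\<in>(UNIV::'d set). \<Sum>i\<in>(UNIV::'n set). (M + M') * exp (- real n * T))"
        proof (intro sum_norm_le)
          fix l i
          have "cmod (tpair (damp_error (real n) T) (W0 l i) U (l, i) - tpair (damp_error (real n) T) (W l i) U' (l, i))
            \<le> cmod (tpair (damp_error (real n) T) (W0 l i) U (l, i)) + cmod (tpair (damp_error (real n) T) (W l i) U' (l, i))"
            by (rule norm_triangle_ineq4)
          also have "\<dots> \<le> M * exp (- real n * T) + M' * exp (- real n * T)"
            by (intro add_mono M M' W W0) auto
          finally show "cmod (tpair (damp_error (real n) T) (W0 l i) U (l, i) - tpair (damp_error (real n) T) (W l i) U' (l, i))
            \<le> (M + M') * exp (- real n * T)" by (simp add: distrib_right)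
        qed
        finally show ?thesis by (simp add: mult.assoc)
      qed
    qed (simp add: T_def)
    then show ?thesis by (simp add: g_def)
  qed
  \<comment> \<open>Given the sums, each block obeys in \<open>x_e < 0\<close> an ordinary
    differential equation in time with known right-hand side, the same for both solutions and
    without absorption. Damping turns it into the factor \<open>n\<close> times the damped
    difference.\<close>
  have blocks_eq: "pairing w U (l, i) s = pairing w U' (l, i) s"
    if w: "w \<in> test_functions {x. x $ e < 0}" for w l i s
  proof -
    define T where "T = s + 1"
    have w': "w \<in> test_functions UNIV" by (rule test_functions_mono[OF _ w]) simp
    have wL: "in_L2 w" by (rule test_function_in_L2[OF w])
    then have nL: "in_L2 (\<lambda>x. cmod (w x))" by (auto simp: in_L2_def)
    obtain M where M: "\<And>\<tau> v p. \<tau> \<ge> 0 \<Longrightarrow> v \<in> borel_measurable borel \<Longrightarrow> AE x in lborel. cmod (v x) \<le> cmod (w x) \<Longrightarrow>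
      cmod (tpair (damp_error \<tau> T) v U p) \<le> M * exp (- \<tau> * T)"
      using tpair_damp_error_bound[OF U(1) U(3) nL, of T] by blast
    obtain M' where M': "\<And>\<tau> v p. \<tau> \<ge> 0 \<Longrightarrow> v \<in> borel_measurable borel \<Longrightarrow> AE x in lborel. cmod (v x) \<le> cmod (w x) \<Longrightarrow>
      cmod (tpair (damp_error \<tau> T) v U' p) \<le> M' * exp (- \<tau> * T)"
      using tpair_damp_error_bound[OF U'(1) U'(3) nL, of T] by blast
    have wm: "w \<in> borel_measurable borel" using wL by (simp add: in_L2_def)
    define g where "g r = pairing w U (l, i) r - pairing w U' (l, i) r" for r
    have "g s = 0"
    proof (rule eq_0_of_damped_integrals[where m = 1 and T = T])
      show "continuous_on UNIV g"
        unfolding g_def by (intro continuous_intros pairing_continuous U(1) U'(1) wL)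
      show "g r = 0" if "r \<le> 0" for r
        unfolding g_def using pairing_eq_0[where V = U, OF U(3)[OF that]] pairing_eq_0[where V = U', OF U'(3)[OF that]] by simp
      show "cmod (LINT r|lborel. damp (real n) T r * g r) \<le> (M + M') * exp (- real n * T)"
        if n: "n \<ge> 1" for n
      proof -
        define a where "a = damp (real n) T"
        define b where "b = damp_error (real n) T"
        have a: "\<And>k. Ck k a" "\<And>t. t \<notin> {-1..T + 1} \<Longrightarrow> a t = 0"
          by (auto simp: a_def Ck_damp damp_eq_0)
        have ca: "continuous_on UNIV a" unfolding a_def by (rule continuous_damp)
        have b: "continuous_on UNIV b" "\<And>t. t \<notin> {-1..T + 1} \<Longrightarrow> b t = 0"
          by (auto simp: b_def continuous_damp_error damp_error_eq_0)
        have a': "\<And>t. (a has_vector_derivative (of_real (- real n) * a t + b t)) (at t)"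
          "continuous_on UNIV (\<lambda>t. of_real (- real n) * a t + b t)" "\<And>t. t \<notin> {-1..T + 1} \<Longrightarrow> of_real (- real n) * a t + b t = 0"
          using damp_has_vector_derivative[of "real n" T] ca a b by (auto simp: a_def b_def intro!: continuous_intros)
        note FL = test_function_L2_continuous[OF F]
        \<comment> \<open>Derivatives of \<open>w\<close> are again test functions of the
          half-space, so \<open>sums_eq\<close> applies to them.\<close>
        have sum_pd: "(\<Sum>j\<in>UNIV. \<Sum>k\<in>UNIV. A l $ i $ j * tpair a (pd l w) U (k, j))
          = (\<Sum>j\<in>UNIV. \<Sum>k\<in>UNIV. A l $ i $ j * tpair a (pd l w) U' (k, j))"
        proof -
          note pL = test_function_in_L2[OF test_function_pd[OF w], of l]
          have "(\<Sum>k\<in>UNIV. tpair a (pd l w) U (k, j)) = (\<Sum>k\<in>UNIV. tpair a (pd l w) U' (k, j))" for j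
          proof -
            have "(\<Sum>k\<in>UNIV. tpair a (pd l w) V (k, j)) = (LINT r|lborel. a r * (\<Sum>k\<in>UNIV. pairing (pd l w) V (k, j) r))"
              if "L2_continuous_on UNIV V" for V :: "real \<Rightarrow> real^'d \<Rightarrow> complex^('d \<times> 'n)"
              unfolding tpair_def using tpair_integrable[OF that ca a(2) pL] by (simp add: sum_distrib_left)
            then show ?thesis using U(1) U'(1) sums_eq[OF test_function_pd[OF w]] by simp
          qed
          then show ?thesis by (simp add: sum_distrib_left[symmetric])
        qed
        have \<sigma>0: "tpair a (\<lambda>x. of_real (\<sigma> (x $ e)) * w x) U' (l, i) = 0"
        proof -
          have "AE x in lborel. of_real (\<sigma> (x $ e)) * w x = 0"
            using AE_coord[OF neg, of e]
          proof eventually_elim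
            case (elim x)
            have "w x = 0" if "\<not> x $ e < 0"
              using w that closure_subset[of "{x. w x \<noteq> 0}"] by (force simp: test_functions_def)
            with elim show ?case by auto
          qed
          then have "pairing (\<lambda>x. of_real (\<sigma> (x $ e)) * w x) U' (l, i) r = 0" for r
            unfolding pairing_def by (intro integral_eq_zero_AE) (auto elim: eventually_mono)
          then show ?thesis by (simp add: tpair_def)
        qed
        have \<sigma>00: "tpair a (\<lambda>x. of_real ((\<lambda>_. 0) (x $ e)) * w x) U (l, i) = 0"
          by (simp add: tpair_def pairing_def)
        have zb: "AE s in lborel. \<bar>(\<lambda>_::real. 0::real) s\<bar> \<le> 0" by simp
        have zm: "(\<lambda>_::real. 0::real) \<in> borel_measurable borel" by simp
        have eqU: "- tpair (\<lambda>t. of_real (- real n) * a t + b t) w U (l, i) - (\<Sum>j\<in>UNIV. \<Sum>k\<in>UNIV. A l $ i $ j * tpair a (pd l w) U (k, j))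
          = tpair a w (\<lambda>t x. F (t, x)) (l, i)"
          using weak_form[OF U(1,2) FL zm zb a a' w', where l = l and i = i] unfolding \<sigma>00 by simp
        have eqU': "- tpair (\<lambda>t. of_real (- real n) * a t + b t) w U' (l, i) - (\<Sum>j\<in>UNIV. \<Sum>k\<in>UNIV. A l $ i $ j * tpair a (pd l w) U' (k, j))
          = tpair a w (\<lambda>t x. F (t, x)) (l, i)"
          using weak_form[OF U'(1,2) FL measurable C(2) a a' w', where l = l and i = i] unfolding \<sigma>0 by simp
        have "of_real (real n) * (tpair a w U (l, i) - tpair a w U' (l, i)) = tpair b w U (l, i) - tpair b w U' (l, i)"
        proof -
          have "tpair (\<lambda>t. of_real (- real n) * a t + b t) w U (l, i) = tpair (\<lambda>t. of_real (- real n) * a t + b t) w U' (l, i)"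
            using trans[OF eqU eqU'[symmetric]] unfolding sum_pd by simp
          moreover have "tpair (\<lambda>t. of_real (- real n) * a t + b t) w U (l, i) = of_real (- real n) * tpair a w U (l, i) + tpair b w U (l, i)"
            by (rule tpair_lincomb_coefficient[OF U(1) wL ca a(2) b])
          moreover have "tpair (\<lambda>t. of_real (- real n) * a t + b t) w U' (l, i) = of_real (- real n) * tpair a w U' (l, i) + tpair b w U' (l, i)"
            by (rule tpair_lincomb_coefficient[OF U'(1) wL ca a(2) b])
          ultimately have "of_real (- real n) * tpair a w U (l, i) + tpair b w U (l, i) = of_real (- real n) * tpair a w U' (l, i) + tpair b w U' (l, i)"
            by metis
          then show ?thesis by (simp add: algebra_simps)
        qed
        then have "real n * cmod (tpair a w U (l, i) - tpair a w U' (l, i)) = cmod (tpair b w U (l, i) - tpair b w U' (l, i))"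
          by (metis norm_mult norm_of_real abs_of_nat)
        \<comment> \<open>For \<open>n \<ge> 1\<close> the factor \<open>n\<close> only helps and is
          dropped.\<close>
        moreover have "cmod (tpair a w U (l, i) - tpair a w U' (l, i)) \<le> real n * cmod (tpair a w U (l, i) - tpair a w U' (l, i))"
          using n mult_right_mono[of 1 "real n" "cmod (tpair a w U (l, i) - tpair a w U' (l, i))"] by simp
        moreover have "cmod (tpair b w U (l, i) - tpair b w U' (l, i)) \<le> M * exp (- real n * T) + M' * exp (- real n * T)"
          unfolding b_def using M[OF _ wm, of "real n" "(l, i)"] M'[OF _ wm, of "real n" "(l, i)"]
          by (intro order_trans[OF norm_triangle_ineq4] add_mono) auto
        moreover have "(LINT r|lborel. damp (real n) T r * g r) = tpair a w U (l, i) - tpair a w U' (l, i)"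
          using tpair_integrable[OF U(1) ca a(2) wL] tpair_integrable[OF U'(1) ca a(2) wL]
          by (simp add: tpair_def g_def a_def right_diff_distrib)
        ultimately show ?thesis by (simp add: distrib_right)
      qed
    qed (simp add: T_def)
    then show ?thesis by (simp add: g_def)
  qed
  \<comment> \<open>Equality of the pairings with the box bumps gives equality almost everywhere,
    one component at a time; the index set of the components is finite.\<close>
  have "AE x in lborel. x $ e < 0 \<longrightarrow> (U t x - U' t x) $ p = 0" for p
  proof (rule AE_zero_of_box_bump_integrals[OF in_L2_diff[OF UL]])
    fix a b :: "real^'d" and n :: nat
    assume ab: "cbox a b \<subseteq> {x. x $ e < 0}" and n: "n > 0"
    have w: "box_bump (real n) a b \<in> test_functions {x. x $ e < 0}"
      using ab n by (intro box_bump_test_function) auto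
    have "pairing (box_bump (real n) a b) U p t = pairing (box_bump (real n) a b) U' p t"
      using blocks_eq[OF w, of "fst p" "snd p"] by simp
    then show "(LINT x|lborel. box_bump (real n) a b x * (U t x - U' t x) $ p) = 0"
      using in_L2_product_integrable[OF test_function_in_L2[OF w] UL(1)] in_L2_product_integrable[OF test_function_in_L2[OF w] UL(2)]
      by (simp add: pairing_def right_diff_distrib)
  qed
  then have "AE x in lborel. \<forall>p\<in>UNIV. x $ e < 0 \<longrightarrow> (U t x - U' t x) $ p = 0"
    by (subst AE_finite_all) auto
  then show "AE x in lborel. x $ e < 0 \<longrightarrow> U t x = U' t x"
    by eventually_elim (auto simp: vec_eq_iff)
qed

end
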